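(* Let $\Gamma$ be a discrete, co-finite subgroup of $\mathrm{SL}_2(\mathbb{R})$ with a cusp at $\infty$ of width $1$, and let $f\in\mathcal{S}_2(\Gamma)$. Then the map $s(\Gamma)\to\mathbb{C}$ defined by $$r\mapsto L(f\otimes e(r),1),$$ where we put $L(f\otimes e(\infty),1)=0$, is a quantum modular form of weight zero for $\Gamma$.
   Context: $s(\Gamma)\subset\mathbb{R}\cup\{\infty\}$ denotes the set of cusps of $\Gamma$ (fixed points of parabolic elements of $\Gamma$), on which $\Gamma$ acts by M\"obius transformations. For $\gamma=\begin{pmatrix}a&b\\c&d\end{pmatrix}$, $j(\gamma,z)=cz+d$. Write $e(x)=e^{2\pi i x}$ and let $f(z)=\sum_{n\ge1}a_f(n)e^{2\pi i nz}$ be the Fourier expansion of $f$ at $\infty$. Additive twists (weight $2$): for $r\in\mathbb{R}$, $L(f\otimes e(r),s):=\sum_{n\ge1}a_f(n)e(nr)n^{-s}$ for $\operatorname{Re}s>3/2$. If $r\in s(\Gamma)\setminus\{\infty\}$, this admits analytic continuation to all $s\in\mathbb{C}$, given by $L(f\otimes e(r),s)=\frac{(2\pi)^s}{\Gamma(s)}\int_0^\infty f(r+iy)y^{s-1}\,dy$; the values at $s=1$ in the claim are those of this continuation. Quantum modular form: let $S$ be a finite set and $h:s(\Gamma)\setminus S\to\mathbb{C}$ a map. Then $h$ is a quantum modular form of weight $\kappa$ for $\Gamma$ if for all $\gamma\in\Gamma$ the function $g_\gamma:s(\Gamma)\setminus(S\cup\gamma^{-1}S)\to\mathbb{C}$,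 $g_\gamma(r):=h(\gamma r)-j(\gamma,r)^{\kappa}h(r)$, extends to a continuous function $\mathbb{P}^1(\mathbb{R})\setminus(S\cup\gamma^{-1}S)\to\mathbb{C}$. In the claim, $S=\emptyset$ and $\kappa=0$, so that $j(\gamma,r)^{\kappa}=1$ for all $r\in s(\Gamma)$, including $r=\infty$ and $r=\gamma^{-1}\infty$. *)

theory Defs
  imports "HOL-Algebra.Group" "HOL-Complex_Analysis.Complex_Analysis"
begin

definition SL2R :: "(real^2^2) monoid" where
  "SL2R = \<lparr>carrier = {A. det A = 1}, monoid.mult = (**), one = mat 1\<rparr>"

lemma group_SL2R: "group SL2R"
proof (rule groupI)
  fix A assume A: "A \<in> carrier SL2R"
  then have "invertible A"
    by (simp add: SL2R_def invertible_det_nz)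
  then obtain B where B: "A ** B = mat 1" "B ** A = mat 1"
    unfolding invertible_def by blast
  have "det A * det B = 1"
    by (metis B(1) det_mul det_I)
  with A have "B \<in> carrier SL2R"
    by (simp add: SL2R_def)
  with B show "\<exists>B\<in>carrier SL2R. B \<otimes>\<^bsub>SL2R\<^esub> A = \<one>\<^bsub>SL2R\<^esub>"
    by (auto simp: SL2R_def)
qed (auto simp: SL2R_def det_mul det_I matrix_mul_assoc)

definition upper_half_plane :: "complex set" where
  "upper_half_plane = {z. Im z > 0}"

definition mobius :: "real^2^2 \<Rightarrow> complex \<Rightarrow> complex" where
  "mobius A z = (of_real (A$1$1) * z + of_real (A$1$2)) / (of_real (A$2$1) * z + of_real (A$2$2))"

definition jfac :: "real^2^2 \<Rightarrow> complex \<Rightarrow> complex" where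
  "jfac A z = of_real (A$2$1) * z + of_real (A$2$2)"

text \<open>The real projective line is the one-point compactification of the reals: \<open>Some x\<close> is the
  real point \<open>x\<close>, and \<open>None\<close> is the point at infinity.\<close>

type_synonym P1R = "real option"

abbreviation P1R_topology :: "P1R topology" where
  "P1R_topology \<equiv> Alexandroff_compactification (euclidean :: real topology)"

fun mobius_P1 :: "real^2^2 \<Rightarrow> P1R \<Rightarrow> P1R" where
  "mobius_P1 A (Some x) =
     (if A$2$1 * x + A$2$2 = 0 then None
      else Some ((A$1$1 * x + A$1$2) / (A$2$1 * x + A$2$2)))"
| "mobius_P1 A None = (if A$2$1 = 0 then None else Some (A$1$1 / A$2$1))"

definition parabolic :: "real^2^2 \<Rightarrow> bool" where
  "parabolic A \<longleftrightarrow> det A = 1 \<and> \<bar>trace A\<bar> = 2 \<and> A \<noteq> mat 1 \<and> A \<noteq> - mat 1"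

definition cusps :: "(real^2^2) set \<Rightarrow> P1R set" where
  "cusps \<Gamma> = {r. \<exists>A\<in>\<Gamma>. parabolic A \<and> mobius_P1 A r = r}"

definition discrete_subgroup :: "(real^2^2) set \<Rightarrow> bool" where
  "discrete_subgroup \<Gamma> \<longleftrightarrow> subgroup \<Gamma> SL2R \<and> discrete \<Gamma>"

definition hyperbolic_area :: "complex set \<Rightarrow> ennreal" where
  "hyperbolic_area F = (\<integral>\<^sup>+z\<in>F. ennreal (1 / (Im z)\<^sup>2) \<partial>lborel)"

text \<open>The area of the quotient of the upper half plane by \<open>\<Gamma>\<close> is the area of any Borel set of
  orbit representatives.\<close>

definition cofinite_subgroup :: "(real^2^2) set \<Rightarrow> bool" where
  "cofinite_subgroup \<Gamma> \<longleftrightarrow>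
     (\<exists>F. F \<in> sets borel \<and> F \<subseteq> upper_half_plane \<and>
          (\<forall>z\<in>upper_half_plane. \<exists>!w. w \<in> F \<and> (\<exists>A\<in>\<Gamma>. w = mobius A z)) \<and>
          hyperbolic_area F < \<infinity>)"

definition translation :: "real \<Rightarrow> real^2^2" where
  "translation t = vector [vector [1, t], vector [0, 1]]"

text \<open>The width is read off in \<open>PSL\<^sub>2\<close>: the stabiliser of infinity in \<open>\<plusminus>\<Gamma>\<close> is generated by \<open>- mat 1\<close>
  and the translation by \<open>w\<close>. The group \<open>\<Gamma>\<close> itself need not contain \<open>- mat 1\<close>.\<close>

definition cusp_at_infinity_of_width :: "(real^2^2) set \<Rightarrow> real \<Rightarrow> bool" where
  "cusp_at_infinity_of_width \<Gamma> w \<longleftrightarrow>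
     None \<in> cusps \<Gamma> \<and> w > 0 \<and>
     {A. (A \<in> \<Gamma> \<or> - A \<in> \<Gamma>) \<and> mobius_P1 A None = None} =
     {A. \<exists>n::int. A = translation (of_int n * w) \<or> A = - translation (of_int n * w)}"

definition slash :: "int \<Rightarrow> (complex \<Rightarrow> complex) \<Rightarrow> real^2^2 \<Rightarrow> complex \<Rightarrow> complex" where
  "slash k f A z = jfac A z powi (- k) * f (mobius A z)"

text \<open>Cusp forms vanish at every cusp \<open>\<sigma> \<infinity>\<close>. The limit is taken as \<open>Im z\<close> tends to infinity,
  uniformly in \<open>Re z\<close>.\<close>

definition cusp_forms :: "int \<Rightarrow> (real^2^2) set \<Rightarrow> (complex \<Rightarrow> complex) set" where
  "cusp_forms k \<Gamma> = {f. f holomorphic_on upper_half_plane \<and>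
     (\<forall>A\<in>\<Gamma>. \<forall>z\<in>upper_half_plane. slash k f A z = f z) \<and>
     (\<forall>\<sigma>\<in>carrier SL2R. mobius_P1 \<sigma> None \<in> cusps \<Gamma> \<longrightarrow>
        (slash k f \<sigma> \<longlongrightarrow> 0) (filtercomap Im at_top))}"

definition fourier_e :: "complex \<Rightarrow> complex" where
  "fourier_e x = exp (2 * of_real pi * \<i> * x)"

text \<open>The Fourier coefficients at infinity of a cusp form when the width is 1; the coefficient
  at index 0 is fixed to 0.\<close>

definition fourier_coeff :: "(complex \<Rightarrow> complex) \<Rightarrow> nat \<Rightarrow> complex" where
  "fourier_coeff f = (THE a. a 0 = 0 \<and>
     (\<forall>z\<in>upper_half_plane. (\<lambda>n. a (Suc n) * fourier_e (of_nat (Suc n) * z)) sums f z))"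

text \<open>The additive twist in weight 2: the entire function that continues the Dirichlet series
  from \<open>Re s > 3/2\<close> (unique by the identity theorem).\<close>

definition twisted_L :: "(complex \<Rightarrow> complex) \<Rightarrow> real \<Rightarrow> complex \<Rightarrow> complex" where
  "twisted_L f r = (THE L. L holomorphic_on UNIV \<and>
     (\<forall>s. Re s > 3/2 \<longrightarrow>
        (\<lambda>n. fourier_coeff f (Suc n) * fourier_e (of_nat (Suc n) * of_real r) *
             of_nat (Suc n) powr (- s)) sums L s))"

text \<open>At infinity \<open>jfac\<close> is evaluated on the representative \<open>(1, 0)\<close>, that is, \<open>j(\<gamma>, \<infinity>) = c\<close>.
  In weight 0 all the factors are 1 (\<open>0 powi 0 = 1\<close>), also where \<open>jfac\<close> is zero.\<close>

definition jfac_P1 :: "real^2^2 \<Rightarrow> P1R \<Rightarrow> complex" where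
  "jfac_P1 A r = (case r of Some x \<Rightarrow> jfac A (of_real x) | None \<Rightarrow> of_real (A$2$1))"

text \<open>Only the values of \<open>h\<close> on \<open>cusps \<Gamma> - S\<close> matter.\<close>

definition quantum_modular_form ::
  "int \<Rightarrow> (real^2^2) set \<Rightarrow> P1R set \<Rightarrow> (P1R \<Rightarrow> complex) \<Rightarrow> bool" where
  "quantum_modular_form \<kappa> \<Gamma> S h \<longleftrightarrow> finite S \<and>
     (\<forall>A\<in>\<Gamma>. \<exists>G.
        continuous_map (subtopology P1R_topology (UNIV - (S \<union> mobius_P1 A -` S))) euclidean G \<and>
        (\<forall>r \<in> cusps \<Gamma> - (S \<union> mobius_P1 A -` S).
           G r = h (mobius_P1 A r) - jfac_P1 A r powi \<kappa> * h r))"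

end

(* The form f has weight 2, so f(z) dz is invariant under the group. Let P be the primitive of f that
   vanishes at infinity. For every A in the group, P(A z) - P(z) is a constant c. At each cusp r the
   primitive P has a limit V(r), and V(infinity) = 0. The twisted L-value h(r) at s = 1 is 2 pi i V(r), so
   h(A r) - h(r) equals 2 pi i c for every cusp r, and a constant function is continuous.

   The analytic content is the convergence of the Dirichlet series for Re s > 3/2, which follows from
   the boundedness of Im z |f(z)| by Parseval's identity. The boundedness needs a case of Siegel's
   theorem on groups of finite coarea. A point which is moved by every element of the group by a
   definite amount lies in finitely many orbits of balls, because disjoint balls use up area. If a
   nontrivial A moves z very little, then we walk away from the axis, fixed point or cusp of A until
   the displacement has a fixed size; discreteness forces small elements to commute, so the walk ends at
   a point of the first kind. Hence only finitely many centralizers occur up to conjugation. Those of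
   hyperbolic and elliptic elements contain no elements arbitrarily close to 1, and for parabolic ones z
   lies deep in a cusp, where f decays. *)

theory Submission
  imports Defs
begin

text \<open>The analytic work is forced by the definite description in \<open>twisted_L\<close>: its
  value at 1 is meaningful only once an entire function agrees with the series on all of Re s > 3/2.
  Bounded height, used coefficient by coefficient, gives a(n) = O(n) and reaches only Re s > 2. A
  mean square bound on the first N coefficients, followed by Cauchy-Schwarz, gains the missing
  factor N^(1/2).

  Finite coarea supplies a Borel set of representatives without any shape: no sides, no cusp
  neighbourhoods. Bounded height is therefore obtained by counting and area alone. An element A is
  compared at different points z through the matrices \<open>cj z A\<close>, whose norm records how
  far A moves z. Within one centralizer the point enters only through one positive number, so that
  leaving the thin part becomes a problem in one real variable.

  Signs need care: \<Gamma> may or may not contain \<open>- mat 1\<close>, and smallness always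
  means closeness to \<open>mat 1\<close>.\<close>

no_notation fps_nth (infixl "$" 75)

section \<open>Two-by-two matrices and discrete groups\<close>

definition mat2 :: "real \<Rightarrow> real \<Rightarrow> real \<Rightarrow> real \<Rightarrow> real^2^2" where
  "mat2 a b c d = vector [vector [a, b], vector [c, d]]"

lemma mat2_nth [simp]:
  "mat2 a b c d $ 1 $ 1 = a" "mat2 a b c d $ 1 $ 2 = b"
  "mat2 a b c d $ 2 $ 1 = c" "mat2 a b c d $ 2 $ 2 = d"
  by (simp_all add: mat2_def vector_2)

lemma mat2_eq_iff:
  fixes A B :: "real^2^2"
  shows "A = B \<longleftrightarrow> A$1$1 = B$1$1 \<and> A$1$2 = B$1$2 \<and> A$2$1 = B$2$1 \<and> A$2$2 = B$2$2"
  by (auto simp: vec_eq_iff forall_2)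

lemma mult_nth [simp]:
  fixes A B :: "real^2^2"
  shows "(A ** B) $ i $ j = A$i$1 * B$1$j + A$i$2 * B$2$j"
  by (simp add: matrix_matrix_mult_def sum_2)

lemma mult_diff_distrib2:
  fixes A B C :: "real^2^2"
  shows "A ** (B - C) = A ** B - A ** C" "(B - C) ** A = B ** A - C ** A"
  by (simp_all add: mat2_eq_iff algebra_simps)

lemma mat_nth [simp]:
  "(mat k :: real^2^2) $ 1 $ 1 = k" "(mat k :: real^2^2) $ 1 $ 2 = 0"
  "(mat k :: real^2^2) $ 2 $ 1 = 0" "(mat k :: real^2^2) $ 2 $ 2 = k"
  by (simp_all add: mat_def)

lemma trace2: "trace (A::real^2^2) = A$1$1 + A$2$2"
  by (simp add: trace_def sum_2)

text \<open>The adjugate serves as the inverse on determinant 1. It is linear in the entries, keeps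
  the norm, and equals \<open>mat (trace A) - A\<close>, so commuting with it is the same as
  commuting with \<open>A\<close>.\<close>

definition adj2 :: "real^2^2 \<Rightarrow> real^2^2" where
  "adj2 A = mat2 (A$2$2) (- A$1$2) (- A$2$1) (A$1$1)"

lemma det_adj2 [simp]: "det (adj2 A) = det A"
  by (simp add: adj2_def det_2)

lemma adj2_inverse:
  assumes "det A = 1"
  shows "A ** adj2 A = mat 1" "adj2 A ** A = mat 1"
  using assms by (auto simp: mat2_eq_iff adj2_def det_2 algebra_simps)

lemma norm_sq_mat2:
  fixes A :: "real^2^2"
  shows "(norm A)\<^sup>2 = (A$1$1)\<^sup>2 + (A$1$2)\<^sup>2 + (A$2$1)\<^sup>2 + (A$2$2)\<^sup>2"
  by (simp add: norm_vec_def L2_set_def sum_2 real_sqrt_pow2 sum_nonneg)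

lemma norm_adj2 [simp]: "norm (adj2 A) = norm A"
proof -
  have "(norm (adj2 A))\<^sup>2 = (norm A)\<^sup>2"
    unfolding norm_sq_mat2 by (simp add: adj2_def)
  then show ?thesis by simp
qed

text \<open>The norm is the Frobenius norm: Cauchy-Schwarz for each of the four entries, and
  \<open>id\<close> splits the product of the square norms accordingly.\<close>

lemma norm_mult2_le:
  fixes A B :: "real^2^2"
  shows "norm (A ** B) \<le> norm A * norm B"
proof -
  have cs: "(a * x + b * y)\<^sup>2 \<le> (a\<^sup>2 + b\<^sup>2) * (x\<^sup>2 + y\<^sup>2)" for a b x y :: real
    using zero_le_power2[of "a * y - b * x"]
    by (simp add: power2_eq_square algebra_simps)
  have id: "(p + q + r + s) * (t + u + v + w) = (p + q) * (t + v) + (p + q) * (u + w) + (r + s) * (t + v) + (r + s) * (u + w)"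
    for p q r s t u v w :: real by (simp add: algebra_simps)
  have "(norm (A ** B))\<^sup>2 \<le> (norm A * norm B)\<^sup>2"
    unfolding power_mult_distrib norm_sq_mat2 id mult_nth
    by (intro add_mono cs)
  then show ?thesis by (simp add: power2_le_iff_abs_le abs_mult)
qed

lemma norm_entry_le: "\<bar>A $ i $ j\<bar> \<le> norm (A::real^2^2)"
  by (rule order_trans[OF component_le_norm_cart Finite_Cartesian_Product.norm_nth_le])

lemma norm_mat1_2: "norm (mat 1 :: real^2^2) = sqrt 2"
proof -
  have "(norm (mat 1 :: real^2^2))\<^sup>2 = 2" by (simp add: norm_sq_mat2)
  then show ?thesis by (metis norm_ge_zero real_sqrt_unique)
qed

lemma SL2R_carrier [simp]: "A \<in> carrier SL2R \<longleftrightarrow> det A = 1"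
  by (simp add: SL2R_def)

section \<open>Discrete matrix groups and uniform counting\<close>

definition matgroup :: "(real^2^2) set \<Rightarrow> bool" where
  "matgroup L \<longleftrightarrow> mat 1 \<in> L \<and> (\<forall>A\<in>L. det A = 1) \<and> (\<forall>A\<in>L. adj2 A \<in> L) \<and> (\<forall>A\<in>L. \<forall>B\<in>L. A ** B \<in> L)"

text \<open>Discreteness at the identity with a visible radius; by the group law it controls the
  gaps between all elements of bounded norm.\<close>

definition isolated1 :: "real \<Rightarrow> (real^2^2) set \<Rightarrow> bool" where
  "isolated1 \<epsilon> L \<longleftrightarrow> \<epsilon> > 0 \<and> (\<forall>A\<in>L. norm (A - mat 1) < \<epsilon> \<longrightarrow> A = mat 1)"

lemma discrete_subgroup_matgroup:
  assumes "discrete_subgroup \<Gamma>"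
  shows "matgroup \<Gamma>" "\<exists>\<epsilon>. isolated1 \<epsilon> \<Gamma>"
proof -
  interpret group SL2R by (rule group_SL2R)
  have sub: "subgroup \<Gamma> SL2R" using assms by (simp add: discrete_subgroup_def)
  have one: "mat 1 \<in> \<Gamma>" using subgroup.one_closed[OF sub] by (simp add: SL2R_def)
  have det: "det A = 1" if "A \<in> \<Gamma>" for A
    using subgroup.mem_carrier[OF sub that] by simp
  have "adj2 A \<in> \<Gamma>" if A: "A \<in> \<Gamma>" for A
  proof -
    have "adj2 A \<otimes>\<^bsub>SL2R\<^esub> A = \<one>\<^bsub>SL2R\<^esub>"
      using adj2_inverse(2)[OF det[OF A]] by (simp add: SL2R_def)
    then have "inv\<^bsub>SL2R\<^esub> A = adj2 A"
      using det[OF A] by (intro inv_equality) auto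
    with subgroup.m_inv_closed[OF sub A] show ?thesis by simp
  qed
  moreover have "A ** B \<in> \<Gamma>" if "A \<in> \<Gamma>" "B \<in> \<Gamma>" for A B
    using subgroup.m_closed[OF sub that] by (simp add: SL2R_def)
  ultimately show "matgroup \<Gamma>" using one det by (auto simp: matgroup_def)
  have "mat 1 isolated_in \<Gamma>" using assms one by (simp add: discrete_subgroup_def discrete_def)
  then obtain e where "e > 0" "\<forall>y\<in>\<Gamma>. dist (mat 1) y < e \<longrightarrow> y = mat 1"
    unfolding isolated_in_dist_Ex_iff by blast
  then have "isolated1 e \<Gamma>" by (simp add: isolated1_def dist_norm norm_minus_commute)
  then show "\<exists>\<epsilon>. isolated1 \<epsilon> \<Gamma>" ..
qed

lemma matgroupD:
  assumes "matgroup L"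
  shows "mat 1 \<in> L" "\<And>A. A \<in> L \<Longrightarrow> det A = 1" "\<And>A. A \<in> L \<Longrightarrow> adj2 A \<in> L"
    "\<And>A B. A \<in> L \<Longrightarrow> B \<in> L \<Longrightarrow> A ** B \<in> L"
  using assms by (auto simp: matgroup_def)

text \<open>The bound \<open>M\<close> is uniform in the group. It will be applied to the images of
  \<Gamma> under \<open>cj p\<close> for all points \<open>p\<close> of the thick part at
  once.\<close>

definition packing_bound :: "real \<Rightarrow> real \<Rightarrow> nat \<Rightarrow> bool" where
  "packing_bound \<epsilon> R M \<longleftrightarrow> (\<forall>L. matgroup L \<longrightarrow> isolated1 \<epsilon> L \<longrightarrow>
     finite {A\<in>L. norm A \<le> R} \<and> card {A\<in>L. norm A \<le> R} \<le> M)"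

text \<open>Since A^-1 B - 1 = A^-1 (B - A), two elements of norm at most \<open>R\<close> that are
  closer than \<eta> coincide. Total boundedness of the ball gives finitely many cells, each holding
  at most one element, and the number of cells does not depend on the group.\<close>

lemma packing:
  assumes "\<epsilon> > 0"
  obtains M where "packing_bound \<epsilon> R M"
proof -
  define \<eta> where "\<eta> = \<epsilon> / (\<bar>R\<bar> + 1)"
  have eta: "\<eta> > 0" using assms by (simp add: \<eta>_def add_nonneg_pos)
  have "compact (cball (0::real^2^2) R)" by simp
  then obtain k where k: "finite k" "cball (0::real^2^2) R \<subseteq> (\<Union>x\<in>k. ball x (\<eta>/2))"
    using eta unfolding compact_eq_totally_bounded by (meson half_gt_zero)
  show ?thesis
  proof (rule that[of "card k"], unfold packing_bound_def, intro allI impI)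
    fix L :: "(real^2^2) set"
    assume L: "matgroup L" and iso: "isolated1 \<epsilon> L"
    let ?S = "{A\<in>L. norm A \<le> R}"
    define c where "c = (\<lambda>A. SOME x. x \<in> k \<and> A \<in> ball x (\<eta>/2))"
    have c: "c A \<in> k \<and> A \<in> ball (c A) (\<eta>/2)" if "A \<in> ?S" for A
    proof -
      have "A \<in> cball 0 R" using that by simp
      then have "\<exists>x. x \<in> k \<and> A \<in> ball x (\<eta>/2)" using k by blast
      then show ?thesis unfolding c_def by (rule someI_ex)
    qed
    have "inj_on c ?S"
    proof (rule inj_onI)
      fix A B assume A: "A \<in> ?S" and B: "B \<in> ?S" and eq: "c A = c B"
      have cd: "dist (c A) A < \<eta>/2" "dist (c A) B < \<eta>/2"
        using c[OF A] c[OF B] eq by auto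
      have "dist A B < \<eta>" using cd by (rule dist_triangle_half_r)
      then have d: "norm (B - A) < \<eta>" by (simp add: dist_norm norm_minus_commute)
      have dA: "det A = 1" using A matgroupD(2)[OF L] by auto
      have "adj2 A ** B - mat 1 = adj2 A ** (B - A)"
        by (simp add: mult_diff_distrib2 adj2_inverse[OF dA])
      then have "norm (adj2 A ** B - mat 1) \<le> norm A * norm (B - A)"
        using norm_mult2_le[of "adj2 A" "B - A"] by simp
      also have "\<dots> \<le> \<bar>R\<bar> * norm (B - A)" using A by (intro mult_right_mono) auto
      also have "\<dots> < \<epsilon>"
      proof -
        have "\<bar>R\<bar> * norm (B - A) \<le> (\<bar>R\<bar> + 1) * norm (B - A)" by (simp add: mult_right_mono)
        also have "\<dots> < (\<bar>R\<bar> + 1) * \<eta>" using d by (intro mult_strict_left_mono) auto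
        also have "\<dots> = \<epsilon>" by (simp add: \<eta>_def)
        finally show ?thesis .
      qed
      finally have "adj2 A ** B = mat 1"
        using iso matgroupD(4)[OF L matgroupD(3)[OF L, of A], of B] A B by (simp add: isolated1_def)
      then have "A ** (adj2 A ** B) = A" by simp
      then show "A = B" by (simp add: matrix_mul_assoc adj2_inverse[OF dA])
    qed
    moreover have "c ` ?S \<subseteq> k" using c by auto
    ultimately have "card ?S \<le> card k" "finite ?S"
      by (rule card_inj_on_le[OF _ _ k(1)], rule inj_on_finite[OF _ _ k(1)])
    then show "finite ?S \<and> card ?S \<le> card k" by simp
  qed
qed

lemma finite_bounded_matgroup:
  assumes "matgroup L" "isolated1 \<epsilon> L"
  shows "finite {A\<in>L. norm A \<le> R}"
proof -
  have "\<epsilon> > 0" using assms by (simp add: isolated1_def)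
  from packing[OF this, of R] show ?thesis using assms unfolding packing_bound_def by blast
qed

lemma countable_matgroup:
  assumes "matgroup L" "isolated1 \<epsilon> L"
  shows "countable L"
proof -
  have fin: "finite {A\<in>L. norm A \<le> R}" for R :: real
    by (rule finite_bounded_matgroup[OF assms])
  have "L \<subseteq> (\<Union>n::nat. {A\<in>L. norm A \<le> real n})"
    using real_arch_simple by blast
  moreover have "countable (\<Union>n::nat. {A\<in>L. norm A \<le> real n})"
    using fin countable_finite by blast
  ultimately show ?thesis by (rule countable_subset)
qed

section \<open>The hyperbolic plane and commuting small elements\<close>

lemma mobius_denom_nonzero:
  assumes "det A = 1" "Im z > 0"
  shows "jfac A z \<noteq> 0"
proof
  assume 0: "jfac A z = 0"
  have "Im (jfac A z) = A$2$1 * Im z" "Re (jfac A z) = A$2$1 * Re z + A$2$2"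
    by (simp_all add: jfac_def)
  with 0 assms(2) have "A$2$1 = 0" "A$2$2 = 0" by auto
  with assms(1) show False by (simp add: det_2)
qed

lemma Im_mobius:
  assumes "det A = 1"
  shows "Im (mobius A z) = Im z / (cmod (jfac A z))\<^sup>2"
proof -
  have "A$1$1 * A$2$2 = 1 + A$1$2 * A$2$1" using assms by (simp add: det_2)
  then have "(A$1$1 * Im z) * (A$2$1 * Re z + A$2$2) - (A$1$1 * Re z + A$1$2) * (A$2$1 * Im z) = Im z"
    by algebra
  then show ?thesis
    by (simp add: mobius_def jfac_def Im_divide cmod_power2)
qed

lemma mobius_upper:
  assumes "det A = 1" "Im z > 0"
  shows "Im (mobius A z) > 0"
  using assms mobius_denom_nonzero[OF assms] by (simp add: Im_mobius)

lemma mobius_mult_jfac: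
  assumes "det B = 1" "Im z > 0"
  shows "jfac (A ** B) z = jfac A (mobius B z) * jfac B z"
    and "mobius (A ** B) z = mobius A (mobius B z)"
proof -
  have j: "of_real (B$2$1) * z + of_real (B$2$2) \<noteq> (0::complex)"
    using mobius_denom_nonzero[OF assms] by (simp add: jfac_def)
  show jj: "jfac (A ** B) z = jfac A (mobius B z) * jfac B z"
    using j by (simp add: jfac_def mobius_def field_simps)
  have "mobius A (mobius B z) = ((of_real (A$1$1) * mobius B z + of_real (A$1$2)) * jfac B z) / (jfac A (mobius B z) * jfac B z)"
    using mobius_denom_nonzero[OF assms] by (simp add: mobius_def[of A] jfac_def[of A])
  also have "(of_real (A$1$1) * mobius B z + of_real (A$1$2)) * jfac B z
      = of_real ((A**B)$1$1) * z + of_real ((A**B)$1$2)"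
    using j by (simp add: jfac_def mobius_def field_simps)
  finally show "mobius (A ** B) z = mobius A (mobius B z)"
    unfolding jj[symmetric] by (simp add: mobius_def[of "A**B"] jfac_def)
qed

lemma mobius_mat1 [simp]: "mobius (mat 1) z = z"
  by (simp add: mobius_def)

lemma mobius_adj2:
  assumes "det A = 1" "Im z > 0"
  shows "mobius (adj2 A) (mobius A z) = z" "mobius A (mobius (adj2 A) z) = z"
  using mobius_mult_jfac(2)[OF assms, of "adj2 A"] mobius_mult_jfac(2)[of "adj2 A" z A] assms
  by (simp_all add: adj2_inverse)

text \<open>In terms of the hyperbolic distance \<open>d\<close> this is \<open>2 cosh d - 2\<close>.\<close>

definition hdist :: "complex \<Rightarrow> complex \<Rightarrow> real" where
  "hdist z w = (cmod (z - w))\<^sup>2 / (Im z * Im w)"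

lemma hdist_mobius:
  assumes "det A = 1" "Im z > 0" "Im w > 0"
  shows "hdist (mobius A z) (mobius A w) = hdist z w"
proof -
  let ?p = "jfac A z" and ?q = "jfac A w"
  have nz: "?p \<noteq> 0" "?q \<noteq> 0" using assms mobius_denom_nonzero by auto
  have d: "of_real (A$1$1) * of_real (A$2$2) - of_real (A$1$2) * of_real (A$2$1) = (1::complex)"
    using arg_cong[OF assms(1), of complex_of_real] by (simp add: det_2)
  have "(mobius A z - mobius A w) * (?p * ?q) =
     (of_real (A$1$1) * z + of_real (A$1$2)) * ?q - (of_real (A$1$1) * w + of_real (A$1$2)) * ?p"
  proof -
    have "mobius A z * ?p = of_real (A$1$1) * z + of_real (A$1$2)"
      "mobius A w * ?q = of_real (A$1$1) * w + of_real (A$1$2)"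
      using nz by (simp_all add: mobius_def jfac_def)
    moreover have "(mobius A z - mobius A w) * (?p * ?q) = (mobius A z * ?p) * ?q - (mobius A w * ?q) * ?p"
      by (simp add: algebra_simps)
    ultimately show ?thesis by simp
  qed
  also have "\<dots> = (of_real (A$1$1) * of_real (A$2$2) - of_real (A$1$2) * of_real (A$2$1)) * (z - w)"
    unfolding jfac_def by (simp add: algebra_simps)
  also have "\<dots> = z - w" unfolding d by simp
  finally have "mobius A z - mobius A w = (z - w) / (?p * ?q)" using nz by (simp add: eq_divide_eq)
  then show ?thesis
    using nz by (simp add: hdist_def Im_mobius[OF assms(1)] norm_divide norm_mult power_divide power_mult_distrib)
qed

lemma hdist_sym: "hdist z w = hdist w z"
  by (simp add: hdist_def norm_minus_commute mult.commute)

lemma hdist_ratio: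
  assumes "Im z > 0" "Im w > 0" "hdist z w \<le> 1"
  shows "Im w \<le> 3 * Im z"
proof (rule ccontr)
  assume "\<not> Im w \<le> 3 * Im z"
  then have gt: "Im w > 3 * Im z" by simp
  have "(Im z - Im w)\<^sup>2 \<le> (cmod (z - w))\<^sup>2"
    using abs_Im_le_cmod[of "z - w"] by (metis abs_le_square_iff abs_norm_cancel minus_complex.sel(2))
  also have "\<dots> \<le> Im z * Im w" using assms by (simp add: hdist_def divide_le_eq)
  finally have *: "(Im w - Im z)\<^sup>2 \<le> Im z * Im w" by (simp add: power2_commute)
  \<comment> \<open>The difference of the heights exceeds 2/3 of \<open>Im w\<close>, so its square
    is at least 4/9 of the square of \<open>Im w\<close>, against at most 1/3 for the product of the
    heights.\<close>
  have "(Im w * (2/3)) * (Im w * (2/3)) \<le> (Im w - Im z) * (Im w - Im z)"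
    using gt assms by (intro mult_mono) auto
  moreover have "Im z * Im w \<le> (Im w * (1/3)) * Im w"
    using gt assms by (intro mult_right_mono) auto
  moreover have "0 < Im w * Im w" using assms by simp
  ultimately show False using * by (simp add: power2_eq_square)
qed

text \<open>\<open>hdist\<close> is not a metric. Comparable heights and (a + b)^2 \<le> 2 a^2 + 2
  b^2 replace the triangle inequality; 12 is 2 * 3 + 2 * 3.\<close>

lemma hdist_quasi_triangle:
  assumes "Im z > 0" "Im w > 0" "Im v > 0" "hdist z w \<le> 1" "hdist w v \<le> 1"
  shows "hdist z v \<le> 12"
proof -
  have 1: "Im w \<le> 3 * Im z" "Im w \<le> 3 * Im v"
    using hdist_ratio[of z w] hdist_ratio[of v w] assms hdist_sym[of w v] by auto
  have "cmod (z - v) \<le> cmod (z - w) + cmod (w - v)"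
    using norm_triangle_ineq[of "z - w" "w - v"] by simp
  then have "(cmod (z - v))\<^sup>2 \<le> (cmod (z - w) + cmod (w - v))\<^sup>2" by (simp add: power_mono)
  also have "\<dots> \<le> 2 * (cmod (z - w))\<^sup>2 + 2 * (cmod (w - v))\<^sup>2"
    using zero_le_power2[of "cmod (z - w) - cmod (w - v)"] by (simp add: power2_eq_square algebra_simps)
  also have "\<dots> \<le> 2 * (Im z * Im w) + 2 * (Im w * Im v)"
    using assms by (intro add_mono mult_left_mono) (auto simp: hdist_def divide_le_eq)
  also have "\<dots> \<le> 2 * (Im z * (3 * Im v)) + 2 * ((3 * Im z) * Im v)"
    using assms 1 by (intro add_mono mult_left_mono mult_right_mono) auto
  finally show ?thesis using assms by (simp add: hdist_def divide_le_eq mult.commute)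
qed

text \<open>The matrix \<open>A\<close> seen from the point \<open>z\<close>: the conjugate of \<open>A\<close> by the affine map that sends
  \<open>\<i>\<close> to \<open>z\<close>.\<close>

definition cj :: "complex \<Rightarrow> real^2^2 \<Rightarrow> real^2^2" where
  "cj z A = mat2 (A$1$1 - A$2$1 * Re z)
     ((A$1$2 + (A$1$1 - A$2$2) * Re z - A$2$1 * (Re z)\<^sup>2) / Im z)
     (A$2$1 * Im z) (A$2$2 + A$2$1 * Re z)"

lemma cj_mult:
  assumes "Im z > 0"
  shows "cj z (A ** B) = cj z A ** cj z B"
  using assms by (simp add: mat2_eq_iff cj_def field_simps power2_eq_square)

lemma cj_mat [simp]: "cj z (mat k) = mat k"
  by (simp add: mat2_eq_iff cj_def)

lemma cj_add: "cj z (A + B) = cj z A + cj z B"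
  by (simp add: mat2_eq_iff cj_def algebra_simps add_divide_distrib diff_divide_distrib)

lemma cj_diff: "cj z (A - B) = cj z A - cj z B"
  by (simp add: mat2_eq_iff cj_def algebra_simps add_divide_distrib diff_divide_distrib)

lemma cj_scaleR: "cj z (r *\<^sub>R A) = r *\<^sub>R cj z A"
  by (simp add: mat2_eq_iff cj_def algebra_simps add_divide_distrib diff_divide_distrib)

lemma cj_adj2: "adj2 (cj z A) = cj z (adj2 A)"
  by (simp add: mat2_eq_iff cj_def adj2_def algebra_simps add_divide_distrib diff_divide_distrib)

lemma det_cj:
  assumes "Im z > 0"
  shows "det (cj z A) = det A"
  using assms by (simp add: cj_def det_2 field_simps power2_eq_square)

lemma trace_cj: "trace (cj z A) = trace A"
  by (simp add: cj_def trace2)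

lemma cj_eq_0:
  assumes "Im z > 0" "cj z A = 0"
  shows "A = 0"
proof -
  have e: "A$1$1 - A$2$1 * Re z = 0" "A$2$1 * Im z = 0" "A$2$2 + A$2$1 * Re z = 0"
    "A$1$2 + (A$1$1 - A$2$2) * Re z - A$2$1 * (Re z)\<^sup>2 = 0"
    using assms by (auto simp: mat2_eq_iff cj_def)
  then have "A$2$1 = 0" using assms by simp
  with e show ?thesis by (simp add: mat2_eq_iff)
qed

lemma cj_inject:
  assumes "Im z > 0" "cj z A = cj z B"
  shows "A = B"
  using cj_eq_0[of z "A - B"] assms by (simp add: cj_diff)

text \<open>The quadratic polynomial whose zeros are the fixed points of \<open>A\<close>:
  \<open>z - mobius A z\<close> is its value divided by \<open>jfac A z\<close>.\<close>

definition qform :: "real^2^2 \<Rightarrow> complex \<Rightarrow> complex" where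
  "qform A z = of_real (A$2$1) * z\<^sup>2 + of_real (A$2$2 - A$1$1) * z - of_real (A$1$2)"

lemma norm_cj:
  assumes "Im z > 0"
  shows "(norm (cj z A))\<^sup>2 = 2 * det A + (cmod (qform A z))\<^sup>2 / (Im z)\<^sup>2"
  using assms unfolding norm_sq_mat2 cmod_power2 qform_def
  by (simp add: cj_def det_2 power2_eq_square field_simps)

lemma hdist_self_mobius:
  assumes "det A = 1" "Im z > 0"
  shows "hdist z (mobius A z) = (cmod (qform A z))\<^sup>2 / (Im z)\<^sup>2"
proof -
  have nz: "jfac A z \<noteq> 0" using assms mobius_denom_nonzero by auto
  have "z - mobius A z = qform A z / jfac A z"
    using nz by (simp add: mobius_def qform_def jfac_def field_simps power2_eq_square)
  then show ?thesis
    using nz assms by (simp add: hdist_def Im_mobius norm_divide power_divide power2_eq_square)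
qed

text \<open>With d the hyperbolic distance from \<open>z\<close> to its image, the right side is 2
  cosh d: the norm of the conjugate measures displacement.\<close>

lemma norm_cj_det1:
  assumes "det A = 1" "Im z > 0"
  shows "(norm (cj z A))\<^sup>2 = 2 + hdist z (mobius A z)"
  using norm_cj[of z A] hdist_self_mobius[OF assms] assms by simp

lemma norm_diff_mat1:
  fixes A :: "real^2^2"
  shows "(norm (A - mat 1))\<^sup>2 = (norm A)\<^sup>2 - 2 * trace A + 2"
  unfolding norm_sq_mat2 by (simp add: trace2 power2_eq_square algebra_simps)

lemma trace_conj:
  assumes "det B = 1"
  shows "trace (B ** A ** adj2 B) = trace A"
proof -
  have "B$1$1 * B$2$2 - B$1$2 * B$2$1 = 1" using assms by (simp add: det_2)
  then show ?thesis by (simp add: trace2 adj2_def) algebra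
qed

text \<open>For determinant 1 the distance to the identity depends on the trace and the displacement
  alone, and moving \<open>z\<close> and \<open>A\<close> together by \<open>B\<close> changes
  neither.\<close>

lemma norm_cj_conj:
  assumes "det A = 1" "det B = 1" "Im z > 0"
  shows "norm (cj (mobius B z) (B ** A ** adj2 B) - mat 1) = norm (cj z A - mat 1)"
proof -
  have up: "Im (mobius B z) > 0" using mobius_upper assms by simp
  have d: "det (B ** A ** adj2 B) = 1" using assms by (simp add: det_mul)
  have "mobius (B ** A ** adj2 B) (mobius B z) = mobius B (mobius A z)"
    using assms up by (simp add: mobius_mult_jfac mobius_adj2 mobius_upper det_mul)
  then have "hdist (mobius B z) (mobius (B ** A ** adj2 B) (mobius B z)) = hdist z (mobius A z)"
    using hdist_mobius[OF assms(2,3) mobius_upper[OF assms(1,3)]] by simp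
  then have "(norm (cj (mobius B z) (B ** A ** adj2 B) - mat 1))\<^sup>2 = (norm (cj z A - mat 1))\<^sup>2"
    unfolding norm_diff_mat1 norm_cj_det1[OF d up] norm_cj_det1[OF assms(1,3)] trace_cj
    by (simp add: trace_conj[OF assms(2)])
  then show ?thesis by simp
qed

lemma matgroup_cj:
  assumes "matgroup L" "Im z > 0"
  shows "matgroup (cj z ` L)"
  unfolding matgroup_def
proof (intro conjI ballI)
  show "mat 1 \<in> cj z ` L" using matgroupD(1)[OF assms(1)] by (metis cj_mat imageI)
qed (use assms in \<open>auto simp: det_cj cj_adj2 cj_mult[symmetric] matgroup_def\<close>)


section \<open>Centralizers, and commutators of elements near the identity\<close>

lemma mult_scaleR2 [simp]:
  fixes A B :: "real^2^2"
  shows "A ** (r *\<^sub>R B) = r *\<^sub>R (A ** B)" "(r *\<^sub>R A) ** B = r *\<^sub>R (A ** B)"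
  by (simp_all add: mat2_eq_iff algebra_simps)

lemma mult_add_distrib2:
  fixes A B C :: "real^2^2"
  shows "A ** (B + C) = A ** B + A ** C" "(B + C) ** A = B ** A + C ** A"
  by (simp_all add: mat2_eq_iff algebra_simps)

lemma det_scaleR2: "det (r *\<^sub>R (A::real^2^2)) = r\<^sup>2 * det A"
  by (simp add: det_2 power2_eq_square algebra_simps)

lemma det_mat_plus_traceless:
  fixes N :: "real^2^2"
  assumes "trace N = 0"
  shows "det (mat p + q *\<^sub>R N) = p\<^sup>2 + q\<^sup>2 * det N"
proof -
  have n: "N$2$2 = - N$1$1" using assms by (simp add: trace2)
  show ?thesis by (simp add: det_2 n power2_eq_square algebra_simps)
qed

lemma mat_commute: "mat k ** (B::real^2^2) = B ** mat k"
  by (simp add: mat2_eq_iff)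

lemma adj2_mult: "adj2 (A ** B) = adj2 B ** adj2 A"
  by (simp add: mat2_eq_iff adj2_def algebra_simps)

lemma adj2_adj2 [simp]: "adj2 (adj2 A) = A"
  by (simp add: mat2_eq_iff adj2_def)

lemma commute_adj2:
  assumes "adj2 A ** B = B ** adj2 A"
  shows "A ** B = B ** A"
proof -
  have "adj2 A = mat (trace A) - A" by (simp add: mat2_eq_iff adj2_def trace2)
  with assms show ?thesis by (simp add: mult_diff_distrib2 mat_commute)
qed

text \<open>In a commutator a matrix counts only through its two off-diagonal entries and the
  difference of its diagonal entries. Commuting says that the two triples have vanishing cross
  product, so the triple of \<open>C\<close> is a multiple of the nonzero triple of
  \<open>N\<close>.\<close>

lemma centralizer_traceless:
  fixes N C :: "real^2^2"
  assumes tr: "trace N = 0" and nz: "N \<noteq> 0" and comm: "C ** N = N ** C"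
  obtains p q where "C = mat p + q *\<^sub>R N"
proof -
  have n: "N$2$2 = - N$1$1" using tr by (simp add: trace2)
  have c: "(C ** N) $ i $ j = (N ** C) $ i $ j" for i j using comm by simp
  have e1: "C$1$2 * N$2$1 = N$1$2 * C$2$1"
    using c[of 1 1] by (simp add: mult.commute)
  have e2: "(C$1$1 - C$2$2) * N$1$2 = 2 * N$1$1 * C$1$2"
    using c[of 1 2] unfolding mult_nth n left_diff_distrib by (simp add: mult.commute)
  have e3: "(C$1$1 - C$2$2) * N$2$1 = 2 * N$1$1 * C$2$1"
    using c[of 2 1] unfolding mult_nth n left_diff_distrib by (simp add: mult.commute mult.left_commute)
  note e = e1 e2 e3
  have "\<exists>q. C$1$2 = q * N$1$2 \<and> C$2$1 = q * N$2$1 \<and> C$1$1 - C$2$2 = 2 * q * N$1$1"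
  proof -
    consider "N$1$2 \<noteq> 0" | "N$2$1 \<noteq> 0" | "N$1$2 = 0" "N$2$1 = 0" "N$1$1 \<noteq> 0"
      using nz n by (auto simp: mat2_eq_iff)
    then show ?thesis
    proof cases
      case 1 then show ?thesis using e by (intro exI[of _ "C$1$2 / N$1$2"]) (simp add: field_simps)
    next
      case 2 then show ?thesis using e by (intro exI[of _ "C$2$1 / N$2$1"]) (simp add: field_simps)
    next
      case 3 then show ?thesis using e
        by (intro exI[of _ "(C$1$1 - C$2$2) / (2 * N$1$1)"]) (simp add: field_simps)
    qed
  qed
  then obtain q where q: "C$1$2 = q * N$1$2" "C$2$1 = q * N$2$1" "C$1$1 - C$2$2 = 2 * q * N$1$1" by blast
  then have "C = mat (C$1$1 - q * N$1$1) + q *\<^sub>R N"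
    using n by (simp add: mat2_eq_iff)
  then show ?thesis by (rule that)
qed

text \<open>Conjugation by \<open>B\<close> multiplies \<open>N\<close> by \<open>q\<close>, so
  conjugating \<open>mat 1 + N\<close> repeatedly gives \<open>mat 1 + q ^ k *\<^sub>R N\<close>.
  For |q| < 1 these are nontrivial elements tending to the identity, against discreteness.\<close>

lemma no_contracting_conjugation:
  assumes L: "matgroup L" "isolated1 \<epsilon> L" and B: "B \<in> L" and A: "mat 1 + N \<in> L" and nz: "N \<noteq> 0"
    and BN: "B ** N = q *\<^sub>R (N ** B)"
  shows "\<bar>q\<bar> \<ge> 1"
proof (rule ccontr)
  assume "\<not> \<bar>q\<bar> \<ge> 1"
  then have q: "\<bar>q\<bar> < 1" by simp
  have dB: "det B = 1" using matgroupD(2)[OF L(1) B] .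
  have conj: "B ** (x *\<^sub>R N) ** adj2 B = (x * q) *\<^sub>R N" for x
  proof -
    have "B ** (x *\<^sub>R N) ** adj2 B = (x * q) *\<^sub>R (N ** B ** adj2 B)"
      using BN by simp
    also have "N ** B ** adj2 B = N" by (simp add: matrix_mul_assoc[symmetric] adj2_inverse[OF dB])
    finally show ?thesis .
  qed
  have mem: "mat 1 + q ^ k *\<^sub>R N \<in> L" for k
  proof (induction k)
    case 0 then show ?case using A by simp
  next
    case (Suc k)
    have "B ** (mat 1 + q ^ k *\<^sub>R N) ** adj2 B = B ** adj2 B + B ** (q ^ k *\<^sub>R N) ** adj2 B"
      by (simp add: mult_add_distrib2)
    also have "\<dots> = mat 1 + q ^ Suc k *\<^sub>R N" unfolding conj adj2_inverse[OF dB] by (simp add: mult.commute)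
    finally show ?case
      using matgroupD(4)[OF L(1) matgroupD(4)[OF L(1) B Suc] matgroupD(3)[OF L(1) B]] by simp
  qed
  have q0: "q \<noteq> 0"
  proof
    assume "q = 0"
    then have "B ** N = 0" using BN by simp
    then have "adj2 B ** B ** N = 0" by (simp add: matrix_mul_assoc[symmetric])
    with nz show False by (simp add: adj2_inverse[OF dB])
  qed
  have "(\<lambda>k. \<bar>q\<bar> ^ k * norm N) \<longlonglongrightarrow> 0 * norm N"
    using q by (intro tendsto_intros LIMSEQ_power_zero) auto
  then have "eventually (\<lambda>k. \<bar>q\<bar> ^ k * norm N < \<epsilon>) sequentially"
    using L(2) by (auto simp: isolated1_def elim: order_tendstoD)
  then obtain k where "\<bar>q\<bar> ^ k * norm N < \<epsilon>" by (auto simp: eventually_sequentially)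
  then have "norm ((mat 1 + q ^ k *\<^sub>R N) - mat 1) < \<epsilon>" by (simp add: power_abs)
  then have "mat 1 + q ^ k *\<^sub>R N = mat 1" using L(2) mem[of k] by (auto simp: isolated1_def)
  with q0 nz show False by simp
qed

text \<open>If \<open>A\<close> commutes with its commutator with \<open>B\<close>, it commutes with
  its conjugate \<open>C\<close> by \<open>B\<close>. So \<open>C\<close> is p + q N with
  \<open>N\<close> the traceless part of \<open>A\<close>, and equal traces give B N = q N B.
  Determinants leave q = 1, q = -1 or a nilpotent \<open>N\<close>; in the last case discreteness,
  applied to \<open>B\<close> and to its inverse, gives |q| = 1 again.\<close>

lemma commutes_of_commutator_commutes:
  assumes L: "matgroup L" "isolated1 \<epsilon> L" and A: "A \<in> L" "norm (A - mat 1) < 1/8"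
    and B: "B \<in> L" "norm (B - mat 1) < 1/8"
    and D: "A ** (A ** B ** adj2 A ** adj2 B) = (A ** B ** adj2 A ** adj2 B) ** A"
  shows "A ** B = B ** A"
proof (rule ccontr)
  assume ne: "A ** B \<noteq> B ** A"
  have dA: "det A = 1" and dB: "det B = 1" using matgroupD(2)[OF L(1)] A B by auto
  define C where "C = B ** A ** adj2 B"
  define N where "N = A - mat (trace A / 2)"
  have trN: "trace N = 0" by (simp add: N_def trace2)
  have adjC: "adj2 C = B ** adj2 A ** adj2 B"
    by (simp add: C_def adj2_mult matrix_mul_assoc)
  have "A ** (adj2 C ** A) = A ** (A ** adj2 C)"
    using D unfolding adjC by (simp add: matrix_mul_assoc)
  then have "adj2 A ** (A ** (adj2 C ** A)) = adj2 A ** (A ** (A ** adj2 C))" by simp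
  then have "adj2 C ** A = A ** adj2 C" by (simp add: matrix_mul_assoc adj2_inverse[OF dA])
  then have "C ** A = A ** C" by (rule commute_adj2)
  then have "C ** N = N ** C"
    unfolding N_def by (simp add: mult_diff_distrib2) (simp add: mat2_eq_iff)
  moreover have nzN: "N \<noteq> 0"
  proof
    assume "N = 0"
    then have "A = mat (trace A / 2)" by (simp add: N_def)
    then have "A ** B = B ** A" by (metis mat_commute)
    with ne show False by simp
  qed
  ultimately obtain p q where C: "C = mat p + q *\<^sub>R N"
    using centralizer_traceless[OF trN, of C] by blast
  have "trace C = trace A" unfolding C_def by (rule trace_conj[OF dB])
  moreover have "trace C = 2 * p + q * trace N" unfolding C by (simp add: trace2 algebra_simps)
  ultimately have p: "trace A / 2 = p" using trN by simp
  have Ap: "A = mat p + N" unfolding N_def p by simp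
  have "C ** B = B ** A" unfolding C_def by (simp add: matrix_mul_assoc[symmetric] adj2_inverse[OF dB])
  then have "(mat p + q *\<^sub>R N) ** B = B ** (mat p + N)"
    unfolding C Ap .
  then have BN: "B ** N = q *\<^sub>R (N ** B)"
    by (simp add: mult_add_distrib2 mat_commute)
  have q1: "q \<noteq> 1"
  proof
    assume "q = 1"
    then have "B ** (mat p + N) = (mat p + N) ** B" using BN by (simp add: mult_add_distrib2 mat_commute)
    with ne show False unfolding Ap by simp
  qed
  \<comment> \<open>For q = -1 the matrix \<open>B\<close> would anticommute with \<open>N\<close>,
    which an element so close to the identity cannot do.\<close>
  have qm1: "q \<noteq> -1"
  proof
    assume "q = -1"
    then have "(B - mat 1) ** N + N ** (B - mat 1) = (-2) *\<^sub>R N"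
      using BN by (simp add: mult_diff_distrib2 scaleR_2)
    then have "2 * norm N = norm ((B - mat 1) ** N + N ** (B - mat 1))" by simp
    also have "\<dots> \<le> norm (B - mat 1) * norm N + norm N * norm (B - mat 1)"
      by (intro norm_triangle_le add_mono norm_mult2_le)
    also have "\<dots> = (2 * norm (B - mat 1)) * norm N" by simp
    also have "\<dots> \<le> (1/4) * norm N" using B by (intro mult_right_mono) auto
    finally show False using nzN by simp
  qed
  have "det (B ** N) = det (q *\<^sub>R (N ** B))" using BN by simp
  then have "det N = q\<^sup>2 * det N"
    using dB by (simp add: det_mul det_scaleR2)
  moreover have "q\<^sup>2 \<noteq> 1" using q1 qm1 by (simp add: power2_eq_1_iff)
  ultimately have detN: "det N = 0" by simp
  have "det A = p\<^sup>2 + det N"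
    using det_mat_plus_traceless[OF trN, of p 1] unfolding Ap by simp
  then have "p\<^sup>2 = 1" using detN dA by simp
  \<comment> \<open>\<open>A\<close> is close to the identity, so half its trace is not -1; hence
    \<open>A\<close> is unipotent and not the negative of a unipotent.\<close>
  moreover have "p \<noteq> -1"
    using norm_entry_le[of "A - mat 1" 1 1] norm_entry_le[of "A - mat 1" 2 2] A p
    by (simp add: trace2)
  ultimately have "p = 1" by (simp add: power2_eq_1_iff)
  then have mem: "mat 1 + N \<in> L" using A(1) unfolding Ap by simp
  have "\<bar>q\<bar> \<ge> 1" by (rule no_contracting_conjugation[OF L B(1) mem nzN BN])
  then have q0: "q \<noteq> 0" by auto
  have "adj2 B ** N = inverse q *\<^sub>R (N ** adj2 B)"
  proof -
    have "adj2 B ** (B ** N) ** adj2 B = adj2 B ** (q *\<^sub>R (N ** B)) ** adj2 B" using BN by simp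
    also have "\<dots> = q *\<^sub>R (adj2 B ** N ** (B ** adj2 B))"
      by (simp add: matrix_mul_assoc)
    also have "\<dots> = q *\<^sub>R (adj2 B ** N)" by (simp add: adj2_inverse[OF dB])
    finally have "N ** adj2 B = q *\<^sub>R (adj2 B ** N)"
      by (simp add: matrix_mul_assoc adj2_inverse[OF dB])
    then show ?thesis using q0 by simp
  qed
  then have "\<bar>inverse q\<bar> \<ge> 1"
    by (rule no_contracting_conjugation[OF L matgroupD(3)[OF L(1) B(1)] mem nzN])
  with \<open>\<bar>q\<bar> \<ge> 1\<close> have "\<bar>q\<bar> = 1" by (simp add: divide_simps split: if_splits)
  with q1 qm1 show False by auto
qed

text \<open>The iterated commutators of \<open>A\<close> with \<open>B\<close> converge to \<open>1\<close>, so by discreteness they are eventually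
  equal to \<open>1\<close>; then one descends to \<open>B\<close>.\<close>

lemma commute_near_one:
  assumes L: "matgroup L" "isolated1 \<epsilon> L" and A: "A \<in> L" "norm (A - mat 1) < 1/8"
    and B: "B \<in> L" "norm (B - mat 1) < 1/8"
  shows "A ** B = B ** A"
proof -
  define Bk where "Bk k = ((\<lambda>X. A ** X ** adj2 A ** adj2 X) ^^ k) B" for k :: nat
  have BkS: "Bk (Suc k) = A ** Bk k ** adj2 A ** adj2 (Bk k)" for k by (simp add: Bk_def)
  have mem: "Bk k \<in> L" for k
  proof (induction k)
    case 0 then show ?case using B by (simp add: Bk_def)
  next
    case (Suc k)
    then show ?case unfolding BkS by (intro matgroupD(3,4)[OF L(1)] A)
  qed
  \<comment> \<open>31/20 = 57/40 + 1/8, a bound for sqrt 2 plus the radius; below, 1/4 * (31/20)^2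
    is less than 3/4, the rate of contraction.\<close>
  have near: "norm X \<le> 31/20" if "norm (X - mat 1) < 1/8" for X :: "real^2^2"
  proof -
    have "norm X \<le> norm (X - mat 1) + norm (mat 1 :: real^2^2)"
      using norm_triangle_ineq[of "X - mat 1" "mat 1"] by simp
    moreover have "sqrt 2 \<le> 57/40" by (rule real_le_lsqrt) (auto simp: power2_eq_square)
    ultimately show ?thesis using that by (simp add: norm_mat1_2)
  qed
  have bd: "norm (Bk k - mat 1) < 1/8 * (3/4) ^ k" for k
  proof (induction k)
    case 0 then show ?case using B by (simp add: Bk_def)
  next
    case (Suc k)
    let ?X = "Bk k"
    have dA: "det A = 1" and dX: "det ?X = 1" using matgroupD(2)[OF L(1)] A mem by auto
    have "(3/4::real) ^ k \<le> 1" by (simp add: power_le_one)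
    then have X8: "norm (?X - mat 1) < 1/8" using Suc by linarith
    \<comment> \<open>A X - X A does not change when the identity is subtracted from both factors,
      so the distance of the commutator to the identity is bounded by a product of two small
      distances.\<close>
    have "((A - mat 1) ** (?X - mat 1) - (?X - mat 1) ** (A - mat 1)) ** (adj2 A ** adj2 ?X)
        = (A ** ?X) ** (adj2 A ** adj2 ?X) - ?X ** (A ** adj2 A) ** adj2 ?X"
      by (simp add: mult_diff_distrib2 matrix_mul_assoc)
    also have "\<dots> = A ** ?X ** adj2 A ** adj2 ?X - mat 1"
      by (simp add: matrix_mul_assoc adj2_inverse[OF dA] adj2_inverse[OF dX])
    finally have eq: "Bk (Suc k) - mat 1 = ((A - mat 1) ** (?X - mat 1) - (?X - mat 1) ** (A - mat 1)) ** (adj2 A ** adj2 ?X)"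
      using BkS by simp
    have "norm (Bk (Suc k) - mat 1) \<le> norm ((A - mat 1) ** (?X - mat 1) - (?X - mat 1) ** (A - mat 1)) * norm (adj2 A ** adj2 ?X)"
      unfolding eq by (rule norm_mult2_le)
    also have "\<dots> \<le> (1/4 * norm (?X - mat 1)) * (31/20 * (31/20))"
    proof (rule mult_mono)
      have "norm ((A - mat 1) ** (?X - mat 1) - (?X - mat 1) ** (A - mat 1)) \<le>
        norm (A - mat 1) * norm (?X - mat 1) + norm (?X - mat 1) * norm (A - mat 1)"
        by (intro order_trans[OF norm_triangle_ineq4] add_mono norm_mult2_le)
      also have "\<dots> = (2 * norm (A - mat 1)) * norm (?X - mat 1)" by simp
      also have "\<dots> \<le> (1/4) * norm (?X - mat 1)" using A by (intro mult_right_mono) auto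
      finally show "norm ((A - mat 1) ** (?X - mat 1) - (?X - mat 1) ** (A - mat 1)) \<le> 1/4 * norm (?X - mat 1)" .
      have "norm (adj2 A ** adj2 ?X) \<le> norm A * norm ?X" using norm_mult2_le[of "adj2 A" "adj2 ?X"] by simp
      also have "\<dots> \<le> 31/20 * (31/20)" using near[OF A(2)] near[OF X8] by (intro mult_mono) auto
      finally show "norm (adj2 A ** adj2 ?X) \<le> 31/20 * (31/20)" .
    qed auto
    also have "\<dots> \<le> 3/4 * norm (?X - mat 1)" by simp
    also have "\<dots> < 3/4 * (1/8 * (3/4) ^ k)" using Suc by (intro mult_strict_left_mono) auto
    finally show ?case by simp
  qed
  have bd8: "norm (Bk k - mat 1) < 1/8" for k
  proof -
    have "(3/4::real) ^ k \<le> 1" by (simp add: power_le_one)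
    then show ?thesis using bd[of k] by linarith
  qed
  have "(\<lambda>k. 1/8 * (3/4::real) ^ k) \<longlonglongrightarrow> 1/8 * 0"
    by (intro tendsto_intros LIMSEQ_power_zero) auto
  then have "eventually (\<lambda>k. 1/8 * (3/4::real) ^ k < \<epsilon>) sequentially"
    using L(2) by (auto simp: isolated1_def elim: order_tendstoD)
  then obtain k where "1/8 * (3/4::real) ^ k < \<epsilon>" by (auto simp: eventually_sequentially)
  then have "Bk k = mat 1" using bd[of k] L(2) mem[of k] by (auto simp: isolated1_def)
  then have last: "A ** Bk k = Bk k ** A" by simp
  \<comment> \<open>Descent from the trivial commutator at index \<open>k\<close> to
    \<open>B\<close> at index 0; subtraction of naturals stops at 0, where nothing is left to
    show.\<close>
  have "A ** Bk (k - j) = Bk (k - j) ** A" for j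
  proof (induction j)
    case 0 then show ?case using last by simp
  next
    case (Suc j)
    show ?case
    proof (cases "j < k")
      case True
      then have "Suc (k - Suc j) = k - j" by simp
      then have "A ** Bk (Suc (k - Suc j)) = Bk (Suc (k - Suc j)) ** A" using Suc by simp
      then show ?thesis
        using commutes_of_commutator_commutes[OF L A mem bd8, of "k - Suc j"] unfolding BkS by blast
    next
      case False then show ?thesis using Suc by simp
    qed
  qed
  from this[of k] show ?thesis by (simp add: Bk_def)
qed

section \<open>Leaving the thin part\<close>

lemma linear_cj: "linear (cj z)"
  by (intro linearI) (simp_all add: cj_add cj_scaleR)

text \<open>An injective linear map is bounded below. The new radius depends on \<open>z\<close>,
  which is harmless: \<open>commute_near_one\<close> needs only that some radius exists.\<close>

lemma isolated1_cj:
  assumes "isolated1 \<epsilon> L" "Im z > 0"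
  obtains \<epsilon>' where "isolated1 \<epsilon>' (cj z ` L)"
proof -
  have "inj (cj z)" using cj_inject[OF assms(2)] by (auto intro: injI)
  then obtain B where B: "B > 0" "\<And>x. B * norm x \<le> norm (cj z x)"
    using linear_inj_bounded_below_pos[OF linear_cj] by blast
  have "isolated1 (B * \<epsilon>) (cj z ` L)"
    unfolding isolated1_def
  proof (intro conjI ballI impI)
    show "B * \<epsilon> > 0" using B assms by (simp add: isolated1_def)
    fix X assume "X \<in> cj z ` L" and lt: "norm (X - mat 1) < B * \<epsilon>"
    then obtain A where A: "A \<in> L" "X = cj z A" by auto
    have "B * norm (A - mat 1) \<le> norm (X - mat 1)"
      using B(2)[of "A - mat 1"] A by (simp add: cj_diff)
    then have "B * norm (A - mat 1) < B * \<epsilon>" using lt by linarith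
    then have "norm (A - mat 1) < \<epsilon>" using B(1) by simp
    then show "X = mat 1" using assms A by (auto simp: isolated1_def)
  qed
  then show ?thesis by (rule that)
qed

lemma norm_mat2_le_sum:
  fixes A :: "real^2^2"
  shows "norm A \<le> \<bar>A$1$1\<bar> + \<bar>A$1$2\<bar> + \<bar>A$2$1\<bar> + \<bar>A$2$2\<bar>"
proof -
  have "norm A \<le> norm (A$1) + norm (A$2)"
    using L2_set_le_sum[of UNIV "\<lambda>i. norm (A$i)"] by (simp add: norm_vec_def sum_2)
  moreover have "norm (A$i) \<le> \<bar>A$i$1\<bar> + \<bar>A$i$2\<bar>" for i
    using norm_le_l1_cart[of "A$i"] by (simp add: sum_2)
  ultimately show ?thesis by (smt (verit))
qed

lemma norm_le_of_norm_cj: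
  assumes z: "\<bar>Re z\<bar> \<le> \<rho>" "1 / \<rho> \<le> Im z" "Im z \<le> \<rho>" "\<rho> \<ge> 1" and X: "norm (cj z A) \<le> R"
  shows "norm A \<le> R * \<rho> + 2 * (R + R * \<rho> * \<rho>) + (\<rho> * R + 2 * (R + R * \<rho> * \<rho>) * \<rho> + R * \<rho> * \<rho> * \<rho>)"
proof -
  have y: "Im z > 0" using z by (smt (verit) divide_pos_pos)
  have R: "R \<ge> 0" using X norm_ge_zero order_trans by blast
  have e: "\<bar>cj z A $ i $ j\<bar> \<le> R" for i j using norm_entry_le[of "cj z A"] X order_trans by blast
  have y1: "1 \<le> Im z * \<rho>" using z by (simp add: field_simps)
  have c: "\<bar>A$2$1\<bar> \<le> R * \<rho>"
  proof -
    have "\<bar>A$2$1\<bar> * 1 \<le> \<bar>A$2$1\<bar> * (Im z * \<rho>)" using y1 by (intro mult_left_mono) auto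
    also have "\<dots> = \<bar>A$2$1 * Im z\<bar> * \<rho>" using y by (simp add: abs_mult)
    also have "\<dots> \<le> R * \<rho>" using e[of 2 1] z by (intro mult_right_mono) (auto simp: cj_def)
    finally show ?thesis by simp
  qed
  have cx: "\<bar>A$2$1 * Re z\<bar> \<le> R * \<rho> * \<rho>"
    unfolding abs_mult using c z R by (intro mult_mono) auto
  have a: "\<bar>A$1$1\<bar> \<le> R + R * \<rho> * \<rho>" using e[of 1 1] cx by (simp add: cj_def)
  have d: "\<bar>A$2$2\<bar> \<le> R + R * \<rho> * \<rho>" using e[of 2 2] cx by (simp add: cj_def)
  have "A$1$2 = Im z * cj z A $ 1 $ 2 - (A$1$1 - A$2$2) * Re z + A$2$1 * Re z * Re z"
    using y by (simp add: cj_def power2_eq_square)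
  then have "\<bar>A$1$2\<bar> \<le> \<bar>Im z * cj z A $ 1 $ 2\<bar> + \<bar>(A$1$1 - A$2$2) * Re z\<bar> + \<bar>A$2$1 * Re z * Re z\<bar>"
    by linarith
  moreover have "\<bar>Im z * cj z A $ 1 $ 2\<bar> \<le> \<rho> * R"
    unfolding abs_mult using e[of 1 2] z y by (intro mult_mono) auto
  moreover have "\<bar>(A$1$1 - A$2$2) * Re z\<bar> \<le> 2 * (R + R * \<rho> * \<rho>) * \<rho>"
    unfolding abs_mult using a d z R by (intro mult_mono) auto
  moreover have "\<bar>A$2$1 * Re z * Re z\<bar> \<le> R * \<rho> * \<rho> * \<rho>"
    unfolding abs_mult[of "A$2$1 * Re z"] using cx z R by (intro mult_mono) auto
  ultimately have b: "\<bar>A$1$2\<bar> \<le> \<rho> * R + 2 * (R + R * \<rho> * \<rho>) * \<rho> + R * \<rho> * \<rho> * \<rho>" by linarith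
  show ?thesis
    using order_trans[OF norm_mat2_le_sum add_mono[OF add_mono[OF add_mono[OF a b] c] d]]
    by (simp add: algebra_simps)
qed

section \<open>Centralizer elements as a scalar plus a multiple of a traceless matrix\<close>

lemma norm_mat_plus_traceless:
  fixes N :: "real^2^2"
  assumes "trace N = 0"
  shows "(norm (mat a + q *\<^sub>R N))\<^sup>2 = 2 * a\<^sup>2 + q\<^sup>2 * (norm N)\<^sup>2"
proof -
  have n: "N$2$2 = - N$1$1" using assms by (simp add: trace2)
  show ?thesis unfolding norm_sq_mat2 by (simp add: n power2_eq_square algebra_simps)
qed

text \<open>The determinant is invariant under \<open>cj z\<close>, so a traceless matrix with
  nonzero determinant looks small from no point at all.\<close>

lemma abs_det_traceless_le:
  fixes N :: "real^2^2"
  assumes "trace N = 0"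
  shows "2 * \<bar>det N\<bar> \<le> (norm N)\<^sup>2"
proof -
  have n: "N$2$2 = - N$1$1" using assms by (simp add: trace2)
  have "det N = - (N$1$1 * N$1$1) - N$1$2 * N$2$1"
    "(norm N)\<^sup>2 = 2 * (N$1$1 * N$1$1) + N$1$2 * N$1$2 + N$2$1 * N$2$1"
    unfolding norm_sq_mat2 by (simp_all add: det_2 n power2_eq_square)
  moreover have "0 \<le> N$1$2 * N$1$2 + N$2$1 * N$2$1 + 2 * (N$1$2 * N$2$1)"
    using zero_le_power2[of "N$1$2 + N$2$1"] by (simp add: power2_eq_square algebra_simps)
  moreover have "0 \<le> N$1$2 * N$1$2 + N$2$1 * N$2$1 - 2 * (N$1$2 * N$2$1)"
    using zero_le_power2[of "N$1$2 - N$2$1"] by (simp add: power2_eq_square algebra_simps)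
  moreover have "0 \<le> N$1$1 * N$1$1" by simp
  ultimately have "2 * det N \<le> (norm N)\<^sup>2" "- (2 * det N) \<le> (norm N)\<^sup>2" by linarith+
  then show ?thesis by (simp add: abs_if)
qed

text \<open>Scalar and traceless matrices are orthogonal and \<open>cj z\<close> respects both
  kinds, so within the centralizer of \<open>N\<close> the point enters through
  \<open>norm (cj z N)\<close> alone; its square is the parameter \<open>u\<close> of
  \<open>exit_thin_part\<close>.\<close>

lemma norm_sq_cj_lin:
  assumes "trace N = 0"
  shows "(norm (cj z (mat p + q *\<^sub>R N) - mat 1))\<^sup>2 = 2 * (p - 1)\<^sup>2 + q\<^sup>2 * (norm (cj z N))\<^sup>2"
proof -
  have "cj z (mat p + q *\<^sub>R N) - mat 1 = mat (p - 1) + q *\<^sub>R cj z N"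
    by (simp add: cj_add cj_scaleR) (simp add: mat2_eq_iff)
  then show ?thesis using norm_mat_plus_traceless[of "cj z N"] assms by (simp add: trace_cj)
qed

text \<open>Determinant 1 reads p^2 + q^2 det N = 1, so a small \<open>q\<close> together with
  positive \<open>p\<close> forces \<open>p\<close> close to 1, and the element would be too close
  to the identity.\<close>

lemma lin_coeff_bound:
  assumes L: "matgroup \<Gamma>" "isolated1 \<eta> \<Gamma>" and N: "trace N = 0" "N \<noteq> 0"
  obtains q0 where "q0 > 0"
    "\<And>p q. mat p + q *\<^sub>R N \<in> \<Gamma> \<Longrightarrow> mat p + q *\<^sub>R N \<noteq> mat 1 \<Longrightarrow> p > 0 \<Longrightarrow> \<bar>q\<bar> \<ge> q0"
proof -
  \<comment> \<open>The terms come from |p - 1| \<le> |q| |det N|, doubled by the passage to the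
    norm of a scalar matrix, and from the norm of q N; the 1 keeps \<open>K\<close>
    positive.\<close>
  define K where "K = 2 * \<bar>det N\<bar> + norm N + 1"
  have K: "K > 0" by (simp add: K_def add_nonneg_pos)
  have eta: "\<eta> > 0" using L by (simp add: isolated1_def)
  show ?thesis
  proof (rule that[of "min 1 (\<eta> / K)"])
    show "min 1 (\<eta> / K) > 0" using K eta by simp
    fix p q assume mem: "mat p + q *\<^sub>R N \<in> \<Gamma>" and ne: "mat p + q *\<^sub>R N \<noteq> mat 1" and p: "p > 0"
    show "min 1 (\<eta> / K) \<le> \<bar>q\<bar>"
    proof (rule ccontr)
      assume "\<not> min 1 (\<eta> / K) \<le> \<bar>q\<bar>"
      then have q: "\<bar>q\<bar> < 1" "\<bar>q\<bar> * K < \<eta>"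
        using K by (simp_all add: not_le pos_less_divide_eq)
      have "p\<^sup>2 + q\<^sup>2 * det N = 1"
        using matgroupD(2)[OF L(1) mem] det_mat_plus_traceless[OF N(1)] by simp
      then have 1: "1 - p\<^sup>2 = q\<^sup>2 * det N" by simp
      have "\<bar>p - 1\<bar> * 1 \<le> \<bar>p - 1\<bar> * (p + 1)" using p by (intro mult_left_mono) auto
      also have "\<dots> = \<bar>(p - 1) * (p + 1)\<bar>" using p by (simp add: abs_mult)
      also have "(p - 1) * (p + 1) = - (1 - p\<^sup>2)" by (simp add: power2_eq_square algebra_simps)
      also have "\<bar>- (1 - p\<^sup>2)\<bar> = \<bar>1 - p\<^sup>2\<bar>" by (rule abs_minus_cancel)
      also have "\<dots> = \<bar>q\<bar> * (\<bar>q\<bar> * \<bar>det N\<bar>)" unfolding 1 by (simp add: abs_mult power2_eq_square)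
      also have "\<dots> \<le> \<bar>q\<bar> * (1 * \<bar>det N\<bar>)" using q by (intro mult_left_mono mult_right_mono) auto
      finally have p1: "\<bar>p - 1\<bar> \<le> \<bar>q\<bar> * \<bar>det N\<bar>" by simp
      have "mat p + q *\<^sub>R N - mat 1 = mat (p - 1) + q *\<^sub>R N" by (simp add: mat2_eq_iff)
      then have "norm (mat p + q *\<^sub>R N - mat 1) \<le> norm (mat (p - 1) :: real^2^2) + norm (q *\<^sub>R N)"
        by (metis norm_triangle_ineq)
      also have "\<dots> \<le> 2 * \<bar>p - 1\<bar> + \<bar>q\<bar> * norm N"
        using norm_mat2_le_sum[of "mat (p - 1)"] by simp
      also have "\<dots> \<le> \<bar>q\<bar> * K"
      proof -
        have "\<bar>q\<bar> * K = 2 * (\<bar>q\<bar> * \<bar>det N\<bar>) + \<bar>q\<bar> * norm N + \<bar>q\<bar>"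
          unfolding K_def by (simp add: algebra_simps)
        moreover have "0 \<le> \<bar>q\<bar>" by simp
        ultimately show ?thesis using p1 by linarith
      qed
      also have "\<dots> < \<eta>" by (rule q)
      finally show False using L(2) mem ne by (auto simp: isolated1_def)
    qed
  qed
qed

lemma coeff_pos_of_sq_sum_lt:
  fixes p q u e :: real
  assumes "2 * (p - 1)\<^sup>2 + q\<^sup>2 * u < e\<^sup>2" "u \<ge> 0" "0 < e" "e \<le> 1"
  shows "p > 0"
proof (rule ccontr)
  assume "\<not> p > 0"
  then have "1 * 1 \<le> (1 - p) * (1 - p)" by (intro mult_mono) auto
  moreover have "(p - 1)\<^sup>2 = (1 - p) * (1 - p)" by (simp add: power2_eq_square algebra_simps)
  moreover have "0 \<le> q\<^sup>2 * u" using assms by simp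
  moreover have "e\<^sup>2 \<le> 1" using assms by (simp add: power_le_one)
  ultimately show False using assms(1) by linarith
qed

text \<open>Intermediate value theorem on the connected half-plane. The square norm is unbounded: it
  grows straight upwards if \<open>N$2$1\<close> is nonzero, and otherwise on the way down to a real
  \<open>x\<close> that is not a zero of \<open>qform N\<close>.\<close>

lemma norm_cj_attains:
  assumes N: "trace N = 0" "N \<noteq> 0" and z: "Im z > 0" and u: "(norm (cj z N))\<^sup>2 \<le> u"
  obtains w where "Im w > 0" "(norm (cj w N))\<^sup>2 = u"
proof -
  define g where "g w = (norm (cj w N))\<^sup>2" for w
  let ?H = "{w. Im w > 0}"
  have "continuous_on ?H (\<lambda>w. 2 * det N + (cmod (qform N w))\<^sup>2 / (Im w)\<^sup>2)"
    unfolding qform_def by (intro continuous_intros) auto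
  then have "continuous_on ?H g"
    by (rule continuous_on_eq) (auto simp: g_def norm_cj)
  moreover have "connected ?H" by (intro convex_connected convex_halfspace_Im_gt)
  ultimately have con: "connected (g ` ?H)" by (rule connected_continuous_image)
  have "\<exists>w\<in>?H. u \<le> g w"
  proof -
    have big: "u \<le> g w" if "\<bar>cj w N $ i $ j\<bar> \<ge> \<bar>u\<bar> + 1" for w i j
    proof -
      have "norm (cj w N) \<ge> \<bar>u\<bar> + 1" using norm_entry_le[of "cj w N" i j] that by linarith
      then have "(\<bar>u\<bar> + 1) * (\<bar>u\<bar> + 1) \<le> norm (cj w N) * norm (cj w N)" by (intro mult_mono) auto
      moreover have "(\<bar>u\<bar> + 1) * 1 \<le> (\<bar>u\<bar> + 1) * (\<bar>u\<bar> + 1)" by (intro mult_left_mono) auto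
      ultimately show ?thesis by (simp add: g_def power2_eq_square)
    qed
    show ?thesis
    proof (cases "N$2$1 = 0")
      case False
      define t where "t = (\<bar>u\<bar> + 1) / \<bar>N$2$1\<bar>"
      have t: "t > 0" using False by (simp add: t_def add_nonneg_pos)
      have "u \<le> g (Complex 0 t)"
        by (rule big[of _ 2 1]) (use t False in \<open>simp add: cj_def abs_mult\<close>, simp add: t_def)
      then show ?thesis using t by (intro bexI[of _ "Complex 0 t"]) auto
    next
      case True
      obtain x where x: "N$1$2 + (N$1$1 - N$2$2) * x \<noteq> 0"
      proof (cases "N$1$2 = 0")
        case True
        then have "N$1$1 \<noteq> 0" using N \<open>N$2$1 = 0\<close> by (auto simp: mat2_eq_iff trace2)
        then show ?thesis using True N by (intro that[of 1]) (simp add: trace2)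
      next
        case False then show ?thesis by (intro that[of 0]) simp
      qed
      define k where "k = N$1$2 + (N$1$1 - N$2$2) * x"
      define t where "t = \<bar>k\<bar> / (\<bar>u\<bar> + 1)"
      have k0: "k \<noteq> 0" using x by (simp add: k_def)
      then have t: "t > 0" by (simp add: t_def add_nonneg_pos)
      have "cj (Complex x t) N $ 1 $ 2 = k / t" using True by (simp add: cj_def k_def)
      moreover have "\<bar>k / t\<bar> = \<bar>u\<bar> + 1" using k0 by (simp add: t_def abs_mult)
      ultimately have "u \<le> g (Complex x t)" by (intro big[of _ 1 2]) simp
      then show ?thesis using t by (intro bexI[of _ "Complex x t"]) auto
    qed
  qed
  then obtain w1 where w1: "w1 \<in> ?H" "u \<le> g w1" by blast
  have "{g z..g w1} \<subseteq> g ` ?H"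
    by (rule connected_contains_Icc[OF con]) (use z w1 in auto)
  moreover have "u \<in> {g z..g w1}" using u w1 by (simp add: g_def)
  ultimately show ?thesis using that by (auto simp: g_def)
qed

text \<open>Closeness to \<open>- mat 1\<close> does not count: thickness at \<open>z\<close> says
  exactly that the group seen from \<open>z\<close> is isolated at the identity with radius
  \<epsilon>, which is what \<open>packing_bound\<close> asks for.\<close>

definition thick :: "real \<Rightarrow> (real^2^2) set \<Rightarrow> complex set" where
  "thick \<epsilon> \<Gamma> = {z. Im z > 0 \<and> (\<forall>A\<in>\<Gamma>. A \<noteq> mat 1 \<longrightarrow> norm (cj z A - mat 1) \<ge> \<epsilon>)}"

text \<open>Moving radially away from the axis, fixed point or cusp of \<open>A\<close> scales the traceless part of
  every element of its centralizer by the same factor. At the scale where the centralizer stops being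
  \<open>\<epsilon>\<close>-small some element \<open>B\<close> is still \<open>2\<epsilon>\<close>-small, and commutation of small elements forbids small
  elements outside the centralizer.\<close>

lemma exit_thin_part:
  assumes L: "matgroup \<Gamma>" "isolated1 \<eta> \<Gamma>" and e: "0 < \<epsilon>" "\<epsilon> < 1/16"
    and A: "A \<in> \<Gamma>" "A \<noteq> mat 1" and z: "Im z > 0" and small: "norm (cj z A - mat 1) < \<epsilon>"
  obtains w B where "w \<in> thick \<epsilon> \<Gamma>" "B \<in> \<Gamma>" "B \<noteq> mat 1" "A ** B = B ** A"
    "norm (cj w B - mat 1) \<le> 2 * \<epsilon>"
proof -
  define t where "t = trace A / 2"
  define N where "N = A - mat t"
  have AN: "A = mat t + N" and AN1: "A = mat t + 1 *\<^sub>R N" by (simp_all add: N_def)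
  have trN: "trace N = 0" by (simp add: N_def trace2 t_def)
  have sq: "x\<^sup>2 < \<epsilon>\<^sup>2" if "x < \<epsilon>" "x \<ge> 0" for x using that by (simp add: power_strict_mono)
  have A0: "2 * (t - 1)\<^sup>2 + 1\<^sup>2 * (norm (cj z N))\<^sup>2 < \<epsilon>\<^sup>2"
    using sq[OF small] unfolding AN1 norm_sq_cj_lin[OF trN] by simp
  have tpos: "t > 0" by (rule coeff_pos_of_sq_sum_lt[OF A0]) (use e in auto)
  have N0: "N \<noteq> 0"
  proof
    assume "N = 0"
    then have "A = mat t" using AN by simp
    moreover from this have "t\<^sup>2 = 1" using matgroupD(2)[OF L(1) A(1)] by (simp add: det_2 power2_eq_square)
    then have "t = 1" using tpos by (simp add: power2_eq_1_iff)
    ultimately show False using A by simp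
  qed
  obtain q0 where q0: "q0 > 0"
    "\<And>p q. mat p + q *\<^sub>R N \<in> \<Gamma> \<Longrightarrow> mat p + q *\<^sub>R N \<noteq> mat 1 \<Longrightarrow> p > 0 \<Longrightarrow> \<bar>q\<bar> \<ge> q0"
    using lin_coeff_bound[OF L trN N0] by blast
  \<comment> \<open>The values \<open>u\<close> of the square norm of \<open>N\<close> at which some
    nontrivial element of \<Gamma> in the centralizer is \<epsilon>-small. The lower bound
    \<open>q0\<close> on |q| bounds them from above.\<close>
  define U where "U = {u. u > 0 \<and> (\<exists>p q. mat p + q *\<^sub>R N \<in> \<Gamma> \<and> mat p + q *\<^sub>R N \<noteq> mat 1 \<and>
    2 * (p - 1)\<^sup>2 + q\<^sup>2 * u < \<epsilon>\<^sup>2)}"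
  define u0 where "u0 = (norm (cj z N))\<^sup>2"
  have u0pos: "u0 > 0" using N0 cj_eq_0[OF z, of N] by (auto simp: u0_def)
  have u0U: "u0 \<in> U"
    unfolding U_def mem_Collect_eq
  proof (intro conjI exI)
    show "u0 > 0" by (rule u0pos)
    show "mat t + 1 *\<^sub>R N \<in> \<Gamma>" "mat t + 1 *\<^sub>R N \<noteq> mat 1" using A AN1 by auto
    show "2 * (t - 1)\<^sup>2 + 1\<^sup>2 * u0 < \<epsilon>\<^sup>2" unfolding u0_def by (rule A0)
  qed
  have Uq: "p > 0 \<and> \<bar>q\<bar> \<ge> q0" if "u > 0" "mat p + q *\<^sub>R N \<in> \<Gamma>" "mat p + q *\<^sub>R N \<noteq> mat 1"
    "2 * (p - 1)\<^sup>2 + q\<^sup>2 * u < \<epsilon>\<^sup>2" for u p q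
  proof -
    have "p > 0" by (rule coeff_pos_of_sq_sum_lt[OF that(4)]) (use that e in auto)
    then show ?thesis using q0(2) that by blast
  qed
  have bdd: "bdd_above U"
  proof (rule bdd_aboveI[of _ "\<epsilon>\<^sup>2 / q0\<^sup>2"])
    fix u assume "u \<in> U"
    then obtain p q where u: "u > 0" and pq: "mat p + q *\<^sub>R N \<in> \<Gamma>" "mat p + q *\<^sub>R N \<noteq> mat 1"
      "2 * (p - 1)\<^sup>2 + q\<^sup>2 * u < \<epsilon>\<^sup>2" by (auto simp: U_def)
    have "q0\<^sup>2 \<le> \<bar>q\<bar>\<^sup>2" using Uq[OF u pq] q0(1) by (intro power_mono) auto
    then have "q0\<^sup>2 * u \<le> q\<^sup>2 * u" using u by (intro mult_right_mono) auto
    moreover have "0 \<le> 2 * (p - 1)\<^sup>2" by simp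
    ultimately have "q0\<^sup>2 * u \<le> \<epsilon>\<^sup>2" using pq by linarith
    then show "u \<le> \<epsilon>\<^sup>2 / q0\<^sup>2" using q0 by (simp add: field_simps)
  qed
  have supge: "u0 \<le> Sup U" by (rule cSup_upper[OF u0U bdd])
  \<comment> \<open>For \<open>u1\<close> in \<open>U\<close> above half the supremum,
    \<open>2 * u1\<close> is no longer in \<open>U\<close>, while the element that is small at
    \<open>u1\<close> at most doubles its square distance there.\<close>
  then have "Sup U / 2 < Sup U" using u0pos by simp
  then obtain u1 where u1: "u1 \<in> U" "Sup U / 2 < u1"
    using less_cSupE[of "Sup U / 2" U] u0U by blast
  then obtain p q where u1pos: "u1 > 0" and pq: "mat p + q *\<^sub>R N \<in> \<Gamma>" "mat p + q *\<^sub>R N \<noteq> mat 1"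
      "2 * (p - 1)\<^sup>2 + q\<^sup>2 * u1 < \<epsilon>\<^sup>2" by (auto simp: U_def)
  define B where "B = mat p + q *\<^sub>R N"
  have u2: "Sup U < 2 * u1" "u0 \<le> 2 * u1" using u1 supge by auto
  obtain w where w: "Im w > 0" "(norm (cj w N))\<^sup>2 = 2 * u1"
    using norm_cj_attains[OF trN N0 z] u2(2) unfolding u0_def by blast
  have "(norm (cj w B - mat 1))\<^sup>2 = 2 * (p - 1)\<^sup>2 + q\<^sup>2 * (2 * u1)"
    unfolding B_def norm_sq_cj_lin[OF trN] w(2) ..
  also have "\<dots> \<le> 2 * (2 * (p - 1)\<^sup>2 + q\<^sup>2 * u1)" by simp
  also have "\<dots> \<le> 2 * \<epsilon>\<^sup>2" using pq by simp
  also have "\<dots> \<le> (2 * \<epsilon>)\<^sup>2" by (simp add: power2_eq_square)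
  finally have "(norm (cj w B - mat 1))\<^sup>2 \<le> (2 * \<epsilon>)\<^sup>2" .
  then have sB: "norm (cj w B - mat 1) \<le> 2 * \<epsilon>"
    by (rule power2_le_imp_le) (use e in simp)
  have q: "q \<noteq> 0" using Uq[OF u1pos pq] q0 by auto
  have "w \<in> thick \<epsilon> \<Gamma>"
    unfolding thick_def
  proof (intro CollectI conjI ballI impI w(1))
    fix C assume C: "C \<in> \<Gamma>" "C \<noteq> mat 1"
    show "\<epsilon> \<le> norm (cj w C - mat 1)"
    proof (rule ccontr)
      assume "\<not> \<epsilon> \<le> norm (cj w C - mat 1)"
      then have sC: "norm (cj w C - mat 1) < \<epsilon>" by simp
      \<comment> \<open>Here 2 * \<epsilon> < 1/8 enters: seen from \<open>w\<close>, both
        \<open>C\<close> and \<open>B\<close> are within the radius of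
        \<open>commute_near_one\<close>. Commuting with \<open>B\<close> puts \<open>C\<close> in
        the centralizer of \<open>N\<close>, and its smallness would place \<open>2 * u1\<close> in
        \<open>U\<close>.\<close>
      obtain \<eta>' where iso: "isolated1 \<eta>' (cj w ` \<Gamma>)" using isolated1_cj[OF L(2) w(1)] by blast
      have "cj w C ** cj w B = cj w B ** cj w C"
        by (rule commute_near_one[OF matgroup_cj[OF L(1) w(1)] iso])
           (use sC sB e C pq B_def in auto)
      then have "C ** B = B ** C" using cj_inject[OF w(1)] by (simp add: cj_mult[OF w(1), symmetric])
      then have "C ** N = N ** C" using q by (simp add: B_def mult_add_distrib2 mat_commute)
      then obtain p' q' where C': "C = mat p' + q' *\<^sub>R N" by (rule centralizer_traceless[OF trN N0])
      have "2 * (p' - 1)\<^sup>2 + q'\<^sup>2 * (2 * u1) < \<epsilon>\<^sup>2"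
        using sq[OF sC] unfolding C' norm_sq_cj_lin[OF trN] w(2) by simp
      then have "2 * u1 \<in> U" using C C' u1pos unfolding U_def by auto
      then have "2 * u1 \<le> Sup U" using bdd by (rule cSup_upper)
      with u2 show False by simp
    qed
  qed
  moreover have "A ** B = B ** A" unfolding AN B_def by (simp add: mat2_eq_iff algebra_simps)
  ultimately show ?thesis using that pq sB unfolding B_def by blast
qed


section \<open>The height of f at points that a centralizer moves little\<close>

lemma height_slash:
  assumes "det A = 1" "Im z > 0"
  shows "Im z * cmod (slash 2 f A z) = Im (mobius A z) * cmod (f (mobius A z))"
  by (simp add: slash_def Im_mobius[OF assms(1)] norm_mult norm_divide norm_power power_int_minus field_simps)

text \<open>Such an \<open>N\<close> is nilpotent with one fixed boundary point, the image of
  infinity under \<sigma>. In the coordinate \<open>w\<close> it is an infinitesimal translation of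
  length \<open>k\<close>, whose norm seen from height \<open>Im w\<close> is
  \<open>k / Im w\<close>: a small norm means high in the cusp.\<close>

lemma nilpotent_cusp_coordinate:
  assumes N: "trace N = 0" "N \<noteq> 0" "det N = 0" and t: "t \<noteq> 0"
  obtains \<sigma> k where "det \<sigma> = 1" "mobius_P1 (mat t + N) (mobius_P1 \<sigma> None) = mobius_P1 \<sigma> None" "k > 0"
    "\<And>z. Im z > 0 \<Longrightarrow> \<exists>w. Im w > 0 \<and> mobius \<sigma> w = z \<and> norm (cj z N) * Im w = k"
proof (cases "N$2$1 = 0")
  case True
  have n: "N$2$2 = - N$1$1" using N by (simp add: trace2)
  then have "N$1$1 = 0" using N True by (simp add: det_2)
  then have n0: "N$1$1 = 0" "N$2$2 = 0" and b: "N$1$2 \<noteq> 0" using n True N(2) by (auto simp: mat2_eq_iff)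
  show ?thesis
  proof (rule that[of "mat 1" "\<bar>N$1$2\<bar>"])
    fix z :: complex assume z: "Im z > 0"
    have "(norm (cj z N))\<^sup>2 = (\<bar>N$1$2\<bar> / Im z)\<^sup>2"
      unfolding norm_cj[OF z] by (simp add: N n0 True qform_def power_divide)
    then have "norm (cj z N) = \<bar>N$1$2\<bar> / Im z" using z by (simp add: power2_eq_iff_nonneg)
    then show "\<exists>w. Im w > 0 \<and> mobius (mat 1) w = z \<and> norm (cj z N) * Im w = \<bar>N$1$2\<bar>"
      using z by (intro exI[of _ z]) simp
  qed (use b True in auto)
next
  case False
  have n: "N$2$2 = - N$1$1" using N by (simp add: trace2)
  \<comment> \<open>The double zero of \<open>qform N\<close>, to which \<sigma> below moves
    infinity.\<close>
  define r where "r = N$1$1 / N$2$1"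
  have nr: "N$1$1 = r * N$2$1" using False by (simp add: r_def)
  have br: "N$1$2 = - (r * r * N$2$1)"
  proof -
    have "(N$1$2 + r * r * N$2$1) * N$2$1 = 0" using N(3) unfolding det_2 n nr by (simp add: algebra_simps)
    with False show ?thesis by simp
  qed
  define \<sigma> where "\<sigma> = mat2 r (-1) 1 0"
  show ?thesis
  proof (rule that[of \<sigma> "\<bar>N$2$1\<bar>"])
    show "det \<sigma> = 1" by (simp add: \<sigma>_def det_2)
    have s: "mobius_P1 \<sigma> None = Some r" by (simp add: \<sigma>_def)
    show "mobius_P1 (mat t + N) (mobius_P1 \<sigma> None) = mobius_P1 \<sigma> None"
      unfolding s using t by (simp add: n nr br algebra_simps)
    fix z :: complex assume z: "Im z > 0"
    define w where "w = - 1 / (z - of_real r)"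
    have zr: "z - of_real r \<noteq> 0" using z by (auto simp: complex_eq_iff)
    then have "(cmod (z - of_real r))\<^sup>2 > 0" by simp
    have Iw: "Im w = Im z / (cmod (z - of_real r))\<^sup>2"
      unfolding w_def by (simp add: Im_divide cmod_power2)
    have "Im w > 0" unfolding Iw using z zr by simp
    moreover have "mobius \<sigma> w = z"
      using zr by (simp add: mobius_def \<sigma>_def w_def field_simps)
    moreover have "norm (cj z N) * Im w = \<bar>N$2$1\<bar>"
    proof -
      have "qform N z = of_real (N$2$1) * (z - of_real r)\<^sup>2"
        unfolding qform_def n nr br by (simp add: power2_eq_square algebra_simps)
      then have "(norm (cj z N))\<^sup>2 = (\<bar>N$2$1\<bar> * (cmod (z - of_real r))\<^sup>2 / Im z)\<^sup>2"
        unfolding norm_cj[OF z] N(3) by (simp add: norm_mult norm_power power_divide power_mult_distrib)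
      then have "norm (cj z N) = \<bar>N$2$1\<bar> * (cmod (z - of_real r))\<^sup>2 / Im z"
        using z by (simp add: power2_eq_iff_nonneg)
      then show ?thesis unfolding Iw using z zr by simp
    qed
    ultimately show "\<exists>w. Im w > 0 \<and> mobius \<sigma> w = z \<and> norm (cj z N) * Im w = \<bar>N$2$1\<bar>" by blast
  qed (use False in auto)
qed

lemma bounded_in_thin_part:
  assumes L: "matgroup \<Gamma>" "isolated1 \<eta> \<Gamma>"
    and cusp: "\<And>\<sigma>. det \<sigma> = 1 \<Longrightarrow> mobius_P1 \<sigma> None \<in> cusps \<Gamma> \<Longrightarrow>
      \<exists>Y. \<forall>z. Im z > 0 \<longrightarrow> Im z > Y \<longrightarrow> Im z * cmod (slash 2 f \<sigma> z) \<le> 1"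
    and B: "B \<in> \<Gamma>" "B \<noteq> mat 1" "B \<noteq> - mat 1"
  obtains e where "e > 0"
    "\<And>z A. Im z > 0 \<Longrightarrow> A \<in> \<Gamma> \<Longrightarrow> A \<noteq> mat 1 \<Longrightarrow> A ** B = B ** A \<Longrightarrow> norm (cj z A - mat 1) < e \<Longrightarrow>
       Im z * cmod (f z) \<le> 1"
proof -
  define t where "t = trace B / 2"
  define N where "N = B - mat t"
  have BN: "B = mat t + N" by (simp add: N_def)
  have trN: "trace N = 0" by (simp add: N_def trace2 t_def)
  have dB: "det B = 1" using matgroupD(2)[OF L(1) B(1)] .
  have dBN: "t\<^sup>2 + det N = 1" using dB det_mat_plus_traceless[OF trN, of t 1] BN by simp
  have N0: "N \<noteq> 0"
  proof
    assume "N = 0"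
    then have "B = mat t" "t\<^sup>2 = 1" using BN dBN by (auto simp: det_2)
    moreover have "mat (-1) = - (mat 1 :: real^2^2)" by (simp add: mat2_eq_iff)
    ultimately show False using B by (auto simp: power2_eq_1_iff)
  qed
  obtain q0 where q0: "q0 > 0"
    "\<And>p q. mat p + q *\<^sub>R N \<in> \<Gamma> \<Longrightarrow> mat p + q *\<^sub>R N \<noteq> mat 1 \<Longrightarrow> p > 0 \<Longrightarrow> \<bar>q\<bar> \<ge> q0"
    using lin_coeff_bound[OF L trN N0] by blast
  \<comment> \<open>A small nontrivial element commuting with \<open>B\<close> is p + q N with |q|
    bounded below, so \<open>N\<close> itself must look small from \<open>z\<close>.\<close>
  have main: "q0 * norm (cj z N) < e"
    if z: "Im z > 0" and A: "A \<in> \<Gamma>" "A \<noteq> mat 1" "A ** B = B ** A" "norm (cj z A - mat 1) < e" and e: "e \<le> 1" for z A e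
  proof -
    have e0: "e > 0" using A(4) norm_ge_zero le_less_trans by blast
    have "A ** N = N ** A" using A(3) BN by (simp add: mult_add_distrib2 mat_commute)
    then obtain p q where Apq: "A = mat p + q *\<^sub>R N" by (rule centralizer_traceless[OF trN N0])
    have "(norm (cj z A - mat 1))\<^sup>2 < e\<^sup>2" using A(4) by (simp add: power_strict_mono)
    then have lt: "2 * (p - 1)\<^sup>2 + q\<^sup>2 * (norm (cj z N))\<^sup>2 < e\<^sup>2"
      unfolding Apq norm_sq_cj_lin[OF trN] .
    have "p > 0" by (rule coeff_pos_of_sq_sum_lt[OF lt]) (use e e0 in auto)
    then have q: "\<bar>q\<bar> \<ge> q0" using q0(2) A Apq by blast
    have "0 \<le> 2 * (p - 1)\<^sup>2" by simp
    then have "q\<^sup>2 * (norm (cj z N))\<^sup>2 < e\<^sup>2" using lt by linarith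
    then have "(\<bar>q\<bar> * norm (cj z N))\<^sup>2 < e\<^sup>2" by (simp add: power_mult_distrib)
    then have "\<bar>q\<bar> * norm (cj z N) < e" using e0 by (simp add: power_less_imp_less_base)
    moreover have "q0 * norm (cj z N) \<le> \<bar>q\<bar> * norm (cj z N)" using q by (intro mult_right_mono) auto
    ultimately show ?thesis by linarith
  qed
  show ?thesis
  proof (cases "det N = 0")
    case False
    \<comment> \<open>For this \<open>e\<close> the assumptions on \<open>A\<close> contradict the
      lower bound by the determinant, so the claim holds vacuously.\<close>
    define e where "e = min 1 (q0 * sqrt (2 * \<bar>det N\<bar>))"
    have "e > 0" using False q0 by (simp add: e_def)
    then show ?thesis
    proof (rule that)
      fix z A assume z: "Im z > 0" and A: "A \<in> \<Gamma>" "A \<noteq> mat 1" "A ** B = B ** A" "norm (cj z A - mat 1) < e"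
      have "q0 * norm (cj z N) < e" using main[OF z A] by (simp add: e_def)
      also have "e \<le> q0 * sqrt (2 * \<bar>det N\<bar>)" by (simp add: e_def)
      also have "sqrt (2 * \<bar>det N\<bar>) \<le> norm (cj z N)"
        using abs_det_traceless_le[of "cj z N"] trN by (intro real_le_lsqrt) (simp_all add: trace_cj det_cj[OF z])
      finally show "Im z * cmod (f z) \<le> 1" using q0 by simp
    qed
  next
    case True
    have t: "t\<^sup>2 = 1" using dBN True by simp
    then have "t \<noteq> 0" by auto
    then obtain \<sigma> k where s: "det \<sigma> = 1" "mobius_P1 B (mobius_P1 \<sigma> None) = mobius_P1 \<sigma> None" "k > 0"
      "\<And>z. Im z > 0 \<Longrightarrow> \<exists>w. Im w > 0 \<and> mobius \<sigma> w = z \<and> norm (cj z N) * Im w = k"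
      using nilpotent_cusp_coordinate[OF trN N0 True, of t] unfolding BN by metis
    have "\<bar>t\<bar> = 1" using t by (auto simp: power2_eq_1_iff)
    then have "\<bar>trace B\<bar> = 2" by (simp add: t_def)
    then have "parabolic B" using B dB by (simp add: parabolic_def)
    then have "mobius_P1 \<sigma> None \<in> cusps \<Gamma>" using s(2) B(1) unfolding cusps_def by blast
    then obtain Y where Y: "\<And>z. Im z > 0 \<Longrightarrow> Im z > Y \<Longrightarrow> Im z * cmod (slash 2 f \<sigma> z) \<le> 1"
      using cusp[OF s(1)] by blast
    \<comment> \<open>Chosen so that \<open>q0 * norm (cj z N) < e\<close> forces
      \<open>Im w\<close> above |Y| + 1, where the bound near the cusp applies.\<close>
    define e where "e = min 1 (q0 * k / (\<bar>Y\<bar> + 1))"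
    have "e > 0" using s q0 by (simp add: e_def add_nonneg_pos)
    then show ?thesis
    proof (rule that)
      fix z A assume z: "Im z > 0" and A: "A \<in> \<Gamma>" "A \<noteq> mat 1" "A ** B = B ** A" "norm (cj z A - mat 1) < e"
      obtain w where w: "Im w > 0" "mobius \<sigma> w = z" "norm (cj z N) * Im w = k" using s(4)[OF z] by blast
      have "q0 * norm (cj z N) < e" using main[OF z A] by (simp add: e_def)
      also have "e \<le> q0 * k / (\<bar>Y\<bar> + 1)" by (simp add: e_def)
      finally have "q0 * norm (cj z N) * (\<bar>Y\<bar> + 1) < q0 * (norm (cj z N) * Im w)"
        unfolding w(3) by (simp add: pos_less_divide_eq add_nonneg_pos)
      then have "q0 * norm (cj z N) * (\<bar>Y\<bar> + 1) < q0 * norm (cj z N) * Im w" by (simp add: mult.assoc)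
      then have "\<bar>Y\<bar> + 1 < Im w" by (rule mult_left_less_imp_less) (use q0 in simp)
      then have "Im w * cmod (slash 2 f \<sigma> w) \<le> 1" using Y w(1) by simp
      then show "Im z * cmod (f z) \<le> 1" using height_slash[OF s(1) w(1), of f] w(2) by simp
    qed
  qed
qed

section \<open>Invariance of the hyperbolic area\<close>

text \<open>The substitution rule with Jacobian determinants is a statement on
  \<open>real^2\<close>, so areas are computed there and carried back.\<close>

definition vec_complex :: "real^2 \<Rightarrow> complex" where
  "vec_complex v = Complex (v$1) (v$2)"

definition complex_vec :: "complex \<Rightarrow> real^2" where
  "complex_vec z = vector [Re z, Im z]"

lemma complex_vec_nth [simp]: "complex_vec z $ 1 = Re z" "complex_vec z $ 2 = Im z"
  by (simp_all add: complex_vec_def vector_2)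

lemma vec_complex_sel [simp]: "Re (vec_complex v) = v$1" "Im (vec_complex v) = v$2"
  by (simp_all add: vec_complex_def)

lemma vec_complex_inverse [simp]: "vec_complex (complex_vec z) = z" "complex_vec (vec_complex v) = v"
  by (simp_all add: complex_eq_iff vec_eq_iff forall_2)

lemma bounded_linear_vec_complex: "bounded_linear vec_complex"
  by (intro linear_conv_bounded_linear[THEN iffD1] linearI) (simp_all add: complex_eq_iff)

lemma bounded_linear_complex_vec: "bounded_linear complex_vec"
  by (intro linear_conv_bounded_linear[THEN iffD1] linearI) (simp_all add: vec_eq_iff forall_2)

lemma measurable_vec_complex [measurable]: "vec_complex \<in> borel \<rightarrow>\<^sub>M borel"
  by (intro borel_measurable_continuous_onI linear_continuous_on bounded_linear_vec_complex)

text \<open>Lebesgue measure is determined by its values on boxes, and \<open>vec_complex\<close>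
  matches boxes with equal sides.\<close>

lemma lborel_complex_eq: "(lborel :: complex measure) = distr lborel borel vec_complex"
proof (rule lborel_eqI)
  fix l u :: complex assume lu: "\<And>b. b \<in> Basis \<Longrightarrow> l \<bullet> b \<le> u \<bullet> b"
  have le: "Re l \<le> Re u" "Im l \<le> Im u" using lu[of 1] lu[of \<i>] by (auto simp: Basis_complex_def inner_complex_def)
  have B: "(Basis :: (real^2) set) = {axis 1 1, axis 2 1}"
    by (auto simp: Basis_vec_def) (metis exhaust_2)
  have ne: "axis 1 1 \<noteq> (axis 2 1 :: real^2)" by (simp add: axis_eq_axis)
  have "vec_complex -` box l u = box (complex_vec l) (complex_vec u)"
    by (auto simp: box_def B Basis_complex_def inner_complex_def inner_axis)
  then have "emeasure (distr lborel borel vec_complex) (box l u) = emeasure lborel (box (complex_vec l) (complex_vec u))"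
    by (simp add: emeasure_distr)
  also have "\<dots> = (\<Prod>b\<in>Basis. (complex_vec u - complex_vec l) \<bullet> b)"
    by (rule emeasure_lborel_box) (use le in \<open>auto simp: B inner_axis\<close>)
  also have "(\<Prod>b\<in>Basis. (complex_vec u - complex_vec l) \<bullet> b) = (\<Prod>b\<in>Basis. (u - l) \<bullet> b)"
    using ne by (simp add: B inner_axis Basis_complex_def inner_complex_def)
  finally show "emeasure (distr lborel borel vec_complex) (box l u) = (\<Prod>b\<in>Basis. (u - l) \<bullet> b)" .
qed simp

lemma hyperbolic_area_vec:
  assumes [measurable]: "E \<in> sets borel"
  shows "hyperbolic_area E = (\<integral>\<^sup>+v. ennreal (1 / (v$2)\<^sup>2 * indicator (vec_complex -` E) v) \<partial>lborel)"
proof -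
  have "hyperbolic_area E = (\<integral>\<^sup>+v. ennreal (1 / (Im (vec_complex v))\<^sup>2) * indicator E (vec_complex v) \<partial>lborel)"
    unfolding hyperbolic_area_def lborel_complex_eq by (subst nn_integral_distr) auto
  also have "\<dots> = (\<integral>\<^sup>+v. ennreal (1 / (v$2)\<^sup>2 * indicator (vec_complex -` E) v) \<partial>lborel)"
    by (intro nn_integral_cong) (auto simp: indicator_def)
  finally show ?thesis .
qed

lemma measurable_mobius [measurable]: "mobius A \<in> borel_measurable borel"
  unfolding mobius_def by measurable

lemma mobius_image_eq:
  assumes "det A = 1" "E \<subseteq> upper_half_plane"
  shows "mobius A ` E = {z. Im z > 0 \<and> mobius (adj2 A) z \<in> E}"
  using assms by (force simp: upper_half_plane_def mobius_adj2 mobius_upper image_iff)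

lemma mobius_has_field_derivative:
  assumes "det A = 1" "Im z > 0"
  shows "(mobius A has_field_derivative 1 / (jfac A z)\<^sup>2) (at z within S)"
proof -
  have nz: "jfac A z \<noteq> 0" using mobius_denom_nonzero assms by blast
  have d: "of_real (A$1$1) * of_real (A$2$2) - of_real (A$1$2) * of_real (A$2$1) = (1::complex)"
    using arg_cong[OF assms(1), of complex_of_real] by (simp add: det_2)
  have "((\<lambda>z. (of_real (A$1$1) * z + of_real (A$1$2)) / (of_real (A$2$1) * z + of_real (A$2$2)))
     has_field_derivative (of_real (A$1$1) * jfac A z - (of_real (A$1$1) * z + of_real (A$1$2)) * of_real (A$2$1)) / (jfac A z * jfac A z)) (at z within S)"
    using nz unfolding jfac_def by (auto intro!: derivative_eq_intros)
  moreover have "of_real (A$1$1) * jfac A z - (of_real (A$1$1) * z + of_real (A$1$2)) * of_real (A$2$1) = 1"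
    unfolding d[symmetric] jfac_def by (simp add: algebra_simps)
  ultimately show ?thesis unfolding mobius_def[abs_def] by (simp add: power2_eq_square)
qed

text \<open>The real Jacobian at \<open>z\<close> is |jfac|^-4 and the height scales by |jfac|^-2,
  so the density 1 / (Im z)^2 absorbs it. An upper bound for the area of an image is what the double
  counting in \<open>thick_area\<close> uses.\<close>

lemma hyperbolic_area_mobius_le:
  assumes A: "det A = 1" and E [measurable]: "E \<in> sets borel" and EH: "E \<subseteq> upper_half_plane" and fin: "hyperbolic_area E < \<infinity>"
  shows "mobius A ` E \<in> sets borel" "hyperbolic_area (mobius A ` E) \<le> hyperbolic_area E"
proof -
  have "mobius A ` E = {z\<in>space borel. Im z > 0 \<and> mobius (adj2 A) z \<in> E}" using mobius_image_eq[OF A EH] by simp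
  also have "\<dots> \<in> sets borel" by measurable
  finally show [measurable]: "mobius A ` E \<in> sets borel" .
  define S where "S = vec_complex -` E"
  define w where "w = (\<lambda>v::real^2. 1 / (v$2)\<^sup>2)"
  define g where "g v = complex_vec (mobius A (vec_complex v))" for v
  define g' where "g' v h = complex_vec (1 / (jfac A (vec_complex v))\<^sup>2 * vec_complex h)" for v h
  have Smeas [measurable]: "S \<in> sets borel" unfolding S_def
    using measurable_sets[OF measurable_vec_complex E] by simp
  have [measurable]: "w \<in> borel_measurable borel" unfolding w_def by measurable
  have gS: "g ` S = vec_complex -` (mobius A ` E)"
  proof
    show "g ` S \<subseteq> vec_complex -` (mobius A ` E)" by (auto simp: g_def S_def)
    show "vec_complex -` (mobius A ` E) \<subseteq> g ` S"
    proof
      fix v assume "v \<in> vec_complex -` (mobius A ` E)"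
      then obtain z where z: "z \<in> E" "vec_complex v = mobius A z" by auto
      then have "v = g (complex_vec z)" unfolding g_def by (metis vec_complex_inverse)
      then show "v \<in> g ` S" using z by (auto simp: S_def)
    qed
  qed
  have SH: "Im (vec_complex v) > 0" if "v \<in> S" for v using that EH by (auto simp: S_def upper_half_plane_def)
  have der: "(g has_derivative g' v) (at v within S)" if v: "v \<in> S" for v
  proof -
    have "(mobius A has_derivative (*) (1 / (jfac A (vec_complex v))\<^sup>2)) (at (vec_complex v) within (vec_complex ` S))"
      using mobius_has_field_derivative[OF A SH[OF v]] by (simp add: has_field_derivative_def)
    then have "((\<lambda>v. mobius A (vec_complex v)) has_derivative (\<lambda>h. 1 / (jfac A (vec_complex v))\<^sup>2 * vec_complex h)) (at v within S)"
      by (rule has_derivative_in_compose[rotated]) (intro bounded_linear_imp_has_derivative bounded_linear_vec_complex)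
    then show ?thesis unfolding g_def g'_def
      by (rule bounded_linear.has_derivative[OF bounded_linear_complex_vec])
  qed
  have wint: "\<bar>det (matrix (g' v))\<bar> * w (g v) = w v" if v: "v \<in> S" for v
  proof -
    define d where "d = 1 / (jfac A (vec_complex v))\<^sup>2"
    have ax: "vec_complex (axis 1 1) = 1" "vec_complex (axis 2 1) = \<i>"
      by (simp_all add: complex_eq_iff axis_def)
    \<comment> \<open>Multiplication by the complex number \<open>d\<close> is a rotation scaled by
      |d|, with determinant |d|^2.\<close>
    have "det (matrix (g' v)) = (Re d)\<^sup>2 + (Im d)\<^sup>2"
      unfolding det_2 matrix_def g'_def d_def[symmetric] by (simp add: ax power2_eq_square) (simp add: axis_def power2_eq_square)
    also have "\<dots> = (cmod d)\<^sup>2" by (simp add: cmod_power2)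
    finally have det: "\<bar>det (matrix (g' v))\<bar> = (1 / (cmod (jfac A (vec_complex v)))\<^sup>2)\<^sup>2"
      by (simp add: d_def norm_divide norm_power)
    show ?thesis unfolding det
      using mobius_denom_nonzero[OF A SH[OF v]] SH[OF v]
      by (simp add: w_def g_def Im_mobius[OF A] power_divide field_simps)
  qed
  define r where "r = enn2real (hyperbolic_area E)"
  have r: "hyperbolic_area E = ennreal r" "r \<ge> 0" using fin by (auto simp: r_def)
  have "((\<lambda>v. w v * indicator S v) has_integral r) UNIV"
    by (rule nn_integral_has_integral) (use r hyperbolic_area_vec[OF E] in \<open>auto simp: w_def S_def\<close>)
  then have "((\<lambda>v. if v \<in> S then w v else 0) has_integral r) UNIV"
    by (rule has_integral_eq[rotated]) (simp add: indicator_def)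
  then have "(w has_integral r) S" by (simp only: has_integral_restrict_UNIV)
  then have I: "((\<lambda>v. \<bar>det (matrix (g' v))\<bar> * w (g v)) has_integral r) S"
    by (rule has_integral_eq[rotated]) (simp add: wint)
  have 1: "w integrable_on g ` S \<and> integral (g ` S) w \<le> integral S (\<lambda>v. \<bar>det (matrix (g' v))\<bar> * w (g v))"
    by (rule integral_on_image_ubound_nonneg[OF _ der]) (use I in \<open>auto simp: w_def\<close>)
  then have le: "integral (g ` S) w \<le> r" using integral_unique[OF I] by simp
  have "hyperbolic_area (mobius A ` E) = (\<integral>\<^sup>+v. ennreal (indicator (g ` S) v * w v) \<partial>lborel)"
    unfolding hyperbolic_area_vec[OF \<open>mobius A ` E \<in> sets borel\<close>] gS w_def by (simp add: mult.commute)
  also have "\<dots> = ennreal (integral (g ` S) w)"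
    by (rule nn_integral_has_integral_lebesgue) (use 1 in \<open>auto simp: w_def\<close>)
  also have "\<dots> \<le> ennreal r" using le by (rule ennreal_leI)
  finally show "hyperbolic_area (mobius A ` E) \<le> hyperbolic_area E" using r by simp
qed

section \<open>The thick part is covered by finitely many orbits of balls\<close>

text \<open>A Euclidean box with sides proportional to the height stands in for a hyperbolic ball:
  it is Borel, its area is bounded below independently of \<open>p\<close>, and its points have
  \<open>hdist\<close> at most 1 from the centre.\<close>

definition hyp_box :: "complex \<Rightarrow> complex set" where
  "hyp_box p = box (p - Complex (Im p / 4) (Im p / 4)) (p + Complex (Im p / 4) (Im p / 4))"

lemma hyp_box_iff:
  "w \<in> hyp_box p \<longleftrightarrow> \<bar>Re w - Re p\<bar> < Im p / 4 \<and> \<bar>Im w - Im p\<bar> < Im p / 4"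
proof -
  have "w \<in> hyp_box p \<longleftrightarrow> (Re p - Im p / 4 < Re w \<and> Re w < Re p + Im p / 4) \<and>
      (Im p - Im p / 4 < Im w \<and> Im w < Im p + Im p / 4)"
    by (simp add: hyp_box_def box_def Basis_complex_def inner_complex_def)
  then show ?thesis by linarith
qed

lemma hyp_box_hdist:
  assumes "Im p > 0" "w \<in> hyp_box p"
  shows "Im w > 0" "hdist p w \<le> 1"
proof -
  have b: "\<bar>Re w - Re p\<bar> < Im p / 4" "\<bar>Im w - Im p\<bar> < Im p / 4" using assms by (auto simp: hyp_box_iff)
  then have I: "Im w \<ge> 3/4 * Im p" by linarith
  then show pos: "Im w > 0" using assms by linarith
  have "(cmod (p - w))\<^sup>2 = \<bar>Re w - Re p\<bar>\<^sup>2 + \<bar>Im w - Im p\<bar>\<^sup>2"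
    by (simp add: cmod_power2 power2_commute)
  also have "\<dots> \<le> (Im p / 4)\<^sup>2 + (Im p / 4)\<^sup>2" using b by (intro add_mono power_mono) auto
  also have "\<dots> = Im p * (Im p / 8)" by (simp add: power2_eq_square)
  also have "\<dots> \<le> Im p * Im w" using I assms by (intro mult_left_mono) auto
  finally show "hdist p w \<le> 1" using pos assms by (simp add: hdist_def divide_le_eq)
qed

text \<open>A B^-1 carries \<open>mobius B w\<close>, near \<open>q\<close>, to
  \<open>mobius A w\<close>, near \<open>p\<close>. With p = q this bounds multiplicities; with
  distinct \<open>p\<close> and \<open>q\<close> it gives disjointness.\<close>

lemma hyp_box_orbit:
  assumes A: "det A = 1" "mobius A w \<in> hyp_box p" and B: "det B = 1" "mobius B w \<in> hyp_box q"
    and pos: "Im w > 0" "Im p > 0" "Im q > 0"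
  shows "hdist p (mobius (A ** adj2 B) q) \<le> 12"
proof -
  let ?C = "A ** adj2 B"
  have C: "det ?C = 1" using A B by (simp add: det_mul)
  have a: "Im (mobius A w) > 0" "hdist p (mobius A w) \<le> 1" using hyp_box_hdist[OF pos(2) A(2)] by auto
  have b: "Im (mobius B w) > 0" "hdist q (mobius B w) \<le> 1" using hyp_box_hdist[OF pos(3) B(2)] by auto
  have "mobius ?C (mobius B w) = mobius A w"
    using pos A(1) B(1) by (simp add: mobius_mult_jfac mobius_upper mobius_adj2)
  then have "hdist (mobius ?C q) (mobius A w) \<le> 1"
    using hdist_mobius[OF C pos(3) b(1)] b(2) by simp
  then show ?thesis
    by (intro hdist_quasi_triangle[OF pos(2) a(1) mobius_upper[OF C pos(3)] a(2)]) (simp add: hdist_sym)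
qed

section \<open>Counting orbits by area\<close>

definition hyp_measure :: "complex measure" where
  "hyp_measure = density lborel (\<lambda>z. ennreal (1 / (Im z)\<^sup>2))"

lemma sets_hyp_measure [simp, measurable_cong]: "sets hyp_measure = sets borel"
  by (simp add: hyp_measure_def)

lemma hyperbolic_area_emeasure: "S \<in> sets borel \<Longrightarrow> hyperbolic_area S = emeasure hyp_measure S"
  by (simp add: hyperbolic_area_def hyp_measure_def emeasure_density)

lemma hyp_box_area:
  assumes "Im p > 0"
  shows "ennreal (4/25) \<le> emeasure hyp_measure (hyp_box p)"
proof -
  \<comment> \<open>The density at the top edge of the box, at height 5/4 * Im p; times the
    Euclidean area (Im p / 2)^2 it is 4/25.\<close>
  define c where "c = 1 / (5/4 * Im p)\<^sup>2"
  have m: "hyp_box p \<in> sets borel" by (simp add: hyp_box_def)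
  have "emeasure lborel (hyp_box p) = ennreal ((Im p / 2) * (Im p / 2))"
    unfolding hyp_box_def
    by (subst emeasure_lborel_box) (use assms in \<open>auto simp: Basis_complex_def inner_complex_def\<close>)
  then have "ennreal c * emeasure lborel (hyp_box p) = ennreal (c * ((Im p / 2) * (Im p / 2)))"
    using assms by (simp add: c_def flip: ennreal_mult')
  also have "c * ((Im p / 2) * (Im p / 2)) = 4/25"
    using assms by (simp add: c_def power2_eq_square field_simps)
  finally have "ennreal (4/25) = (\<integral>\<^sup>+z. ennreal c * indicator (hyp_box p) z \<partial>lborel)"
    using m by (simp add: nn_integral_cmult_indicator)
  also have "\<dots> \<le> (\<integral>\<^sup>+z. ennreal (1 / (Im z)\<^sup>2) * indicator (hyp_box p) z \<partial>lborel)"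
  proof (intro nn_integral_mono)
    fix z
    show "ennreal c * indicator (hyp_box p) z \<le> ennreal (1 / (Im z)\<^sup>2) * indicator (hyp_box p) z"
    proof (cases "z \<in> hyp_box p")
      case True
      then have "\<bar>Im z - Im p\<bar> < Im p / 4" by (simp add: hyp_box_iff)
      then have "0 < Im z" "Im z \<le> 5/4 * Im p" using assms by linarith+
      then have "c \<le> 1 / (Im z)\<^sup>2" unfolding c_def by (intro divide_left_mono power_mono) auto
      then show ?thesis using True by (simp add: ennreal_leI)
    qed simp
  qed
  also have "\<dots> = emeasure hyp_measure (hyp_box p)"
    using hyperbolic_area_emeasure[OF m] by (simp add: hyperbolic_area_def)
  finally show ?thesis .
qed

text \<open>Fix one such element \<open>A0\<close>. Every other \<open>A\<close> gives A A0^-1,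
  which moves \<open>p\<close> by \<open>hdist\<close> at most 12 and so has norm at most sqrt 14 <
  4 seen from \<open>p\<close>. Thickness makes the group seen from \<open>p\<close> isolated with
  radius \<epsilon>, so \<open>M\<close> bounds the number of these elements.\<close>

lemma thick_multiplicity:
  assumes L: "matgroup \<Gamma>" and p: "p \<in> thick \<epsilon> \<Gamma>" and e: "\<epsilon> > 0" and w: "Im w > 0"
    and M: "packing_bound \<epsilon> 4 M"
  shows "finite {A\<in>\<Gamma>. mobius A w \<in> hyp_box p}" "card {A\<in>\<Gamma>. mobius A w \<in> hyp_box p} \<le> M"
proof -
  let ?S = "{A\<in>\<Gamma>. mobius A w \<in> hyp_box p}"
  have pH: "Im p > 0" using p by (simp add: thick_def)
  have det: "det A = 1" if "A \<in> \<Gamma>" for A using matgroupD(2)[OF L that] .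
  have iso: "isolated1 \<epsilon> (cj p ` \<Gamma>)"
    unfolding isolated1_def
  proof (intro conjI ballI impI e)
    fix X assume "X \<in> cj p ` \<Gamma>" and lt: "norm (X - mat 1) < \<epsilon>"
    then obtain A where A: "A \<in> \<Gamma>" "X = cj p A" by auto
    have "A = mat 1"
    proof (rule ccontr)
      assume "A \<noteq> mat 1"
      then have "\<epsilon> \<le> norm (cj p A - mat 1)" using p A(1) by (simp add: thick_def)
      with lt A show False by simp
    qed
    then show "X = mat 1" using A by simp
  qed
  let ?T = "{X \<in> cj p ` \<Gamma>. norm X \<le> 4}"
  have T: "finite ?T" "card ?T \<le> M" using M matgroup_cj[OF L pH] iso unfolding packing_bound_def by blast+
  have "finite ?S \<and> card ?S \<le> card ?T"
  proof (cases "?S = {}")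
    case False
    then obtain A0 where A0: "A0 \<in> \<Gamma>" "mobius A0 w \<in> hyp_box p" by blast
    define h where "h A = cj p (A ** adj2 A0)" for A
    have inj: "inj_on h ?S"
    proof (rule inj_onI)
      fix A B assume "h A = h B"
      then have "A ** adj2 A0 = B ** adj2 A0" unfolding h_def by (rule cj_inject[OF pH])
      then have "A ** adj2 A0 ** A0 = B ** adj2 A0 ** A0" by simp
      then show "A = B" by (simp add: matrix_mul_assoc[symmetric] adj2_inverse[OF det[OF A0(1)]])
    qed
    have sub: "h ` ?S \<subseteq> ?T"
    proof
      fix X assume "X \<in> h ` ?S"
      then obtain A where A: "A \<in> \<Gamma>" "mobius A w \<in> hyp_box p" "X = cj p (A ** adj2 A0)" by (auto simp: h_def)
      let ?B = "A ** adj2 A0"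
      have B: "?B \<in> \<Gamma>" using matgroupD(4)[OF L A(1) matgroupD(3)[OF L A0(1)]] .
      have dB: "det ?B = 1" by (rule det[OF B])
      have "hdist p (mobius ?B p) \<le> 12"
        by (rule hyp_box_orbit[OF det[OF A(1)] A(2) det[OF A0(1)] A0(2) w pH pH])
      then have "(norm X)\<^sup>2 \<le> 4\<^sup>2" unfolding A(3) norm_cj_det1[OF dB pH] by simp
      then have "norm X \<le> 4" by (rule power2_le_imp_le) simp
      then show "X \<in> ?T" using A(3) B by simp
    qed
    show ?thesis using inj_on_finite[OF inj sub T(1)] card_inj_on_le[OF inj sub T(1)] by simp
  next
    case True
    show ?thesis unfolding True by simp
  qed
  then show "finite ?S" "card ?S \<le> M" using T by auto
qed

text \<open>Double counting: the images under \<open>A\<close> of the pieces \<open>E A\<close> of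
  \<open>F\<close> cover the box, so its area is at most the sum of the areas of all
  \<open>E A\<close>, and each point of \<open>D\<close> lies in at most \<open>M\<close> of these
  pieces.\<close>

lemma thick_area:
  assumes L: "matgroup \<Gamma>" "countable \<Gamma>" and p: "p \<in> thick \<epsilon> \<Gamma>" and e: "\<epsilon> > 0"
    and M: "packing_bound \<epsilon> 4 M"
    and F: "F \<in> sets borel" "F \<subseteq> upper_half_plane" "hyperbolic_area F < \<infinity>"
      "\<And>z. Im z > 0 \<Longrightarrow> \<exists>w\<in>F. \<exists>A\<in>\<Gamma>. w = mobius A z"
  defines "D \<equiv> {w\<in>F. \<exists>A\<in>\<Gamma>. mobius A w \<in> hyp_box p}"
  shows "D \<in> sets borel" "ennreal (4/25) \<le> of_nat M * emeasure hyp_measure D"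
proof -
  have pH: "Im p > 0" using p by (simp add: thick_def)
  have det: "det A = 1" if "A \<in> \<Gamma>" for A using matgroupD(2)[OF L(1) that] .
  have Um [measurable]: "hyp_box p \<in> sets borel" by (simp add: hyp_box_def)
  note F(1) [measurable]
  define E where "E A = {w\<in>F. mobius A w \<in> hyp_box p}" for A
  have "E A = F \<inter> {w\<in>space borel. mobius A w \<in> hyp_box p}" for A by (auto simp: E_def)
  moreover have "{w\<in>space borel. mobius A w \<in> hyp_box p} \<in> sets borel" for A by measurable
  ultimately have Em [measurable]: "E A \<in> sets borel" for A using F(1) by (metis sets.Int)
  have DE: "D = (\<Union>A\<in>\<Gamma>. E A)" by (auto simp: D_def E_def)
  show Dm [measurable]: "D \<in> sets borel" unfolding DE using L(2) by (intro sets.countable_UN') auto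
  have EF: "E A \<subseteq> F" for A by (auto simp: E_def)
  have Efin: "hyperbolic_area (E A) < \<infinity>" for A
  proof -
    have "emeasure hyp_measure (E A) \<le> emeasure hyp_measure F" using EF F(1) by (intro emeasure_mono) auto
    then show ?thesis using F(1,3) by (simp add: hyperbolic_area_emeasure)
  qed
  have im: "mobius A ` E A \<in> sets borel" "emeasure hyp_measure (mobius A ` E A) \<le> emeasure hyp_measure (E A)" if "A \<in> \<Gamma>" for A
    using hyperbolic_area_mobius_le[OF det[OF that] Em order_trans[OF EF F(2)] Efin] hyperbolic_area_emeasure[OF Em]
      hyperbolic_area_emeasure by auto
  have "ennreal (4/25) \<le> emeasure hyp_measure (hyp_box p)" by (rule hyp_box_area[OF pH])
  also have "\<dots> = (\<integral>\<^sup>+z. indicator (hyp_box p) z \<partial>hyp_measure)" by simp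
  also have "\<dots> \<le> (\<integral>\<^sup>+z. (\<integral>\<^sup>+A. indicator (mobius A ` E A) z \<partial>count_space \<Gamma>) \<partial>hyp_measure)"
  proof (intro nn_integral_mono)
    fix z
    show "indicator (hyp_box p) z \<le> (\<integral>\<^sup>+A. indicator (mobius A ` E A) z \<partial>count_space \<Gamma> :: ennreal)"
    proof (cases "z \<in> hyp_box p")
      case True
      have zH: "Im z > 0" using hyp_box_hdist[OF pH True] by simp
      then obtain w A where w: "w \<in> F" "A \<in> \<Gamma>" "w = mobius A z" using F(4) by blast
      have z: "z = mobius (adj2 A) w" using w zH det by (simp add: mobius_adj2)
      then have "w \<in> E (adj2 A)" using w True by (simp add: E_def)
      then have "z \<in> mobius (adj2 A) ` E (adj2 A)" using z by blast
      then have "(1::ennreal) \<le> indicator (mobius (adj2 A) ` E (adj2 A)) z" by simp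
      also have "\<dots> \<le> (\<integral>\<^sup>+A. indicator (mobius A ` E A) z \<partial>count_space \<Gamma>)"
        by (rule nn_integral_ge_point) (rule matgroupD(3)[OF L(1) w(2)])
      finally show ?thesis using True by simp
    qed simp
  qed
  also have "\<dots> = (\<integral>\<^sup>+A. (\<integral>\<^sup>+z. indicator (mobius A ` E A) z \<partial>hyp_measure) \<partial>count_space \<Gamma>)"
    by (rule nn_integral_count_space_nn_integral[OF L(2)]) (use im in auto)
  also have "\<dots> = (\<integral>\<^sup>+A. emeasure hyp_measure (mobius A ` E A) \<partial>count_space \<Gamma>)"
    by (intro nn_integral_cong) (use im in auto)
  also have "\<dots> \<le> (\<integral>\<^sup>+A. emeasure hyp_measure (E A) \<partial>count_space \<Gamma>)"
    by (intro nn_integral_mono) (use im in auto)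
  also have "\<dots> = (\<integral>\<^sup>+A. (\<integral>\<^sup>+z. indicator (E A) z \<partial>hyp_measure) \<partial>count_space \<Gamma>)"
    by (intro nn_integral_cong) auto
  also have "\<dots> = (\<integral>\<^sup>+z. (\<integral>\<^sup>+A. indicator (E A) z \<partial>count_space \<Gamma>) \<partial>hyp_measure)"
    by (rule nn_integral_count_space_nn_integral[OF L(2), symmetric]) auto
  also have "\<dots> \<le> (\<integral>\<^sup>+z. of_nat M * indicator D z \<partial>hyp_measure)"
  proof (intro nn_integral_mono)
    fix z
    have "(\<integral>\<^sup>+A. indicator (E A) z \<partial>count_space \<Gamma>) = (\<integral>\<^sup>+A. indicator {A\<in>\<Gamma>. z \<in> E A} A \<partial>count_space \<Gamma> :: ennreal)"
      by (intro nn_integral_cong) (auto simp: indicator_def)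
    also have "\<dots> = emeasure (count_space \<Gamma>) {A\<in>\<Gamma>. z \<in> E A}" by (rule nn_integral_indicator) auto
    also have "\<dots> \<le> of_nat M * indicator D z"
    proof (cases "z \<in> D")
      case True
      then have zF: "z \<in> F" and zH: "Im z > 0" using F(2) by (auto simp: D_def upper_half_plane_def)
      have eq: "{A\<in>\<Gamma>. z \<in> E A} = {A\<in>\<Gamma>. mobius A z \<in> hyp_box p}" using zF by (auto simp: E_def)
      show ?thesis using thick_multiplicity[OF L(1) p e zH M] True unfolding eq
        by (subst emeasure_count_space_finite) auto
    next
      case False
      then have none: "{A\<in>\<Gamma>. z \<in> E A} = {}" by (auto simp: D_def E_def)
      show ?thesis unfolding none by simp
    qed
    finally show "(\<integral>\<^sup>+A. indicator (E A) z \<partial>count_space \<Gamma>) \<le> of_nat M * indicator D z" .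
  qed
  also have "\<dots> = of_nat M * emeasure hyp_measure D" by (rule nn_integral_cmult_indicator) simp
  finally show "ennreal (4/25) \<le> of_nat M * emeasure hyp_measure D" .
qed

text \<open>Thick points with pairwise distant orbits own disjoint parts \<open>D p\<close> of
  \<open>F\<close>, each of area at least 4 / (25 M), so their number is bounded; a separated set of
  largest size leaves no thick point uncovered.\<close>

lemma thick_covered:
  assumes L: "matgroup \<Gamma>" "countable \<Gamma>" and cof: "cofinite_subgroup \<Gamma>" and e: "\<epsilon> > 0"
  obtains P where "finite P" "P \<subseteq> {z. Im z > 0}" "\<And>z. z \<in> thick \<epsilon> \<Gamma> \<Longrightarrow> \<exists>A\<in>\<Gamma>. \<exists>p\<in>P. hdist p (mobius A z) \<le> 12"
proof -
  obtain F where F: "F \<in> sets borel" "F \<subseteq> upper_half_plane" "hyperbolic_area F < \<infinity>"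
      "\<And>z. Im z > 0 \<Longrightarrow> \<exists>w\<in>F. \<exists>A\<in>\<Gamma>. w = mobius A z"
  proof -
    obtain F where F: "F \<in> sets borel" "F \<subseteq> upper_half_plane" "hyperbolic_area F < \<infinity>"
      and ex: "\<forall>z\<in>upper_half_plane. \<exists>!w. w \<in> F \<and> (\<exists>A\<in>\<Gamma>. w = mobius A z)"
      using cof unfolding cofinite_subgroup_def by blast
    have "\<exists>w\<in>F. \<exists>A\<in>\<Gamma>. w = mobius A z" if "Im z > 0" for z
      using ex that unfolding upper_half_plane_def by blast
    then show ?thesis by (rule that[OF F])
  qed
  obtain M where M: "packing_bound \<epsilon> 4 M"
    using packing[OF e] by blast
  have det: "det A = 1" if "A \<in> \<Gamma>" for A using matgroupD(2)[OF L(1) that] .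
  define D where "D p = {w\<in>F. \<exists>A\<in>\<Gamma>. mobius A w \<in> hyp_box p}" for p
  define sep where "sep P \<longleftrightarrow> finite P \<and> P \<subseteq> thick \<epsilon> \<Gamma> \<and>
    (\<forall>p\<in>P. \<forall>q\<in>P. p \<noteq> q \<longrightarrow> (\<forall>A\<in>\<Gamma>. hdist p (mobius A q) > 12))" for P
  define a where "a = enn2real (emeasure hyp_measure F)"
  have a: "emeasure hyp_measure F = ennreal a" "a \<ge> 0"
    using F(1,3) by (auto simp: a_def hyperbolic_area_emeasure)
  have bound: "real (card P) \<le> 25/4 * (real M * a)" if P: "sep P" for P
  proof -
    have fin: "finite P" and th: "\<And>p. p \<in> P \<Longrightarrow> p \<in> thick \<epsilon> \<Gamma>" using P by (auto simp: sep_def)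
    have Dm: "D p \<in> sets borel" and Da: "ennreal (4/25) \<le> of_nat M * emeasure hyp_measure (D p)" if "p \<in> P" for p
      using thick_area[OF L th[OF that] e M F] unfolding D_def by auto
    have disj: "disjoint_family_on D P"
      unfolding disjoint_family_on_def
    proof (intro ballI impI)
      fix p q assume pq: "p \<in> P" "q \<in> P" "p \<noteq> q"
      show "D p \<inter> D q = {}"
      proof (rule ccontr)
        assume "D p \<inter> D q \<noteq> {}"
        then obtain w A B where w: "w \<in> F" and A: "A \<in> \<Gamma>" "mobius A w \<in> hyp_box p"
          and B: "B \<in> \<Gamma>" "mobius B w \<in> hyp_box q" by (auto simp: D_def)
        have wH: "Im w > 0" using w F(2) by (auto simp: upper_half_plane_def)
        have pH: "Im p > 0" "Im q > 0" using th pq by (auto simp: thick_def)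
        let ?C = "A ** adj2 B"
        have C: "?C \<in> \<Gamma>" using matgroupD(4)[OF L(1) A(1) matgroupD(3)[OF L(1) B(1)]] .
        have "hdist p (mobius ?C q) \<le> 12"
          by (rule hyp_box_orbit[OF det[OF A(1)] A(2) det[OF B(1)] B(2) wH pH])
        moreover have "hdist p (mobius ?C q) > 12" using P pq C by (auto simp: sep_def)
        ultimately show False by simp
      qed
    qed
    have "ennreal (real (card P) * (4/25)) = of_nat (card P) * ennreal (4/25)"
      unfolding ennreal_of_nat_eq_real_of_nat by (rule ennreal_mult) auto
    also have "\<dots> = (\<Sum>p\<in>P. ennreal (4/25))" by simp
    also have "\<dots> \<le> (\<Sum>p\<in>P. of_nat M * emeasure hyp_measure (D p))" by (intro sum_mono Da)
    also have "\<dots> = of_nat M * emeasure hyp_measure (\<Union>p\<in>P. D p)"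
      using Dm disj fin by (subst sum_emeasure[symmetric]) (auto simp: sum_distrib_left image_subset_iff)
    also have "\<dots> \<le> of_nat M * emeasure hyp_measure F"
      using F(1) by (intro mult_left_mono emeasure_mono) (auto simp: D_def)
    also have "\<dots> = ennreal (real M * a)" unfolding a(1) using a(2)
      by (simp add: ennreal_mult ennreal_of_nat_eq_real_of_nat)
    finally have "real (card P) * (4/25) \<le> real M * a" using a(2) by (subst (asm) ennreal_le_iff) auto
    then show ?thesis by simp
  qed
  define n where "n = nat \<lceil>25/4 * (real M * a)\<rceil>"
  have bn: "card P \<le> n" if "sep P" for P
  proof -
    have "real (card P) \<le> real n" using bound[OF that] unfolding n_def by linarith
    then show ?thesis by simp
  qed
  have "sep {}" by (simp add: sep_def)
  then have "\<exists>P. sep P \<and> (\<forall>Q. sep Q \<longrightarrow> card Q \<le> card P)"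
    using bn by (intro ex_has_greatest_nat[of sep "{}" card "Suc n"]) (auto simp: less_Suc_eq_le)
  then obtain P where P: "sep P" "\<And>Q. sep Q \<Longrightarrow> card Q \<le> card P" by blast
  show ?thesis
  proof (rule that[of P])
    show "finite P" "P \<subseteq> {z. Im z > 0}" using P(1) by (auto simp: sep_def thick_def)
    fix z assume z: "z \<in> thick \<epsilon> \<Gamma>"
    show "\<exists>A\<in>\<Gamma>. \<exists>p\<in>P. hdist p (mobius A z) \<le> 12"
    proof (rule ccontr)
      assume neg: "\<not> ?thesis"
      then have far: "hdist p (mobius A z) > 12" if "A \<in> \<Gamma>" "p \<in> P" for A p using that by force
      have "z \<notin> P" using far[OF matgroupD(1)[OF L(1)], of z] by (auto simp: hdist_def)
      have zH: "Im z > 0" using z by (simp add: thick_def)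
      \<comment> \<open>Separation ranges over ordered pairs, so the bound is also needed with the
        roles of \<open>z\<close> and \<open>p\<close> exchanged; the inverse of \<open>A\<close>
        transports it.\<close>
      have far': "hdist z (mobius A p) > 12" if "A \<in> \<Gamma>" "p \<in> P" for A p
      proof -
        have pH: "Im p > 0" using P(1) that by (auto simp: sep_def thick_def)
        have "hdist p (mobius (adj2 A) z) = hdist (mobius A p) (mobius A (mobius (adj2 A) z))"
          using hdist_mobius[OF det[OF that(1)] pH, of "mobius (adj2 A) z"] det[OF that(1)] zH
          by (simp add: mobius_upper)
        also have "\<dots> = hdist z (mobius A p)" using zH det[OF that(1)] by (simp add: mobius_adj2 hdist_sym)
        finally show ?thesis using far[OF matgroupD(3)[OF L(1) that(1)] that(2)] by simp
      qed
      have "sep (insert z P)"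
        using P(1) z far far' unfolding sep_def by auto
      then have "card (insert z P) \<le> card P" by (rule P(2))
      then show False using \<open>z \<notin> P\<close> P(1) by (simp add: sep_def)
    qed
  qed
qed

section \<open>Periodic functions and their expansions\<close>

lemma periodic_int:
  assumes per: "\<And>z. Im z > 0 \<Longrightarrow> F (z + of_real w) = F z" and z: "Im z > 0"
  shows "F (z + of_int n * of_real w) = F z"
proof -
  have nat: "F (z + of_nat m * of_real w) = F z" if "Im z > 0" for m z
  proof (induction m)
    case (Suc m)
    have "F (z + of_nat (Suc m) * of_real w) = F ((z + of_nat m * of_real w) + of_real w)"
      by (simp add: algebra_simps)
    also have "\<dots> = F (z + of_nat m * of_real w)" by (rule per) (use that in simp)
    finally show ?case using Suc by simp
  qed simp
  show ?thesis
  proof (cases "n \<ge> 0")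
    case True
    then show ?thesis using nat[OF z, of "nat n"] by simp
  next
    case False
    have "F ((z + of_int n * of_real w) + of_nat (nat (- n)) * of_real w) = F (z + of_int n * of_real w)"
      by (rule nat) (use z in simp)
    moreover have "(z + of_int n * of_real w) + of_nat (nat (- n)) * of_real w = z"
      using False by (simp add: algebra_simps)
    ultimately show ?thesis by simp
  qed
qed



text \<open>The local parameter at a cusp of width \<open>w\<close>.\<close>

definition qexp :: "real \<Rightarrow> complex \<Rightarrow> complex" where
  "qexp w z = exp (2 * of_real pi * \<i> * z / of_real w)"

lemma norm_qexp: "cmod (qexp w z) = exp (- (2 * pi * Im z / w))"
  by (simp add: qexp_def)

lemma qexp_eq: "qexp w z = exp ((2 * of_real pi * \<i> / of_real w) * z)"
  by (simp add: qexp_def mult_ac)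

lemma qexp_in_ball: "w > 0 \<Longrightarrow> Im z > 0 \<Longrightarrow> qexp w z \<in> ball 0 1"
  by (simp add: norm_qexp)

lemma qexp_nonzero [simp]: "qexp w z \<noteq> 0"
  by (simp add: qexp_def)

lemma has_field_derivative_qexp:
  "(qexp w has_field_derivative (2 * of_real pi * \<i> / of_real w) * qexp w z) (at z within S)"
proof -
  have "((\<lambda>z. exp ((2 * of_real pi * \<i> / of_real w) * z)) has_field_derivative
      (2 * of_real pi * \<i> / of_real w) * exp ((2 * of_real pi * \<i> / of_real w) * z)) (at z within S)"
    by (rule derivative_eq_intros refl | simp)+
  then show ?thesis by (simp add: qexp_eq[abs_def])
qed

lemma eventually_Im_pos: "eventually (\<lambda>z. Im z > 0) (filtercomap Im at_top)"
  by (intro eventually_filtercomapI eventually_gt_at_top)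

lemma filterlim_qexp:
  assumes "w > 0"
  shows "(qexp w \<longlongrightarrow> 0) (filtercomap Im at_top)"
proof (rule tendsto_norm_zero_cancel)
  have "((\<lambda>y. exp (- (2 * pi * y / w))) \<longlongrightarrow> 0) at_top"
  proof (rule filterlim_compose[OF exp_at_bot])
    have "LIM y at_top. (2 * pi / w) * y :> at_top"
      using assms by (intro filterlim_tendsto_pos_mult_at_top[OF tendsto_const]) (auto intro: filterlim_ident)
    then show "LIM y at_top. - (2 * pi * y / w) :> at_bot"
      by (simp add: filterlim_uminus_at_bot)
  qed
  then have "((\<lambda>z. exp (- (2 * pi * Im z / w))) \<longlongrightarrow> 0) (filtercomap Im at_top)"
    by (rule filterlim_compose) (rule filterlim_filtercomap)
  then show "((\<lambda>z. norm (qexp w z)) \<longlongrightarrow> 0) (filtercomap Im at_top)" by (simp add: norm_qexp)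
qed

text \<open>\<open>F\<close> descends to a function \<open>G0\<close> of q on the punctured disc:
  periodicity makes the choice of logarithm irrelevant, so two branches, cut along opposite
  half-axes, prove holomorphy. The limit at infinity removes the singularity at 0 with value 0,
  which permits division by q.\<close>

lemma periodic_expansion:
  assumes hol: "F holomorphic_on {z. Im z > 0}" and w: "w > 0"
    and per: "\<And>z. Im z > 0 \<Longrightarrow> F (z + of_real w) = F z"
    and lim: "(F \<longlongrightarrow> 0) (filtercomap Im at_top)"
  obtains G where "G holomorphic_on ball 0 1" "\<And>z. Im z > 0 \<Longrightarrow> F z = qexp w z * G (qexp w z)"
proof -
  define c :: complex where "c = of_real w / (2 * of_real pi * \<i>)"
  have c0: "c \<noteq> 0" using w by (simp add: c_def)
  have cq: "qexp w z = exp (z / c)" for z by (simp add: c_def qexp_def mult_ac)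
  have c': "c = - \<i> * of_real (w / (2 * pi))" by (simp add: c_def field_simps)
  have Imc: "Im (c * u) = - (w / (2 * pi) * Re u)" for u unfolding c' by simp
  have c2: "c * ((of_int (2 * n) * of_real pi) * \<i>) = of_int n * of_real w" for n using w by (simp add: c_def field_simps)
  define G0 where "G0 q = F (c * Ln q)" for q
  have Hc: "Im (c * u) > 0" if "Re u < 0" for u
    unfolding Imc using w that mult_pos_neg[of "w / (2 * pi)" "Re u"] by simp
  have G0_eq: "G0 (exp u) = F (c * u)" if "Re u < 0" for u
  proof -
    have "exp (Ln (exp u)) = exp u" by simp
    then obtain n where n: "Ln (exp u) = u + (of_int (2 * n) * of_real pi) * \<i>" using exp_eq[of "Ln (exp u)" u] by auto
    have "c * Ln (exp u) = c * u + of_int n * of_real w" unfolding n distrib_left c2 ..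
    then show ?thesis unfolding G0_def using periodic_int[of F w, OF per Hc[OF that]] by simp
  qed
  have ReLn: "Re (Ln q) < 0" if "q \<in> ball 0 1" "q \<noteq> 0" for q using that by simp
  let ?A = "ball 0 1 - \<real>\<^sub>\<le>\<^sub>0 :: complex set" and ?B = "ball 0 1 - \<real>\<^sub>\<ge>\<^sub>0 :: complex set"
  have holF: "F holomorphic_on T" if "T \<subseteq> {z. Im z > 0}" for T using hol that by (rule holomorphic_on_subset)
  have "G0 holomorphic_on ?A"
  proof -
    have "(F \<circ> (\<lambda>q. c * Ln q)) holomorphic_on ?A"
      by (intro holomorphic_on_compose holF) (auto intro!: holomorphic_intros Hc ReLn)
    then show ?thesis by (simp add: o_def G0_def[abs_def])
  qed
  moreover have "G0 holomorphic_on ?B"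
  proof -
    have nz: "- q \<notin> \<real>\<^sub>\<le>\<^sub>0" if "q \<in> ?B" for q
      using that by (auto simp: complex_nonpos_Reals_iff complex_nonneg_Reals_iff)
    have re: "Re (Ln (- q) + \<i> * of_real pi) < 0" if "q \<in> ?B" for q
      using that ReLn[of "- q"] by (cases "q = 0") auto
    have ex: "exp (Ln (- q) + \<i> * of_real pi) = q" if "q \<in> ?B" for q
      using that by (cases "q = 0") (auto simp: exp_add)
    have "(F \<circ> (\<lambda>q. c * (Ln (- q) + \<i> * of_real pi))) holomorphic_on ?B"
      by (intro holomorphic_on_compose holF) (use nz re in \<open>auto intro!: holomorphic_intros Hc\<close>)
    then show ?thesis
    proof (rule holomorphic_transform)
      fix q assume q: "q \<in> ?B"
      show "(F \<circ> (\<lambda>q. c * (Ln (- q) + \<i> * of_real pi))) q = G0 q"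
        using G0_eq[OF re[OF q]] ex[OF q] by simp
    qed
  qed
  ultimately have "G0 holomorphic_on ?A \<union> ?B"
    by (rule holomorphic_on_Un) (auto intro!: open_Diff)
  moreover have "?A \<union> ?B = ball 0 1 - {0}"
    by (auto simp: complex_nonpos_Reals_iff complex_nonneg_Reals_iff complex_eq_iff)
  ultimately have G0hol: "G0 holomorphic_on ball 0 1 - {0}" by simp
  have G0lim: "(G0 \<longlongrightarrow> 0) (at 0)"
    unfolding G0_def
  proof (rule filterlim_compose[OF lim])
    have "LIM q at (0::complex). norm q :> at_right 0"
      by (auto simp: filterlim_at eventually_at_filter intro!: tendsto_eq_intros)
    then have "LIM q at (0::complex). ln (norm q) :> at_bot" by (rule filterlim_compose[OF ln_at_0])
    then have lim1: "LIM q at (0::complex). (w / (2 * pi)) * (- ln (norm q)) :> at_top"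
      using w by (intro filterlim_tendsto_pos_mult_at_top[OF tendsto_const]) (auto simp: filterlim_uminus_at_bot)
    have "(w / (2 * pi)) * (- ln (norm q)) = Im (c * Ln q)" if "q \<noteq> 0" for q
      unfolding Imc using that by simp
    then have "eventually (\<lambda>q. (w / (2 * pi)) * (- ln (norm q)) = Im (c * Ln q)) (at 0)"
      unfolding eventually_at_filter by (intro always_eventually) blast
    from filterlim_cong[OF refl refl this] lim1
    have "LIM q at (0::complex). Im (c * Ln q) :> at_top" by simp
    then show "LIM q at 0. c * Ln q :> filtercomap Im at_top" by (simp add: filterlim_filtercomap_iff o_def)
  qed
  have "((\<lambda>q. (q - 0) * G0 q) \<longlongrightarrow> 0) (at 0)"
    using G0lim by (auto intro!: tendsto_eq_intros)
  then obtain g where g: "g holomorphic_on ball 0 1" "\<And>q. q \<in> ball 0 1 - {0} \<Longrightarrow> g q = G0 q"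
    using holomorphic_on_extend_lim[OF G0hol] by auto
  have g0: "g 0 = 0"
  proof -
    have "isCont g 0"
      using holomorphic_on_imp_differentiable_at[OF g(1) open_ball, of 0]
      by (simp add: field_differentiable_imp_continuous_at)
    then have "(g \<longlongrightarrow> g 0) (at 0)" by (simp add: isCont_def)
    moreover have "(g \<longlongrightarrow> 0) (at 0)"
    proof (rule Lim_transform_eventually[OF G0lim])
      have "eventually (\<lambda>q. q \<in> ball 0 1 - {0}) (at (0::complex))"
        using eventually_at_in_open[of "ball 0 1" "0::complex"] by simp
      then show "eventually (\<lambda>q. G0 q = g q) (at 0)" by eventually_elim (simp add: g(2))
    qed
    ultimately show ?thesis using tendsto_unique trivial_limit_at by blast
  qed
  define G where "G q = (if q = 0 then deriv g 0 else (g q - g 0) / (q - 0))" for q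
  have "G holomorphic_on ball 0 1" unfolding G_def by (rule pole_lemma_open[OF g(1)]) simp
  moreover have "F z = qexp w z * G (qexp w z)" if z: "Im z > 0" for z
  proof -
    have "qexp w z * G (qexp w z) = G0 (qexp w z)"
      using g(2)[of "qexp w z"] qexp_in_ball[OF w z] by (simp add: G_def g0)
    also have "\<dots> = F (c * (z / c))" unfolding cq
      by (rule G0_eq) (use w z c0 in \<open>simp add: c' Re_divide power2_eq_square\<close>)
    finally show ?thesis using c0 by simp
  qed
  ultimately show ?thesis by (rule that)
qed

text \<open>In the parameter q the half-plane \<open>Im z \<ge> y0\<close> lies in a compact disc of
  radius \<rho> < 1, on which \<open>G\<close> is bounded.\<close>

lemma periodic_decay:
  assumes G: "G holomorphic_on ball 0 1" "\<And>z. Im z > 0 \<Longrightarrow> F z = qexp w z * G (qexp w z)" and w: "w > 0"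
    and y0: "y0 > 0"
  obtains C where "C \<ge> 0" "\<And>z. Im z \<ge> y0 \<Longrightarrow> cmod (F z) \<le> C * exp (- (2 * pi * Im z / w))"
proof -
  define \<rho> where "\<rho> = exp (- (2 * pi * y0 / w))"
  have "\<rho> < 1" using w y0 by (simp add: \<rho>_def)
  then have "cball 0 \<rho> \<subseteq> ball (0::complex) 1" by auto
  then have "continuous_on (cball 0 \<rho>) G"
    using G(1) holomorphic_on_imp_continuous_on continuous_on_subset by blast
  then have "bounded (G ` cball 0 \<rho>)" by (intro compact_imp_bounded compact_continuous_image) auto
  then obtain C where C: "\<And>q. q \<in> cball 0 \<rho> \<Longrightarrow> cmod (G q) \<le> C" unfolding bounded_iff by blast
  have C0: "C \<ge> 0" by (rule order_trans[OF norm_ge_zero C[of 0]]) (simp add: \<rho>_def)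
  show ?thesis
  proof (rule that[OF C0])
    fix z assume z: "Im z \<ge> y0"
    have "qexp w z \<in> cball 0 \<rho>" using w z by (simp add: norm_qexp \<rho>_def divide_right_mono)
    then have "cmod (qexp w z) * cmod (G (qexp w z)) \<le> cmod (qexp w z) * C" by (intro mult_left_mono C) auto
    then show "cmod (F z) \<le> C * exp (- (2 * pi * Im z / w))"
      using G(2)[of z] z y0 by (simp add: norm_mult norm_qexp mult.commute)
  qed
qed

text \<open>With dz = c dq / q the factor q of the expansion cancels: F dz = c G(q) dq. A primitive
  of \<open>G\<close> on the disc, normalized at q = 0, yields the one that vanishes at
  infinity.\<close>

lemma periodic_primitive:
  assumes G: "G holomorphic_on ball 0 1" "\<And>z. Im z > 0 \<Longrightarrow> F z = qexp w z * G (qexp w z)" and w: "w > 0"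
  obtains Q where "\<And>z. Im z > 0 \<Longrightarrow> (Q has_field_derivative F z) (at z)" "(Q \<longlongrightarrow> 0) (filtercomap Im at_top)"
proof -
  obtain R where R: "\<And>q. q \<in> ball 0 1 \<Longrightarrow> (R has_field_derivative G q) (at q within ball 0 1)"
    using holomorphic_convex_primitive'[OF convex_ball open_ball G(1)] by blast
  have R': "(R has_field_derivative G q) (at q)" if "q \<in> ball 0 1" for q
    using R[OF that] that by (simp add: at_within_open[OF _ open_ball])
  define c :: complex where "c = of_real w / (2 * of_real pi * \<i>)"
  define Q where "Q z = c * (R (qexp w z) - R 0)" for z
  show ?thesis
  proof (rule that[of Q])
    fix z assume z: "Im z > 0"
    have "((\<lambda>z. R (qexp w z)) has_field_derivative G (qexp w z) * ((2 * of_real pi * \<i> / of_real w) * qexp w z)) (at z)"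
      by (rule DERIV_chain2[OF R'[OF qexp_in_ball[OF w z]] has_field_derivative_qexp])
    then have "(Q has_field_derivative c * (G (qexp w z) * ((2 * of_real pi * \<i> / of_real w) * qexp w z) - 0)) (at z)"
      unfolding Q_def by (intro DERIV_cmult DERIV_diff DERIV_const)
    moreover have "c * (2 * of_real pi * \<i> / of_real w) = 1" using w by (simp add: c_def)
    then have "c * (G (qexp w z) * ((2 * of_real pi * \<i> / of_real w) * qexp w z) - 0) = F z"
      unfolding G(2)[OF z] by (metis (no_types, lifting) diff_zero mult.assoc mult.commute mult.right_neutral)
    ultimately show "(Q has_field_derivative F z) (at z)" by simp
  next
    have "isCont R 0" using R'[of 0] by (intro DERIV_isCont) simp
    then have "((\<lambda>z. R (qexp w z)) \<longlongrightarrow> R 0) (filtercomap Im at_top)"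
      by (rule isCont_tendsto_compose) (rule filterlim_qexp[OF w])
    then show "(Q \<longlongrightarrow> 0) (filtercomap Im at_top)"
      unfolding Q_def by (auto intro!: tendsto_eq_intros)
  qed
qed

section \<open>Cusp forms and the bound on their height\<close>

text \<open>The composition law at infinity suffices: every boundary point is the image of infinity
  under some \<sigma>, and the law there follows by multiplying with \<sigma>, which saves case
  distinctions.\<close>

lemma mobius_P1_mult_None:
  assumes "det B = 1"
  shows "mobius_P1 (A ** B) None = mobius_P1 A (mobius_P1 B None)"
proof (cases "B$2$1 = 0")
  case True
  then have "B$1$1 \<noteq> 0" using assms by (auto simp: det_2)
  then show ?thesis using True by simp
next
  case False
  then have "A$2$1 * (B$1$1 / B$2$1) + A$2$2 = (A$2$1 * B$1$1 + A$2$2 * B$2$1) / B$2$1"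
    "A$1$1 * (B$1$1 / B$2$1) + A$1$2 = (A$1$1 * B$1$1 + A$1$2 * B$2$1) / B$2$1"
    by (simp_all add: field_simps)
  then show ?thesis using False by simp
qed

lemma mobius_P1_transitive:
  obtains \<sigma> where "det \<sigma> = 1" "mobius_P1 \<sigma> None = r"
proof (cases r)
  case None
  then show ?thesis by (intro that[of "mat 1"]) auto
next
  case (Some x)
  then show ?thesis by (intro that[of "mat2 x (-1) 1 0"]) (auto simp: det_2)
qed

declare mobius_P1.simps [simp del]

lemma parabolic_conj:
  assumes "parabolic A" "det B = 1"
  shows "parabolic (B ** A ** adj2 B)"
proof -
  have eq: "adj2 B ** (B ** A ** adj2 B) ** B = A"
  proof -
    have "adj2 B ** (B ** A ** adj2 B) ** B = (adj2 B ** B) ** A ** (adj2 B ** B)"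
      by (simp add: matrix_mul_assoc)
    then show ?thesis by (simp add: adj2_inverse[OF assms(2)])
  qed
  have "B ** A ** adj2 B \<noteq> mat 1"
  proof
    assume "B ** A ** adj2 B = mat 1"
    then have "A = mat 1" using eq by (simp add: adj2_inverse[OF assms(2)])
    with assms show False by (simp add: parabolic_def)
  qed
  moreover have "B ** A ** adj2 B \<noteq> - mat 1"
  proof
    assume neg: "B ** A ** adj2 B = - mat 1"
    have "adj2 B ** (- mat 1) ** B = - (adj2 B ** B)" by (simp add: mat2_eq_iff)
    then have "A = - mat 1" using eq unfolding neg by (simp add: adj2_inverse[OF assms(2)])
    with assms show False by (simp add: parabolic_def)
  qed
  ultimately show ?thesis using assms by (simp add: parabolic_def det_mul trace_conj)
qed

lemma cusps_mobius:
  assumes L: "matgroup \<Gamma>" and A: "A \<in> \<Gamma>" and r: "r \<in> cusps \<Gamma>"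
  shows "mobius_P1 A r \<in> cusps \<Gamma>"
proof -
  obtain \<sigma> where s: "det \<sigma> = 1" "mobius_P1 \<sigma> None = r" by (rule mobius_P1_transitive)
  obtain B where B: "B \<in> \<Gamma>" "parabolic B" "mobius_P1 B r = r" using r by (auto simp: cusps_def)
  have dA: "det A = 1" "det B = 1" using matgroupD(2)[OF L] A B by auto
  let ?C = "A ** B ** adj2 A"
  have "?C ** (A ** \<sigma>) = A ** B ** (adj2 A ** A) ** \<sigma>" by (simp add: matrix_mul_assoc)
  also have "\<dots> = A ** (B ** \<sigma>)" using dA by (simp add: adj2_inverse matrix_mul_assoc)
  finally have eq: "?C ** (A ** \<sigma>) = A ** (B ** \<sigma>)" .
  have "mobius_P1 ?C (mobius_P1 A r) = mobius_P1 (?C ** (A ** \<sigma>)) None"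
    using s dA by (simp add: det_mul mobius_P1_mult_None del: matrix_mul_assoc)
  also have "\<dots> = mobius_P1 A (mobius_P1 B r)"
    using s dA unfolding eq by (simp add: det_mul mobius_P1_mult_None)
  finally have "mobius_P1 ?C (mobius_P1 A r) = mobius_P1 A r" using B by simp
  moreover have "parabolic ?C" by (rule parabolic_conj[OF B(2) dA(1)])
  moreover have "?C \<in> \<Gamma>" by (intro matgroupD(3,4)[OF L] A B)
  ultimately show ?thesis unfolding cusps_def by blast
qed

lemma slash_mult:
  assumes "det A = 1" "det B = 1" "Im z > 0"
  shows "slash 2 f (A ** B) z = jfac B z powi (- 2) * slash 2 f A (mobius B z)"
  using assms by (simp add: slash_def mobius_mult_jfac power_int_mult_distrib mult_ac)

lemma slash_mat1 [simp]: "slash k f (mat 1) = f"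
  by (simp add: slash_def fun_eq_iff jfac_def)

lemma holomorphic_slash:
  assumes "f holomorphic_on {z. Im z > 0}" "det \<sigma> = 1"
  shows "slash 2 f \<sigma> holomorphic_on {z. Im z > 0}"
proof -
  have m: "mobius \<sigma> holomorphic_on {z. Im z > 0}"
    unfolding holomorphic_on_def field_differentiable_def
    using mobius_has_field_derivative[OF assms(2)] by blast
  have "(f \<circ> mobius \<sigma>) holomorphic_on {z. Im z > 0}"
    by (intro holomorphic_on_compose m holomorphic_on_subset[OF assms(1)])
       (auto intro: mobius_upper[OF assms(2)])
  moreover have "(\<lambda>z. jfac \<sigma> z powi (- 2)) holomorphic_on {z. Im z > 0}"
    using mobius_denom_nonzero[OF assms(2)] unfolding jfac_def
    by (intro holomorphic_intros) auto
  ultimately show ?thesis unfolding slash_def[abs_def] o_def by (intro holomorphic_on_mult)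
qed

lemma primitive_slash:
  assumes P: "\<And>z. Im z > 0 \<Longrightarrow> (P has_field_derivative f z) (at z)" and A: "det A = 1" and z: "Im z > 0"
  shows "((\<lambda>z. P (mobius A z)) has_field_derivative slash 2 f A z) (at z)"
proof -
  have "((\<lambda>z. P (mobius A z)) has_field_derivative f (mobius A z) * (1 / (jfac A z)\<^sup>2)) (at z)"
    by (rule DERIV_chain2[OF P[OF mobius_upper[OF A z]] mobius_has_field_derivative[OF A z]])
  then show ?thesis by (simp add: slash_def power_int_minus field_simps)
qed

section \<open>Expansions and limits of a cusp form at its cusps\<close>

locale cusp_form =
  fixes \<Gamma> :: "(real^2^2) set" and f :: "complex \<Rightarrow> complex"
  assumes group: "matgroup \<Gamma>" and cusp_form: "f \<in> cusp_forms 2 \<Gamma>"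
begin

lemma det_eq_1: "A \<in> \<Gamma> \<Longrightarrow> det A = 1"
  using matgroupD(2)[OF group] .

lemma holomorphic: "f holomorphic_on {z. Im z > 0}"
  using cusp_form by (simp add: cusp_forms_def upper_half_plane_def)

lemma slash_invariant: "A \<in> \<Gamma> \<Longrightarrow> Im z > 0 \<Longrightarrow> slash 2 f A z = f z"
  using cusp_form by (simp add: cusp_forms_def upper_half_plane_def)

lemma height_invariant:
  assumes "A \<in> \<Gamma>" "Im z > 0"
  shows "Im (mobius A z) * cmod (f (mobius A z)) = Im z * cmod (f z)"
  using height_slash[OF det_eq_1[OF assms(1)] assms(2), of f] slash_invariant[OF assms] by simp

lemma slash_tendsto:
  "det \<sigma> = 1 \<Longrightarrow> mobius_P1 \<sigma> None \<in> cusps \<Gamma> \<Longrightarrow> (slash 2 f \<sigma> \<longlongrightarrow> 0) (filtercomap Im at_top)"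
  using cusp_form by (simp add: cusp_forms_def)

text \<open>Conjugation by \<sigma> turns a parabolic element fixing the cusp into an upper
  triangular \<open>T\<close> with both diagonal entries 1 or both -1. It acts as a translation, and
  its sign disappears in even weight. The period found need not be the smallest one.\<close>

lemma slash_periodic:
  assumes s: "det \<sigma> = 1" and c: "mobius_P1 \<sigma> None \<in> cusps \<Gamma>"
  obtains w where "w > 0" "\<And>z. Im z > 0 \<Longrightarrow> slash 2 f \<sigma> (z + of_real w) = slash 2 f \<sigma> z"
proof -
  obtain A where A: "A \<in> \<Gamma>" "parabolic A" "mobius_P1 A (mobius_P1 \<sigma> None) = mobius_P1 \<sigma> None"
    using c by (auto simp: cusps_def)
  have dA: "det A = 1" using det_eq_1 A by simp
  define T where "T = adj2 \<sigma> ** A ** \<sigma>"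
  have "parabolic T" using parabolic_conj[OF A(2), of "adj2 \<sigma>"] s by (simp add: T_def)
  then have T: "det T = 1" "\<bar>trace T\<bar> = 2" "T \<noteq> mat 1" "T \<noteq> - mat 1" by (auto simp: parabolic_def)
  have "mobius_P1 T None = mobius_P1 (adj2 \<sigma>) (mobius_P1 (A ** \<sigma>) None)"
    unfolding T_def matrix_mul_assoc[symmetric] using s dA by (intro mobius_P1_mult_None) (simp add: det_mul)
  also have "\<dots> = mobius_P1 (adj2 \<sigma> ** \<sigma>) None"
    using s A(3) by (simp add: mobius_P1_mult_None)
  also have "\<dots> = None" by (simp add: adj2_inverse[OF s] mobius_P1.simps)
  finally have T21: "T$2$1 = 0" by (auto simp: mobius_P1.simps split: if_splits)
  have t: "T$1$1 * T$2$2 = 1" using T(1) T21 by (simp add: det_2)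
  have tr: "(T$1$1 + T$2$2)\<^sup>2 = 4" using T(2) by (metis power2_abs trace2 power2_eq_square numeral_Bit0 mult_2 mult.commute)
  have "(T$1$1 - T$2$2)\<^sup>2 = 0" using tr t by (simp add: power2_eq_square algebra_simps)
  then have eq: "T$2$2 = T$1$1" by simp
  then have s1: "T$1$1 = 1 \<or> T$1$1 = -1" using t by (simp add: square_eq_1_iff)
  \<comment> \<open>The diagonal entry is its own inverse, so this is \<open>T$1$2 / T$2$2\<close>,
    the signed length of the translation.\<close>
  define b where "b = T$1$1 * T$1$2"
  have b0: "b \<noteq> 0"
  proof
    assume "b = 0"
    then have "T$1$2 = 0" using s1 by (auto simp: b_def)
    then have "T = mat 1 \<or> T = - mat 1" using s1 eq T21 by (auto simp: mat2_eq_iff)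
    with T show False by simp
  qed
  have comm: "\<sigma> ** T = A ** \<sigma>" unfolding T_def by (simp add: matrix_mul_assoc adj2_inverse[OF s])
  have Tz: "mobius T z = z + of_real b" "jfac T z powi (- 2) = 1" for z
    using s1 eq T21 by (auto simp: mobius_def jfac_def b_def field_simps)
  have per: "slash 2 f \<sigma> (z + of_real b) = slash 2 f \<sigma> z" if z: "Im z > 0" for z
  proof -
    have "slash 2 f \<sigma> (z + of_real b) = slash 2 f (\<sigma> ** T) z"
      using slash_mult[OF s T(1) z, of f] by (simp add: Tz)
    also have "\<dots> = jfac \<sigma> z powi (- 2) * f (mobius \<sigma> z)"
      unfolding comm using slash_mult[OF dA s z, of f] slash_invariant[OF A(1) mobius_upper[OF s z]] by simp
    finally show ?thesis by (simp add: slash_def)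
  qed
  show ?thesis
  proof (rule that[of "\<bar>b\<bar>"])
    fix z :: complex assume z: "Im z > 0"
    show "slash 2 f \<sigma> (z + of_real \<bar>b\<bar>) = slash 2 f \<sigma> z"
    proof (cases "b > 0")
      case True then show ?thesis using per[OF z] by simp
    next
      case False
      then show ?thesis using per[of "z - of_real b"] z by simp
    qed
  qed (use b0 in simp)
qed

lemma cusp_expansion:
  assumes s: "det \<sigma> = 1" and c: "mobius_P1 \<sigma> None \<in> cusps \<Gamma>"
  obtains w G where "w > 0" "G holomorphic_on ball 0 1"
    "\<And>z. Im z > 0 \<Longrightarrow> slash 2 f \<sigma> z = qexp w z * G (qexp w z)"
proof -
  obtain w where w: "w > 0" "\<And>z. Im z > 0 \<Longrightarrow> slash 2 f \<sigma> (z + of_real w) = slash 2 f \<sigma> z"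
    using slash_periodic[OF s c] by blast
  obtain G where "G holomorphic_on ball 0 1" "\<And>z. Im z > 0 \<Longrightarrow> slash 2 f \<sigma> z = qexp w z * G (qexp w z)"
    using periodic_expansion[OF holomorphic_slash[OF holomorphic s] w slash_tendsto[OF s c]] by blast
  then show ?thesis using that w(1) by blast
qed

lemma slash_decay:
  assumes s: "det \<sigma> = 1" and c: "mobius_P1 \<sigma> None \<in> cusps \<Gamma>" and y0: "y0 > 0"
  obtains w C where "w > 0" "C \<ge> 0" "\<And>z. Im z \<ge> y0 \<Longrightarrow> cmod (slash 2 f \<sigma> z) \<le> C * exp (- (2 * pi * Im z / w))"
proof -
  obtain w G where wG: "w > 0" "G holomorphic_on ball 0 1"
    "\<And>z. Im z > 0 \<Longrightarrow> slash 2 f \<sigma> z = qexp w z * G (qexp w z)"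
    using cusp_expansion[OF s c] by blast
  then obtain C where "C \<ge> 0" "\<And>z. Im z \<ge> y0 \<Longrightarrow> cmod (slash 2 f \<sigma> z) \<le> C * exp (- (2 * pi * Im z / w))"
    using periodic_decay[OF wG(2,3,1) y0] by blast
  then show ?thesis using that wG(1) by blast
qed

lemma small_in_cusp_neighbourhood:
  assumes s: "det \<sigma> = 1" and c: "mobius_P1 \<sigma> None \<in> cusps \<Gamma>"
  shows "\<exists>Y. \<forall>z. Im z > 0 \<longrightarrow> Im z > Y \<longrightarrow> Im z * cmod (slash 2 f \<sigma> z) \<le> 1"
proof -
  obtain w C where wC: "w > 0" "C \<ge> 0" "\<And>z. Im z \<ge> 1 \<Longrightarrow> cmod (slash 2 f \<sigma> z) \<le> C * exp (- (2 * pi * Im z / w))"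
    using slash_decay[OF s c zero_less_one] by blast
  have lin: "LIM y at_top. (2 * pi / w) * y :> at_top"
    using wC(1) by (intro filterlim_tendsto_pos_mult_at_top[OF tendsto_const]) (auto intro: filterlim_ident)
  \<comment> \<open>Written in x = 2 pi y / w, so that the limit 0 of x / exp x applies.\<close>
  have "((\<lambda>y. C * w / (2 * pi) * (((2 * pi / w) * y) ^ 1 / exp ((2 * pi / w) * y))) \<longlongrightarrow> C * w / (2 * pi) * 0) at_top"
    by (intro tendsto_mult tendsto_const filterlim_compose[OF tendsto_power_div_exp_0 lin])
  then have "eventually (\<lambda>y. C * w / (2 * pi) * (((2 * pi / w) * y) ^ 1 / exp ((2 * pi / w) * y)) < 1) at_top"
    by (rule order_tendstoD) simp
  then obtain Y where Y: "\<And>y. y \<ge> Y \<Longrightarrow> C * w / (2 * pi) * (((2 * pi / w) * y) ^ 1 / exp ((2 * pi / w) * y)) < 1"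
    by (auto simp: eventually_at_top_linorder)
  show ?thesis
  proof (intro exI[of _ "max 1 Y"] allI impI)
    fix z assume z: "Im z > 0" "max 1 Y < Im z"
    have "Im z * cmod (slash 2 f \<sigma> z) \<le> Im z * (C * exp (- (2 * pi * Im z / w)))"
      using z by (intro mult_left_mono wC(3)) auto
    also have "\<dots> = C * w / (2 * pi) * (((2 * pi / w) * Im z) ^ 1 / exp ((2 * pi / w) * Im z))"
      using wC(1) by (simp add: exp_minus field_simps)
    also have "\<dots> < 1" using z by (intro Y) simp
    finally show "Im z * cmod (slash 2 f \<sigma> z) \<le> 1" by simp
  qed
qed

text \<open>\<open>Q\<close> is the primitive read off from the expansion at the cusp. It differs
  from the pulled back \<open>P\<close> by a constant, and that constant is the limit.\<close>

lemma cusp_limit: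
  assumes P: "\<And>z. Im z > 0 \<Longrightarrow> (P has_field_derivative f z) (at z)"
    and s: "det \<sigma> = 1" and c: "mobius_P1 \<sigma> None \<in> cusps \<Gamma>"
  obtains V where "((\<lambda>z. P (mobius \<sigma> z)) \<longlongrightarrow> V) (filtercomap Im at_top)"
proof -
  obtain w G where wG: "w > 0" "G holomorphic_on ball 0 1"
    "\<And>z. Im z > 0 \<Longrightarrow> slash 2 f \<sigma> z = qexp w z * G (qexp w z)"
    using cusp_expansion[OF s c] by blast
  obtain Q where Q: "\<And>z. Im z > 0 \<Longrightarrow> (Q has_field_derivative slash 2 f \<sigma> z) (at z)"
    "(Q \<longlongrightarrow> 0) (filtercomap Im at_top)"
    using periodic_primitive[OF wG(2,3,1)] by blast
  let ?H = "{z. Im z > 0}"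
  have "((\<lambda>z. P (mobius \<sigma> z) - Q z) has_field_derivative 0) (at z within ?H)" if "z \<in> ?H" for z
  proof -
    have z: "Im z > 0" using that by simp
    have "((\<lambda>z. P (mobius \<sigma> z) - Q z) has_field_derivative slash 2 f \<sigma> z - slash 2 f \<sigma> z) (at z)"
      by (intro DERIV_diff Q(1)[OF z] primitive_slash[OF P] s z)
    then show ?thesis by (simp add: has_field_derivative_at_within)
  qed
  then obtain k where k: "\<And>z. z \<in> ?H \<Longrightarrow> P (mobius \<sigma> z) - Q z = k"
    using has_field_derivative_zero_constant[OF convex_halfspace_Im_gt, of 0 "\<lambda>z. P (mobius \<sigma> z) - Q z"] by blast
  have "((\<lambda>z. k + Q z) \<longlongrightarrow> k + 0) (filtercomap Im at_top)" by (intro tendsto_add tendsto_const Q(2))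
  moreover have "eventually (\<lambda>z. k + Q z = P (mobius \<sigma> z)) (filtercomap Im at_top)"
    using eventually_Im_pos by eventually_elim (use k in \<open>auto simp: algebra_simps\<close>)
  ultimately have "((\<lambda>z. P (mobius \<sigma> z)) \<longlongrightarrow> k) (filtercomap Im at_top)"
    by (auto elim: Lim_transform_eventually)
  then show ?thesis by (rule that)
qed

end

section \<open>Bounded height\<close>

lemma hdist_le_12_imp:
  assumes "Im p > 0" "Im w > 0" "hdist p w \<le> 12"
  shows "w \<in> cbox (Complex (Re p - 13 * Im p) (Im p / 14)) (Complex (Re p + 13 * Im p) (14 * Im p))"
proof -
  have c: "(cmod (p - w))\<^sup>2 \<le> 12 * (Im p * Im w)" using assms by (simp add: hdist_def divide_le_eq mult.commute)
  have "(Im p - Im w)\<^sup>2 \<le> 12 * (Im p * Im w)" "(Re p - Re w)\<^sup>2 \<le> 12 * (Im p * Im w)"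
    using c by (simp_all add: cmod_power2) (smt (verit) zero_le_power2)+
  then have 1: "(Im p - Im w)\<^sup>2 \<le> 12 * (Im p * Im w)" and 2: "(Re p - Re w)\<^sup>2 \<le> 12 * (Im p * Im w)" by auto
  \<comment> \<open>(a - b)^2 \<le> 12 a b leaves b^2 \<le> 14 a b. The width of the box then
    follows from 12 * 14 = 168 \<le> 13^2.\<close>
  have bd: "b \<le> 14 * a" if "a > 0" "b > 0" "(a - b)\<^sup>2 \<le> 12 * (a * b)" for a b :: real
  proof -
    have "(a - b)\<^sup>2 = a * a + b * b - 2 * (a * b)" by (simp add: power2_eq_square algebra_simps)
    moreover have "0 \<le> a * a" by simp
    ultimately have "b * b \<le> 14 * (a * b)" using that(3) by linarith
    then have "b * b \<le> (14 * a) * b" by simp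
    then show ?thesis using that(2) by (rule mult_right_le_imp_le)
  qed
  have I: "Im w \<le> 14 * Im p" "Im p \<le> 14 * Im w"
    using bd[OF assms(1,2) 1] bd[OF assms(2,1)] 1 by (simp_all add: power2_commute mult.commute)
  have "(Re p - Re w)\<^sup>2 \<le> 12 * (Im p * (14 * Im p))"
    by (rule order_trans[OF 2]) (use I assms in \<open>intro mult_left_mono; simp\<close>)
  also have "\<dots> \<le> (13 * Im p)\<^sup>2" using assms by (simp add: power2_eq_square)
  finally have "\<bar>Re p - Re w\<bar>\<^sup>2 \<le> (13 * Im p)\<^sup>2" by simp
  then have "\<bar>Re p - Re w\<bar> \<le> 13 * Im p" by (rule power2_le_imp_le) (use assms in simp)
  then show ?thesis using I by (auto simp: in_cbox_complex_iff)
qed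

text \<open>Two levels of thickness occur. The fixed \<epsilon> yields, at the exit points, finitely
  many small elements up to conjugation; each has its own threshold, and \<delta> is at most the
  least of them. Orbits of \<delta>-thick points meet a compact set; at all other points one of
  these thresholds applies.\<close>

lemma (in cusp_form) height_bounded:
  assumes iso: "isolated1 \<eta> \<Gamma>" and cof: "cofinite_subgroup \<Gamma>"
  obtains C where "C > 0" "\<And>z. Im z > 0 \<Longrightarrow> Im z * cmod (f z) \<le> C"
proof -
  define \<phi> where "\<phi> z = Im z * cmod (f z)" for z
  have inv: "\<phi> (mobius A z) = \<phi> z" if "A \<in> \<Gamma>" "Im z > 0" for A z
    using height_invariant[OF that] by (simp add: \<phi>_def)
  have cont: "continuous_on {z. Im z > 0} \<phi>"
    unfolding \<phi>_def by (intro continuous_intros holomorphic_on_imp_continuous_on holomorphic)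
  have cnt: "countable \<Gamma>" by (rule countable_matgroup[OF group iso])
  define R where "R p = cbox (Complex (Re p - 13 * Im p) (Im p / 14)) (Complex (Re p + 13 * Im p) (14 * Im p))" for p
  have bounded: "\<exists>C. \<forall>p\<in>P. \<forall>z\<in>R p. \<phi> z \<le> C" if P: "finite P" "P \<subseteq> {z. Im z > 0}" for P
  proof -
    have "R p \<subseteq> {z. Im z > 0}" if "p \<in> P" for p
      using P that by (force simp: R_def in_cbox_complex_iff)
    then have "continuous_on (R p) \<phi>" if "p \<in> P" for p using cont that continuous_on_subset by blast
    then have "compact (\<Union>p\<in>P. \<phi> ` R p)" using P(1) by (intro compact_UN compact_continuous_image) (auto simp: R_def)
    then have "bdd_above (\<Union>p\<in>P. \<phi> ` R p)" by (intro bounded_imp_bdd_above compact_imp_bounded)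
    then obtain C where "\<And>x. x \<in> (\<Union>p\<in>P. \<phi> ` R p) \<Longrightarrow> x \<le> C" by (auto simp: bdd_above_def)
    then show ?thesis by blast
  qed
  \<comment> \<open>A value below 1/16, as \<open>exit_thin_part\<close> requires.\<close>
  define \<epsilon> :: real where "\<epsilon> = 1/17"
  have eps: "0 < \<epsilon>" "\<epsilon> < 1/16" by (simp_all add: \<epsilon>_def)
  obtain P where P: "finite P" "P \<subseteq> {z. Im z > 0}" "\<And>z. z \<in> thick \<epsilon> \<Gamma> \<Longrightarrow> \<exists>A\<in>\<Gamma>. \<exists>p\<in>P. hdist p (mobius A z) \<le> 12"
    using thick_covered[OF group cnt cof eps(1)] by blast
  \<comment> \<open>Candidates for the exit element once the exit point is moved into a compact box.
    \<open>- mat 1\<close> is left out: it commutes with everything, so its centralizer says nothing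
    about \<open>z\<close>.\<close>
  define S where "S = {B\<in>\<Gamma>. B \<noteq> mat 1 \<and> B \<noteq> - mat 1 \<and> (\<exists>p\<in>P. \<exists>z\<in>R p. norm (cj z B - mat 1) \<le> 2 * \<epsilon>)}"
  have "finite S"
  proof -
    have "\<exists>K. \<forall>B z. z \<in> R p \<longrightarrow> norm (cj z B - mat 1) \<le> 2 * \<epsilon> \<longrightarrow> norm B \<le> K" if p: "p \<in> P" for p
    proof -
      have pH: "Im p > 0" using P p by auto
      define \<rho> where "\<rho> = max 1 (max (14 / Im p) (max (14 * Im p) (\<bar>Re p\<bar> + 13 * Im p)))"
      have r: "1 \<le> \<rho>" "14 / Im p \<le> \<rho>" "14 * Im p \<le> \<rho>" "\<bar>Re p\<bar> + 13 * Im p \<le> \<rho>" unfolding \<rho>_def by auto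
      show ?thesis
      proof (rule exI, intro allI impI)
        fix B z assume z: "z \<in> R p" and B: "norm (cj z B - mat 1) \<le> 2 * \<epsilon>"
        have zz: "\<bar>Re z - Re p\<bar> \<le> 13 * Im p" "Im p / 14 \<le> Im z" "Im z \<le> 14 * Im p"
          using z unfolding R_def in_cbox_complex_iff by (auto simp: abs_le_iff)
        have "\<bar>Re z\<bar> \<le> \<rho>" using zz r by linarith
        moreover have "1 / \<rho> \<le> Im z"
        proof -
          have "1 / \<rho> \<le> 1 / (14 / Im p)" using r pH by (intro divide_left_mono) auto
          then show ?thesis using zz by simp
        qed
        moreover have "Im z \<le> \<rho>" using zz r by linarith
        moreover have "norm (cj z B) \<le> 4"
        proof -
          have "norm (cj z B) \<le> norm (cj z B - mat 1) + norm (mat 1 :: real^2^2)"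
            using norm_triangle_ineq[of "cj z B - mat 1" "mat 1"] by simp
          also have "\<dots> \<le> 2 * \<epsilon> + 2"
            using B norm_mat2_le_sum[of "mat 1"] by simp
          finally show ?thesis by (simp add: \<epsilon>_def)
        qed
        ultimately show "norm B \<le> 4 * \<rho> + 2 * (4 + 4 * \<rho> * \<rho>) + (\<rho> * 4 + 2 * (4 + 4 * \<rho> * \<rho>) * \<rho> + 4 * \<rho> * \<rho> * \<rho>)"
          using r(1) by (intro norm_le_of_norm_cj)
      qed
    qed
    then obtain K where K: "\<And>p B z. p \<in> P \<Longrightarrow> z \<in> R p \<Longrightarrow> norm (cj z B - mat 1) \<le> 2 * \<epsilon> \<Longrightarrow> norm B \<le> K p"
      by metis
    have "S \<subseteq> (\<Union>p\<in>P. {B\<in>\<Gamma>. norm B \<le> K p})" using K by (auto simp: S_def)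
    moreover have "finite (\<Union>p\<in>P. {B\<in>\<Gamma>. norm B \<le> K p})"
      using P(1) finite_bounded_matgroup[OF group iso] by blast
    ultimately show ?thesis by (rule finite_subset)
  qed
  have "\<exists>e>0. \<forall>z A. Im z > 0 \<longrightarrow> A \<in> \<Gamma> \<longrightarrow> A \<noteq> mat 1 \<longrightarrow> A ** B = B ** A \<longrightarrow>
      norm (cj z A - mat 1) < e \<longrightarrow> \<phi> z \<le> 1" if "B \<in> S" for B
  proof -
    have "B \<in> \<Gamma>" "B \<noteq> mat 1" "B \<noteq> - mat 1" using that by (auto simp: S_def)
    from bounded_in_thin_part[OF group iso small_in_cusp_neighbourhood this]
    obtain e where "e > 0" "\<And>z A. Im z > 0 \<Longrightarrow> A \<in> \<Gamma> \<Longrightarrow> A \<noteq> mat 1 \<Longrightarrow> A ** B = B ** A \<Longrightarrow>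
      norm (cj z A - mat 1) < e \<Longrightarrow> Im z * cmod (f z) \<le> 1" by blast
    then show ?thesis unfolding \<phi>_def by blast
  qed
  then obtain e where e: "\<And>B. B \<in> S \<Longrightarrow> e B > 0" "\<And>B z A. B \<in> S \<Longrightarrow> Im z > 0 \<Longrightarrow> A \<in> \<Gamma> \<Longrightarrow> A \<noteq> mat 1 \<Longrightarrow>
      A ** B = B ** A \<Longrightarrow> norm (cj z A - mat 1) < e B \<Longrightarrow> \<phi> z \<le> 1" by metis
  define \<delta> where "\<delta> = Min (insert \<epsilon> (e ` S))"
  have delta: "\<delta> > 0" "\<delta> \<le> \<epsilon>" "\<And>B. B \<in> S \<Longrightarrow> \<delta> \<le> e B"
    unfolding \<delta>_def using \<open>finite S\<close> eps e(1) by (auto intro: Min_le)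
  obtain P' where P': "finite P'" "P' \<subseteq> {z. Im z > 0}" "\<And>z. z \<in> thick \<delta> \<Gamma> \<Longrightarrow> \<exists>A\<in>\<Gamma>. \<exists>p\<in>P'. hdist p (mobius A z) \<le> 12"
    using thick_covered[OF group cnt cof delta(1)] by blast
  obtain C where C: "\<And>p z. p \<in> P' \<Longrightarrow> z \<in> R p \<Longrightarrow> \<phi> z \<le> C" using bounded[OF P'(1,2)] by blast
  show ?thesis
  proof (rule that[of "max 1 C"])
    fix z :: complex assume z: "Im z > 0"
    have "\<phi> z \<le> max 1 C"
    proof (cases "z \<in> thick \<delta> \<Gamma>")
      case True
      then obtain A p where A: "A \<in> \<Gamma>" "p \<in> P'" "hdist p (mobius A z) \<le> 12" using P'(3) by blast
      have "mobius A z \<in> R p"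
        unfolding R_def using A P'(2) z by (intro hdist_le_12_imp mobius_upper[OF det_eq_1]) auto
      then have "\<phi> (mobius A z) \<le> C" using C A by blast
      then show ?thesis using inv[OF A(1) z] by simp
    next
      case False
      then obtain A where A: "A \<in> \<Gamma>" "A \<noteq> mat 1" "norm (cj z A - mat 1) < \<delta>"
        using z by (auto simp: thick_def not_le)
      then have A\<epsilon>: "norm (cj z A - mat 1) < \<epsilon>" using delta by simp
      obtain w B where B: "w \<in> thick \<epsilon> \<Gamma>" "B \<in> \<Gamma>" "B \<noteq> mat 1" "A ** B = B ** A"
        "norm (cj w B - mat 1) \<le> 2 * \<epsilon>"
        using exit_thin_part[OF group iso eps A(1,2) z A\<epsilon>] by blast
      have wH: "Im w > 0" using B by (simp add: thick_def)
      obtain K p where K: "K \<in> \<Gamma>" "p \<in> P" "hdist p (mobius K w) \<le> 12" using P(3)[OF B(1)] by blast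
      have dK: "det K = 1" by (rule det_eq_1[OF K(1)])
      have Kw: "mobius K w \<in> R p"
        unfolding R_def using K P(2) wH by (intro hdist_le_12_imp mobius_upper[OF dK]) auto
      \<comment> \<open>\<open>K\<close> moves the exit point into a compact box. Conjugating
        \<open>A\<close> and \<open>B\<close> by it keeps their commutation and their distances to
        the identity, seen from the moved points.\<close>
      define B' where "B' = K ** B ** adj2 K"
      define A' where "A' = K ** A ** adj2 K"
      have mem: "A' \<in> \<Gamma>" "B' \<in> \<Gamma>" unfolding A'_def B'_def by (intro matgroupD(3,4)[OF group] A B K)+
      have undo: "adj2 K ** (K ** X ** adj2 K) ** K = X" for X
      proof -
        have "adj2 K ** (K ** X ** adj2 K) ** K = (adj2 K ** K) ** X ** (adj2 K ** K)"
          by (simp add: matrix_mul_assoc)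
        then show ?thesis by (simp add: adj2_inverse[OF dK])
      qed
      have sB: "norm (cj (mobius K w) B' - mat 1) \<le> 2 * \<epsilon>"
        unfolding B'_def using norm_cj_conj[OF det_eq_1[OF B(2)] dK wH] B(5) by simp
      have sA: "norm (cj (mobius K z) A' - mat 1) < \<delta>"
        unfolding A'_def using norm_cj_conj[OF det_eq_1[OF A(1)] dK z] A(3) by simp
      have ne: "A' \<noteq> mat 1" "B' \<noteq> mat 1"
        using undo[of A] undo[of B] A B by (auto simp: A'_def B'_def adj2_inverse[OF dK])
      \<comment> \<open>The negative identity has distance at least 2 from the identity, far more
        than 2 * \<epsilon>.\<close>
      have "B' \<noteq> - mat 1"
      proof
        assume "B' = - mat 1"
        then have "cj (mobius K w) B' - mat 1 = mat (-2)" by (simp add: mat2_eq_iff cj_def)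
        then have "norm (mat (-2) :: real^2^2) \<le> 2 * \<epsilon>" using sB by simp
        moreover have "2 \<le> norm (mat (-2) :: real^2^2)" using norm_entry_le[of "mat (-2)" 1 1] by simp
        ultimately show False by (simp add: \<epsilon>_def)
      qed
      then have BS: "B' \<in> S" unfolding S_def using mem ne K(2) Kw sB by blast
      have conj: "K ** X ** adj2 K ** (K ** Y ** adj2 K) = K ** (X ** Y) ** adj2 K" for X Y
      proof -
        have "K ** X ** adj2 K ** (K ** Y ** adj2 K) = K ** X ** (adj2 K ** K) ** Y ** adj2 K"
          by (simp add: matrix_mul_assoc)
        then show ?thesis by (simp add: adj2_inverse[OF dK] matrix_mul_assoc)
      qed
      have "A' ** B' = B' ** A'" unfolding A'_def B'_def conj B(4) ..
      moreover have "norm (cj (mobius K z) A' - mat 1) < e B'" using sA delta(3)[OF BS] by simp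
      ultimately have "\<phi> (mobius K z) \<le> 1"
        using e(2)[OF BS mobius_upper[OF dK z] mem(1) ne(1)] by blast
      then show ?thesis using inv[OF K(1) z] by simp
    qed
    then show "Im z * cmod (f z) \<le> max 1 C" by (simp add: \<phi>_def)
  qed simp
qed

section \<open>Fourier coefficients\<close>

lemma qexp_1: "qexp 1 = fourier_e"
  by (simp add: qexp_def fourier_e_def fun_eq_iff)

lemma fourier_e_mult: "fourier_e (of_nat n * z) = fourier_e z ^ n"
  by (simp add: fourier_e_def exp_of_nat_mult[symmetric] mult_ac)

lemma fourier_e_surj:
  assumes "q \<in> ball 0 1" "q \<noteq> 0"
  obtains z where "Im z > 0" "fourier_e z = q"
proof
  let ?z = "Ln q * of_real (1 / (2 * pi)) * (- \<i>)"
  have "Re (Ln q) < 0" using assms by simp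
  then show "Im ?z > 0" by (simp add: divide_neg_pos)
  have "2 * of_real pi * \<i> * ?z = Ln q" by (simp add: field_simps)
  then show "fourier_e ?z = q" using assms unfolding fourier_e_def by simp
qed

text \<open>This resolves the definite description: the Taylor coefficients of \<open>G\<close>,
  shifted by one because of the factor q, are a solution, and the difference of two solutions has a
  power series that vanishes on the unit disc.\<close>

lemma fourier_coeff_sums:
  assumes G: "G holomorphic_on ball 0 1" "\<And>z. Im z > 0 \<Longrightarrow> f z = qexp 1 z * G (qexp 1 z)"
  shows "fourier_coeff f 0 = 0"
    and "Im z > 0 \<Longrightarrow> (\<lambda>n. fourier_coeff f n * fourier_e z ^ n) sums f z"
proof -
  define g where "g n = (deriv ^^ n) G 0 / fact n" for n
  define a where "a n = (if n = 0 then 0 else g (n - 1))" for n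
  have sumsG: "(\<lambda>n. g n * q ^ n) sums G q" if "q \<in> ball 0 1" for q
    using holomorphic_power_series[OF G(1) that] by (simp add: g_def)
  have a: "(\<lambda>n. a (Suc n) * fourier_e (of_nat (Suc n) * z)) sums f z" if "Im z > 0" for z
  proof -
    have "(\<lambda>n. fourier_e z * (g n * fourier_e z ^ n)) sums (fourier_e z * G (fourier_e z))"
      using qexp_in_ball[of 1 z] that by (intro sums_mult sumsG) (simp add: qexp_1)
    then show ?thesis using G(2)[OF that] unfolding fourier_e_mult by (simp add: a_def qexp_1 mult_ac)
  qed
  have uniq: "b = a" if b: "b 0 = 0" "\<forall>z\<in>upper_half_plane. (\<lambda>n. b (Suc n) * fourier_e (of_nat (Suc n) * z)) sums f z" for b
  proof (rule ccontr)
    assume "b \<noteq> a"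
    then obtain m where m: "b m - a m \<noteq> 0" by (auto simp: fun_eq_iff)
    have "m > 0" using m b(1) by (cases m) (auto simp: a_def)
    have "(\<lambda>n. (b n - a n) * (q - 0) ^ n) sums 0" if "norm (q - 0) < 1" for q
    proof (cases "q = 0")
      case True
      then show ?thesis using b(1) by (simp add: a_def)
    next
      case False
      moreover have "q \<in> ball 0 1" using that by simp
      ultimately obtain z where z: "Im z > 0" "fourier_e z = q" using fourier_e_surj by blast
      have "(\<lambda>n. b (Suc n) * fourier_e (of_nat (Suc n) * z) - a (Suc n) * fourier_e (of_nat (Suc n) * z)) sums (f z - f z)"
        using b(2) z by (intro sums_diff a) (auto simp: upper_half_plane_def)
      then have "(\<lambda>n. (b (Suc n) - a (Suc n)) * q ^ Suc n) sums 0"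
        unfolding fourier_e_mult z(2) by (simp add: algebra_simps)
      then have "(\<lambda>n. (b n - a n) * q ^ n) sums (0 + (b 0 - a 0) * q ^ 0)"
        by (subst (asm) sums_Suc_iff) simp
      then show ?thesis using b(1) by (simp add: a_def)
    qed
    \<comment> \<open>Isolation of zeros, applied to a nontrivial power series with sum 0, yields a
      punctured disc on which 0 differs from 0.\<close>
    from powser_0_nonzero[of 1 0 "\<lambda>n. b n - a n" "\<lambda>_. 0" m, OF zero_less_one this refl m \<open>m > 0\<close>]
    obtain s where s: "0 < s" "\<And>z. z \<in> cball 0 s - {0::complex} \<Longrightarrow> (0::complex) \<noteq> 0" by blast
    have "of_real s \<in> cball 0 s - {0::complex}" using s(1) by simp
    from s(2)[OF this] show False by simp
  qed
  have eq: "fourier_coeff f = a"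
    unfolding fourier_coeff_def by (rule the_equality) (use a uniq in \<open>auto simp: a_def upper_half_plane_def\<close>)
  show "fourier_coeff f 0 = 0" by (simp add: eq a_def)
  show "(\<lambda>n. fourier_coeff f n * fourier_e z ^ n) sums f z" if "Im z > 0"
  proof -
    have "(\<lambda>n. a (Suc n) * fourier_e z ^ Suc n) sums f z" using a[OF that] unfolding fourier_e_mult .
    then have "(\<lambda>n. a n * fourier_e z ^ n) sums (f z + a 0 * fourier_e z ^ 0)" by (subst (asm) sums_Suc_iff) simp
    then show ?thesis by (simp add: eq a_def)
  qed
qed

section \<open>Mean squares of power series coefficients\<close>

lemma sum_roots_of_unity_power:
  fixes m n k :: nat
  assumes "n < m" "k < m"
  defines "\<omega> \<equiv> exp (2 * of_real pi * \<i> / of_nat m)"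
  shows "(\<Sum>j<m. \<omega> ^ (j * n) * cnj (\<omega> ^ (j * k))) = (if n = k then of_nat m else 0)"
proof -
  have cnj: "cnj \<omega> = inverse \<omega>" by (simp add: \<omega>_def exp_cnj exp_minus[symmetric])
  have w0: "\<omega> \<noteq> 0" by (simp add: \<omega>_def)
  have pow: "\<omega> ^ l = exp (2 * of_real pi * \<i> * of_nat l / of_nat m)" for l
    by (simp add: \<omega>_def exp_of_nat_mult[symmetric] mult_ac)
  have wm: "\<omega> ^ m = 1" using complex_root_unity_eq_1[of m m] assms(1) unfolding pow by simp
  define \<eta> where "\<eta> = \<omega> ^ n * inverse \<omega> ^ k"
  have "\<eta> ^ m = (\<omega> ^ m) ^ n * inverse ((\<omega> ^ m) ^ k)"
    unfolding \<eta>_def power_mult_distrib power_inverse power_mult[symmetric] by (simp add: mult.commute)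
  then have eta_m: "\<eta> ^ m = 1" by (simp add: wm)
  have "(\<Sum>j<m. \<omega> ^ (j * n) * cnj (\<omega> ^ (j * k))) = (\<Sum>j<m. \<eta> ^ j)"
    by (intro sum.cong refl)
       (simp add: \<eta>_def cnj power_mult_distrib power_mult[symmetric] mult.commute)
  also have "\<dots> = (if n = k then of_nat m else 0)"
  proof (cases "n = k")
    case True
    then have "\<eta> = 1" using w0 by (simp add: \<eta>_def power_inverse)
    then show ?thesis using True by simp
  next
    case False
    have "\<eta> \<noteq> 1"
    proof
      assume "\<eta> = 1"
      then have e: "\<omega> ^ n = \<omega> ^ k" using w0 by (simp add: \<eta>_def power_inverse field_simps)
      have ne: "\<omega> ^ l \<noteq> 1" if "0 < l" "l < m" for l
        using complex_root_unity_eq_1[of m l] that unfolding pow by (auto dest: dvd_imp_le)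
      have "\<omega> ^ (n - k) = 1" if "k < n" using e w0 that by (simp add: power_diff)
      moreover have "\<omega> ^ (k - n) = 1" if "n < k" using e w0 that by (simp add: power_diff)
      ultimately show False using ne[of "n - k"] ne[of "k - n"] False assms(1,2) by (cases "k < n") auto
    qed
    then show ?thesis using False eta_m by (simp add: geometric_sum)
  qed
  finally show ?thesis .
qed

text \<open>Parseval over the m-th roots of unity, by their orthogonality; this finite form takes
  the place of an integral over a circle.\<close>

lemma parseval_polynomial:
  fixes b :: "nat \<Rightarrow> complex"
  assumes "m > 0"
  defines "\<omega> \<equiv> exp (2 * of_real pi * \<i> / of_nat m)"
  shows "(\<Sum>j<m. (cmod (\<Sum>n<m. b n * \<omega> ^ (j * n)))\<^sup>2) = real m * (\<Sum>n<m. (cmod (b n))\<^sup>2)"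
proof -
  have "of_real (\<Sum>j<m. (cmod (\<Sum>n<m. b n * \<omega> ^ (j * n)))\<^sup>2)
     = (\<Sum>j<m. (\<Sum>n<m. b n * \<omega> ^ (j * n)) * cnj (\<Sum>k<m. b k * \<omega> ^ (j * k)))"
    by (simp only: of_real_sum complex_norm_square)
  also have "\<dots> = (\<Sum>j<m. \<Sum>n<m. \<Sum>k<m. (b n * cnj (b k)) * (\<omega> ^ (j * n) * cnj (\<omega> ^ (j * k))))"
    by (simp add: sum_product mult_ac)
  also have "\<dots> = (\<Sum>n<m. \<Sum>k<m. (b n * cnj (b k)) * (\<Sum>j<m. \<omega> ^ (j * n) * cnj (\<omega> ^ (j * k))))"
    unfolding sum_distrib_left by (rule trans[OF sum.swap]) (intro sum.cong refl sum.swap)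
  also have "\<dots> = (\<Sum>n<m. \<Sum>k<m. (b n * cnj (b k)) * (if n = k then of_nat m else 0))"
    unfolding \<omega>_def by (intro sum.cong refl arg_cong2[where f = "(*)"] sum_roots_of_unity_power) auto
  also have "\<dots> = (\<Sum>n<m. b n * cnj (b n) * of_nat m)"
    by (intro sum.cong refl) (simp add: if_distrib[of "\<lambda>x. _ * x"] cong: if_cong)
  also have "\<dots> = of_real (real m * (\<Sum>n<m. (cmod (b n))\<^sup>2))"
    by (simp add: complex_norm_square sum_distrib_left mult_ac del: of_real_power)
  finally show ?thesis by (simp only: of_real_eq_iff)
qed

text \<open>Parseval at \<open>m\<close> equidistant points of the circle for the partial sum of
  length \<open>m\<close>, which differs from \<open>H\<close> by at most the tail
  \<open>t m\<close> of the majorant; then m tends to infinity.\<close>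

lemma sum_sq_power_series_le:
  fixes c :: "nat \<Rightarrow> complex"
  assumes summ: "summable (\<lambda>n. cmod (c n) * \<rho> ^ n)" and rho: "\<rho> > 0"
    and H: "\<And>q. cmod q = \<rho> \<Longrightarrow> (\<lambda>n. c n * q ^ n) sums H q" and M: "\<And>q. cmod q = \<rho> \<Longrightarrow> cmod (H q) \<le> M"
  shows "(\<Sum>n<N. (cmod (c n) * \<rho> ^ n)\<^sup>2) \<le> M\<^sup>2"
proof -
  define t where "t m = (\<Sum>n. cmod (c (n + m)) * \<rho> ^ (n + m))" for m
  have t0: "t \<longlonglongrightarrow> 0"
    unfolding t_def using summable_LIMSEQ_zero[OF summ] suminf_exist_split2[OF summ] by simp
  have tail: "cmod (\<Sum>n<m. c n * q ^ n) \<le> M + t m" if q: "cmod q = \<rho>" for q m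
  proof -
    have nq: "norm (c n * q ^ n) = cmod (c n) * \<rho> ^ n" for n using q by (simp add: norm_mult norm_power)
    have s: "summable (\<lambda>n. norm (c n * q ^ n))" unfolding nq by (rule summ)
    have "H q = (\<Sum>n. c n * q ^ n)" using H[OF q] by (simp add: sums_iff)
    also have "\<dots> = (\<Sum>n. c (n + m) * q ^ (n + m)) + (\<Sum>n<m. c n * q ^ n)"
      by (rule suminf_split_initial_segment) (rule summable_norm_cancel[OF s])
    finally have "(\<Sum>n<m. c n * q ^ n) = H q - (\<Sum>n. c (n + m) * q ^ (n + m))" by simp
    then have "cmod (\<Sum>n<m. c n * q ^ n) \<le> cmod (H q) + cmod (\<Sum>n. c (n + m) * q ^ (n + m))"
      by (simp add: norm_triangle_ineq4)
    also have "cmod (\<Sum>n. c (n + m) * q ^ (n + m)) \<le> (\<Sum>n. norm (c (n + m) * q ^ (n + m)))"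
      by (rule summable_norm) (use summable_ignore_initial_segment[OF s, of m] in simp)
    also have "\<dots> = t m" unfolding t_def nq ..
    finally show ?thesis using M[OF q] by linarith
  qed
  have le: "(\<Sum>n<N. (cmod (c n) * \<rho> ^ n)\<^sup>2) \<le> (M + t m)\<^sup>2" if m: "m \<ge> N" "m > 0" for m
  proof -
    define \<omega> where "\<omega> = exp (2 * of_real pi * \<i> / of_nat m)"
    have w1: "cmod \<omega> = 1"
    proof -
      have "\<omega> = cis (2 * pi / real m)" by (simp add: \<omega>_def cis_conv_exp mult_ac)
      then show ?thesis by simp
    qed
    have "real m * (\<Sum>n<N. (cmod (c n) * \<rho> ^ n)\<^sup>2) \<le> real m * (\<Sum>n<m. (cmod (c n) * \<rho> ^ n)\<^sup>2)"
      using m by (intro mult_left_mono sum_mono2) auto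
    also have "\<dots> = real m * (\<Sum>n<m. (cmod (c n * of_real \<rho> ^ n))\<^sup>2)"
      using rho by (simp add: norm_mult norm_power)
    also have "\<dots> = (\<Sum>j<m. (cmod (\<Sum>n<m. (c n * of_real \<rho> ^ n) * \<omega> ^ (j * n)))\<^sup>2)"
      unfolding \<omega>_def by (rule parseval_polynomial[symmetric]) (rule m)
    also have "\<dots> \<le> (\<Sum>j<m. (M + t m)\<^sup>2)"
    proof (rule sum_mono)
      fix j
      have "(\<Sum>n<m. (c n * of_real \<rho> ^ n) * \<omega> ^ (j * n)) = (\<Sum>n<m. c n * (of_real \<rho> * \<omega> ^ j) ^ n)"
        by (simp add: power_mult_distrib power_mult mult.assoc)
      moreover have "cmod (of_real \<rho> * \<omega> ^ j) = \<rho>" using rho w1 by (simp add: norm_mult norm_power)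
      ultimately have "cmod (\<Sum>n<m. (c n * of_real \<rho> ^ n) * \<omega> ^ (j * n)) \<le> M + t m" using tail by simp
      then show "(cmod (\<Sum>n<m. (c n * of_real \<rho> ^ n) * \<omega> ^ (j * n)))\<^sup>2 \<le> (M + t m)\<^sup>2"
        by (intro power_mono) auto
    qed
    also have "\<dots> = real m * (M + t m)\<^sup>2" by simp
    finally show ?thesis using m by simp
  qed
  have "(\<lambda>m. (M + t m)\<^sup>2) \<longlonglongrightarrow> (M + 0)\<^sup>2" by (intro tendsto_intros t0)
  then have "(\<Sum>n<N. (cmod (c n) * \<rho> ^ n)\<^sup>2) \<le> (M + 0)\<^sup>2"
    by (rule LIMSEQ_le_const) (use le in \<open>auto intro!: exI[of _ "Suc N"]\<close>)
  then show ?thesis by simp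
qed

text \<open>Dyadic blocks replace partial summation: the block from 2^k to 2^(k+1) contributes at
  most K 2^\<alpha> r^k with r = 2^(\<alpha> - \<sigma>) < 1.\<close>

lemma dirichlet_summable:
  fixes b :: "nat \<Rightarrow> real"
  assumes b: "\<And>n. b n \<ge> 0" and K: "\<And>N. (\<Sum>n<N. b n) \<le> K * real N powr \<alpha>" and \<sigma>: "\<alpha> < \<sigma>" "0 \<le> \<sigma>"
  shows "summable (\<lambda>n. b n * real n powr (- \<sigma>))"
proof -
  have K0: "K \<ge> 0" using order_trans[OF b[of 0], of K] K[of 1] by simp
  define r where "r = 2 powr (\<alpha> - \<sigma>)"
  have r: "0 < r" "r < 1" using \<sigma> by (auto simp: r_def powr_less_one)
  let ?g = "\<lambda>n. b n * real n powr (- \<sigma>)"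
  have g: "?g n \<ge> 0" for n using b by simp
  have dyadic: "(\<Sum>n<2^k. ?g n) \<le> b 1 + K * 2 powr \<alpha> * (\<Sum>i<k. r ^ i)" for k
  proof (induction k)
    case 0
    \<comment> \<open>\<open>0 powr x\<close> is 0, so the index 0 contributes nothing.\<close>
    have "(\<Sum>n<2^0. ?g n) = 0" by simp
    then show ?case using b[of 1] by simp
  next
    case (Suc k)
    have "(\<Sum>n<2 ^ Suc k. ?g n) = (\<Sum>n<2^k. ?g n) + (\<Sum>n=2^k..<2^Suc k. ?g n)"
      by (simp add: lessThan_atLeast0 sum.atLeastLessThan_concat)
    also have "(\<Sum>n=2^k..<2^Suc k. ?g n) \<le> (\<Sum>n=2^k..<2^Suc k. b n * (2 ^ k) powr (- \<sigma>))"
    proof (intro sum_mono mult_left_mono b)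
      fix n :: nat assume "n \<in> {2^k..<2^Suc k}"
      then have "real (2 ^ k) \<le> real n" by (intro of_nat_mono) simp
      then have "(2::real) ^ k \<le> real n" by simp
      then show "real n powr - \<sigma> \<le> (2 ^ k) powr - \<sigma>" using \<sigma> by (intro powr_mono2') auto
    qed
    also have "\<dots> = (\<Sum>n=2^k..<2^Suc k. b n) * (2 ^ k) powr (- \<sigma>)" by (simp add: sum_distrib_right)
    also have "\<dots> \<le> (\<Sum>n<2^Suc k. b n) * (2 ^ k) powr (- \<sigma>)"
      by (intro mult_right_mono sum_mono2) (auto simp: b)
    also have "\<dots> \<le> (K * real (2 ^ Suc k) powr \<alpha>) * (2 ^ k) powr (- \<sigma>)"
      by (intro mult_right_mono K) auto
    also have "\<dots> = K * 2 powr \<alpha> * r ^ k"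
    proof -
      have p: "(2::real) ^ k = 2 powr real k" by (simp add: powr_realpow)
      have "real (2 ^ Suc k) powr \<alpha> = 2 powr (\<alpha> + real k * \<alpha>)"
        by (simp add: powr_mult powr_add powr_powr p)
      moreover have "((2::real) ^ k) powr (- \<sigma>) = 2 powr (- (real k * \<sigma>))" by (simp add: p powr_powr)
      moreover have "r ^ k = 2 powr (real k * \<alpha> - real k * \<sigma>)"
        using r by (simp add: r_def powr_realpow[symmetric] powr_powr algebra_simps)
      ultimately show ?thesis by (simp add: powr_add powr_diff powr_minus field_simps)
    qed
    finally show ?case using Suc by (simp add: algebra_simps)
  qed
  have geo: "(\<Sum>i<k. r ^ i) \<le> 1 / (1 - r)" for k
  proof -
    have "(\<Sum>i<k. r ^ i) = (1 - r ^ k) / (1 - r)" using r by (simp add: sum_gp_strict)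
    also have "\<dots> \<le> 1 / (1 - r)" using r by (intro divide_right_mono) auto
    finally show ?thesis .
  qed
  show ?thesis
  proof (rule summableI_nonneg_bounded[OF g])
    fix n :: nat
    have "n \<le> 2 ^ n" by (simp add: less_imp_le)
    then have "(\<Sum>i<n. ?g i) \<le> (\<Sum>i<2^n. ?g i)" using g by (intro sum_mono2) auto
    also have "\<dots> \<le> b 1 + K * 2 powr \<alpha> * (\<Sum>i<n. r ^ i)" by (rule dyadic)
    also have "\<dots> \<le> b 1 + K * 2 powr \<alpha> * (1 / (1 - r))"
      using K0 by (intro add_left_mono mult_left_mono geo) auto
    finally show "(\<Sum>i<n. ?g i) \<le> b 1 + K * 2 powr \<alpha> * (1 / (1 - r))" .
  qed
qed

text \<open>Convergence at height \<open>y / 2\<close> gives absolute convergence at the smaller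
  radius belonging to \<open>y\<close>.\<close>

lemma fourier_coeff_summable:
  assumes G: "G holomorphic_on ball 0 1" "\<And>z. Im z > 0 \<Longrightarrow> f z = qexp 1 z * G (qexp 1 z)" and y: "y > 0"
  shows "summable (\<lambda>n. cmod (fourier_coeff f n) * exp (- (2 * pi * y)) ^ n)"
proof -
  have "summable (\<lambda>n. fourier_coeff f n * fourier_e (\<i> * of_real (y/2)) ^ n)"
    using fourier_coeff_sums(2)[OF G, of "\<i> * of_real (y/2)"] y by (auto simp: sums_iff)
  then have "summable (\<lambda>n. norm (fourier_coeff f n * of_real (exp (- (2 * pi * y))) ^ n))"
    by (rule powser_insidea) (use y in \<open>simp add: qexp_1[symmetric] norm_qexp\<close>)
  then show ?thesis by (simp add: norm_mult norm_power)
qed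

text \<open>At height y = 1 / N the hypothesis reads |f| \<le> C N, and the weights \<rho>^n with n
  < N stay above exp (- 2 pi). So the sum of |a(n)|^2 is at most (C exp (2 pi) N)^2, and
  Cauchy-Schwarz costs a factor sqrt N. The exponent 3/2 is the abscissa in
  \<open>twisted_L\<close>.\<close>

lemma fourier_coeff_sum_bound:
  assumes G: "G holomorphic_on ball 0 1" "\<And>z. Im z > 0 \<Longrightarrow> f z = qexp 1 z * G (qexp 1 z)"
    and C: "C > 0" "\<And>z. Im z > 0 \<Longrightarrow> Im z * cmod (f z) \<le> C"
  shows "(\<Sum>n<N. cmod (fourier_coeff f n)) \<le> C * exp (2 * pi) * real N powr (3/2)"
proof (cases "N = 0")
  case False
  define y where "y = 1 / real N"
  have y: "y > 0" using False by (simp add: y_def)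
  define \<rho> where "\<rho> = exp (- (2 * pi * y))"
  let ?a = "fourier_coeff f"
  have pt: "\<exists>z. Im z = y \<and> fourier_e z = q" if q: "cmod q = \<rho>" for q
  proof -
    have rho1: "\<rho> < 1" "\<rho> > 0" using y by (simp_all add: \<rho>_def)
    then have "q \<in> ball 0 1" "q \<noteq> 0" using q by auto
    then obtain z where z: "Im z > 0" "fourier_e z = q" using fourier_e_surj by blast
    have "exp (- (2 * pi * Im z / 1)) = exp (- (2 * pi * y))"
      using norm_qexp[of 1 z] q z(2) by (simp add: qexp_1 \<rho>_def)
    then have "Im z = y" by simp
    then show ?thesis using z by blast
  qed
  \<comment> \<open>\<open>f\<close> as a function of q on the circle, through a preimage at height
    \<open>y\<close>. Any choice serves, since the series in q has the sum \<open>f z\<close> at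
    each preimage.\<close>
  define H where "H q = f (SOME z. Im z = y \<and> fourier_e z = q)" for q
  have sel: "Im (SOME z. Im z = y \<and> fourier_e z = q) = y \<and> fourier_e (SOME z. Im z = y \<and> fourier_e z = q) = q"
    if "cmod q = \<rho>" for q using someI_ex[OF pt[OF that]] .
  have "(\<Sum>n<N. (cmod (?a n) * \<rho> ^ n)\<^sup>2) \<le> (C / y)\<^sup>2"
  proof (rule sum_sq_power_series_le[where H = H])
    show "summable (\<lambda>n. cmod (?a n) * \<rho> ^ n)" unfolding \<rho>_def by (rule fourier_coeff_summable[OF G y])
    show "\<rho> > 0" by (simp add: \<rho>_def)
    fix q assume q: "cmod q = \<rho>"
    let ?z = "SOME z. Im z = y \<and> fourier_e z = q"
    have z: "Im ?z = y" "fourier_e ?z = q" using sel[OF q] by auto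
    show "(\<lambda>n. ?a n * q ^ n) sums H q"
      using fourier_coeff_sums(2)[OF G, of ?z] y z unfolding H_def by simp
    have "y * cmod (H q) \<le> C" using C(2)[of ?z] y z unfolding H_def by simp
    then show "cmod (H q) \<le> C / y" using y by (simp add: field_simps)
  qed
  then have 1: "(\<Sum>n<N. (cmod (?a n) * \<rho> ^ n)\<^sup>2) \<le> (C * real N)\<^sup>2" by (simp add: y_def)
  have "(exp (- (2 * pi)))\<^sup>2 * (\<Sum>n<N. (cmod (?a n))\<^sup>2) \<le> (\<Sum>n<N. (cmod (?a n) * \<rho> ^ n)\<^sup>2)"
    unfolding sum_distrib_left
  proof (rule sum_mono)
    fix n assume "n \<in> {..<N}"
    then have "real n \<le> real N" by simp
    have "2 * pi * y * real n \<le> 2 * pi * y * real N" using y \<open>real n \<le> real N\<close> by (intro mult_left_mono) auto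
    also have "\<dots> = 2 * pi" using False by (simp add: y_def)
    finally have "exp (- (2 * pi)) \<le> exp (- (2 * pi * y)) ^ n"
      by (simp add: exp_of_nat_mult[symmetric] mult_ac)
    then have "exp (- (2 * pi)) * cmod (?a n) \<le> cmod (?a n) * \<rho> ^ n"
      unfolding \<rho>_def by (subst mult.commute) (intro mult_left_mono, auto)
    then have "(exp (- (2 * pi)) * cmod (?a n))\<^sup>2 \<le> (cmod (?a n) * \<rho> ^ n)\<^sup>2" by (intro power_mono) auto
    then show "(exp (- (2 * pi)))\<^sup>2 * (cmod (?a n))\<^sup>2 \<le> (cmod (?a n) * \<rho> ^ n)\<^sup>2" by (simp add: power_mult_distrib)
  qed
  then have "(exp (- (2 * pi)))\<^sup>2 * (\<Sum>n<N. (cmod (?a n))\<^sup>2) \<le> (C * real N)\<^sup>2" using 1 by linarith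
  then have "(\<Sum>n<N. (cmod (?a n))\<^sup>2) \<le> (exp (2 * pi))\<^sup>2 * (C * real N)\<^sup>2"
    by (simp add: exp_minus power_inverse field_simps)
  then have "(\<Sum>n<N. (cmod (?a n))\<^sup>2) * real (card {..<N}) \<le> ((exp (2 * pi))\<^sup>2 * (C * real N)\<^sup>2) * real N"
    by (intro mult_mono) auto
  then have "(\<Sum>n<N. cmod (?a n))\<^sup>2 \<le> ((exp (2 * pi))\<^sup>2 * (C * real N)\<^sup>2) * real N"
    using sum_squared_le_sum_of_squares[of "\<lambda>n. cmod (?a n)" "{..<N}"] by linarith
  also have "\<dots> = (C * exp (2 * pi) * real N powr (3/2))\<^sup>2"
  proof -
    have "(real N powr (3/2))\<^sup>2 = real N powr 3"
      by (simp add: power2_eq_square flip: powr_add)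
    also have "\<dots> = real N ^ 3" by (rule powr_numeral) simp
    finally show ?thesis by (simp add: power_mult_distrib power2_eq_square power3_eq_cube mult_ac)
  qed
  finally show ?thesis by (rule power2_le_imp_le) (use C in simp)
qed simp

section \<open>Mellin transforms\<close>

lemma powr_complex_of_real: "y > 0 \<Longrightarrow> complex_of_real y powr z = exp (z * of_real (ln y))"
  by (simp add: powr_def Ln_of_real)

lemma absolutely_integrable_scale:
  fixes g :: "real \<Rightarrow> 'a::euclidean_space"
  assumes g: "g absolutely_integrable_on {0<..}" and k: "k > 0"
  shows "integral {0<..} (\<lambda>y. g (k * y)) = integral {0<..} g /\<^sub>R k"
    and "(\<lambda>y. g (k * y)) absolutely_integrable_on {0<..}"
proof -
  let ?h = "\<lambda>y. indicator {0<..} y *\<^sub>R g y"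
  have "has_bochner_integral lebesgue ?h (integral {0<..} g)"
    using g set_lebesgue_integral_eq_integral(2)[OF g]
    by (simp add: has_bochner_integral_iff set_integrable_def set_lebesgue_integral_def)
  then have "has_bochner_integral lebesgue (\<lambda>y. ?h (0 + k * y)) (integral {0<..} g /\<^sub>R \<bar>k\<bar>)"
    using k by (subst has_bochner_integral_lebesgue_real_affine_iff[symmetric]) auto
  moreover have "(\<lambda>y. ?h (0 + k * y)) = (\<lambda>y. indicator {0<..} y *\<^sub>R g (k * y))"
    using k by (auto simp: indicator_def zero_less_mult_iff)
  ultimately have *: "has_bochner_integral lebesgue (\<lambda>y. indicator {0<..} y *\<^sub>R g (k * y)) (integral {0<..} g /\<^sub>R k)"
    using k by (simp only: abs_of_pos)
  then show a: "(\<lambda>y. g (k * y)) absolutely_integrable_on {0<..}"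
    by (simp add: has_bochner_integral_iff set_integrable_def)
  show "integral {0<..} (\<lambda>y. g (k * y)) = integral {0<..} g /\<^sub>R k"
    using * set_lebesgue_integral_eq_integral(2)[OF a]
    by (simp add: has_bochner_integral_iff set_lebesgue_integral_def)
qed

text \<open>Euler's integral after the substitution k y. The second identity supplies the summable
  norms for integrating term by term.\<close>

lemma Gamma_integral_scaled:
  assumes s: "Re s > 0" and k: "k > 0"
  defines "g \<equiv> \<lambda>k y. complex_of_real y powr (s - 1) / of_real (exp (k * y))"
  shows "integral {0<..} (g k) = Gamma s * of_real k powr (- s)"
    and "integral {0<..} (\<lambda>y. norm (g k y)) = k powr (- Re s) * integral {0<..} (\<lambda>y. norm (g 1 y))"
proof -
  have g1: "g 1 absolutely_integrable_on {0<..}"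
    unfolding g_def by (rule absolutely_integrable_Gamma_integral[OF s]) simp
  have gk: "g k y = of_real k powr (1 - s) * g 1 (k * y)" if "y > 0" for y
  proof -
    have "complex_of_real (k * y) powr (s - 1) = of_real k powr (s - 1) * of_real y powr (s - 1)"
      using k that by (simp add: powr_times_real)
    moreover have "complex_of_real k powr (1 - s) * of_real k powr (s - 1) = 1"
      using k by (simp add: powr_add[symmetric])
    ultimately show ?thesis by (simp add: g_def mult.assoc[symmetric])
  qed
  have kk: "complex_of_real k powr (1 - s) = of_real k * of_real k powr (- s)"
    using k by (simp add: powr_diff powr_minus divide_inverse)
  have I1: "integral {0<..} (g 1) = Gamma s"
    using Gamma_integral_complex'[OF s] by (simp add: g_def integral_unique)
  have "integral {0<..} (g k) = integral {0<..} (\<lambda>y. of_real k powr (1 - s) * g 1 (k * y))"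
    by (rule integral_cong) (simp add: gk)
  also have "\<dots> = of_real k powr (1 - s) * integral {0<..} (\<lambda>y. g 1 (k * y))" by simp
  also have "\<dots> = of_real k powr (1 - s) * (Gamma s /\<^sub>R k)"
    unfolding absolutely_integrable_scale(1)[OF g1 k] I1 ..
  also have "\<dots> = Gamma s * of_real k powr (- s)" unfolding kk using k by (simp add: scaleR_conv_of_real)
  finally show "integral {0<..} (g k) = Gamma s * of_real k powr (- s)" .
  have n1: "(\<lambda>y. norm (g 1 y)) absolutely_integrable_on {0<..}" using absolutely_integrable_norm[OF g1] by (simp add: o_def)
  have "integral {0<..} (\<lambda>y. norm (g k y)) = integral {0<..} (\<lambda>y. k powr (1 - Re s) * norm (g 1 (k * y)))"
    by (rule integral_cong) (use k in \<open>simp add: gk norm_mult norm_powr_real_powr\<close>)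
  also have "\<dots> = k powr (1 - Re s) * integral {0<..} (\<lambda>y. norm (g 1 (k * y)))" by simp
  also have "integral {0<..} (\<lambda>y. norm (g 1 (k * y))) = integral {0<..} (\<lambda>y. norm (g 1 y)) / k"
    using absolutely_integrable_scale(1)[OF n1 k] by (simp add: divide_inverse mult.commute)
  finally show "integral {0<..} (\<lambda>y. norm (g k y)) = k powr (- Re s) * integral {0<..} (\<lambda>y. norm (g 1 y))"
    using k by (simp add: powr_diff powr_minus divide_inverse)
qed

section \<open>Mellin transforms of functions that decay at both ends\<close>

lemma has_integral_exp_neg: "((\<lambda>y::real. exp (- y)) has_integral 1) {0<..}"
proof -
  have "((\<lambda>y::real. exp (- y)) has_integral 1) {0..}"
    using has_integral_exp_minus_to_infinity[of 1 0] by simp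
  moreover have "((\<lambda>y::real. exp (- y)) has_integral 1) {0..} \<longleftrightarrow> ((\<lambda>y::real. exp (- y)) has_integral 1) {0<..}"
  proof (rule has_integral_spike_set_eq)
    show "negligible {x \<in> {0..} - {0<..}. exp (- x) \<noteq> (0::real)}"
      by (rule negligible_subset[of "{0}"]) auto
    show "negligible {x \<in> {0<..} - {0..}. exp (- x) \<noteq> (0::real)}"
      by (rule negligible_subset[of "{}"]) auto
  qed
  ultimately show ?thesis by blast
qed

text \<open>One constant for a whole vertical strip and all \<open>y\<close>, near 0 as well as near
  infinity. This forces \<phi> to vanish at 0 faster than every power of \<open>y\<close>, so the
  integral converges for every \<open>s\<close>.\<close>

locale mellin =
  fixes \<phi> :: "real \<Rightarrow> complex"
  assumes cont: "continuous_on {0<..} \<phi>"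
    and decay: "\<And>R. \<exists>C. \<forall>s y. \<bar>Re s\<bar> \<le> R \<longrightarrow> y > 0 \<longrightarrow> cmod (\<phi> y * of_real y powr (s - 1)) \<le> C * exp (- y)"
begin

definition M :: "complex \<Rightarrow> complex" where
  "M s = integral {0<..} (\<lambda>y. \<phi> y * of_real y powr (s - 1))"

text \<open>Over a compact interval the integral is holomorphic by differentiation under the
  integral sign; for \<open>M\<close> only locally uniform convergence remains.\<close>

definition trunc :: "nat \<Rightarrow> complex \<Rightarrow> complex" where
  "trunc n s = integral {1 / real (Suc n)..real (Suc n)} (\<lambda>y. \<phi> y * of_real y powr (s - 1))"

lemma cont_integrand: "continuous_on {0<..} (\<lambda>y. \<phi> y * of_real y powr (s - 1))"
  by (intro continuous_intros cont) auto

lemma absolutely_integrable: "(\<lambda>y. \<phi> y * of_real y powr (s - 1)) absolutely_integrable_on {0<..}"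
proof -
  obtain C where C: "\<And>y. y > 0 \<Longrightarrow> cmod (\<phi> y * of_real y powr (s - 1)) \<le> C * exp (- y)"
    using decay[of "\<bar>Re s\<bar>"] by auto
  show ?thesis
  proof (rule measurable_bounded_by_integrable_imp_absolutely_integrable)
    show "(\<lambda>y. \<phi> y * of_real y powr (s - 1)) \<in> borel_measurable (lebesgue_on {0<..})"
      by (intro continuous_imp_measurable_on_sets_lebesgue cont_integrand) auto
    show "(\<lambda>y. C * exp (- y)) integrable_on {0<..}"
      using has_integral_exp_neg by (intro integrable_on_mult_right) blast
  qed (use C in auto)
qed

text \<open>The error is at most the mass of the majorant C exp (-y) outside the interval. It
  depends on \<open>s\<close> through \<open>C\<close> alone, which gives uniformity on
  strips.\<close>

lemma truncation_error:
  assumes C: "\<And>y. y > 0 \<Longrightarrow> cmod (\<phi> y * of_real y powr (s - 1)) \<le> C * exp (- y)"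
  shows "cmod (M s - trunc n s) \<le> C * (1 - (exp (- (1 / real (Suc n))) - exp (- real (Suc n))))"
proof -
  let ?N = "real (Suc n)"
  let ?J = "{1 / ?N..?N}"
  let ?h = "\<lambda>y. \<phi> y * of_real y powr (s - 1)"
  have N: "1 / ?N > 0" "1 / ?N \<le> ?N" by (simp_all add: divide_le_eq algebra_simps)
  have sub: "?J \<subseteq> {0<..}"
  proof
    fix y assume "y \<in> ?J"
    then have "1 / ?N \<le> y" by (simp only: atLeastAtMost_iff)
    with N(1) show "y \<in> {0<..}" by (simp only: greaterThan_iff)
  qed
  have hJ: "?h integrable_on ?J"
    by (intro integrable_continuous_interval continuous_on_subset[OF cont_integrand sub])
  have hi: "(?h has_integral M s) {0<..}"
    unfolding M_def using absolutely_integrable set_lebesgue_integral_eq_integral(1) integrable_integral by blast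
  have ht: "((\<lambda>y. if y \<in> ?J then ?h y else 0) has_integral trunc n s) {0<..}"
    unfolding trunc_def by (subst has_integral_restrict[OF sub]) (rule integrable_integral[OF hJ])
  have hd: "((\<lambda>y. ?h y - (if y \<in> ?J then ?h y else 0)) has_integral (M s - trunc n s)) {0<..}"
    by (rule has_integral_diff[OF hi ht])
  have he: "((\<lambda>y. C * (exp (- y) - (if y \<in> ?J then exp (- y) else 0))) has_integral
      C * (1 - (exp (- (1 / ?N)) - exp (- ?N)))) {0<..}"
  proof (intro has_integral_mult_right has_integral_diff has_integral_exp_neg)
    have "((\<lambda>y. exp (- y)) has_integral (- exp (- ?N) - (- exp (- (1 / ?N))))) ?J"
      using N(2) by (intro fundamental_theorem_of_calculus)
        (auto intro!: derivative_eq_intros simp: has_real_derivative_iff_has_vector_derivative[symmetric])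
    then show "((\<lambda>y. if y \<in> ?J then exp (- y) else 0) has_integral (exp (- (1 / ?N)) - exp (- ?N))) {0<..}"
      by (subst has_integral_restrict[OF sub]) simp
  qed
  have "norm (integral {0<..} (\<lambda>y. ?h y - (if y \<in> ?J then ?h y else 0))) \<le>
      integral {0<..} (\<lambda>y. C * (exp (- y) - (if y \<in> ?J then exp (- y) else 0)))"
  proof (rule Henstock_Kurzweil_Integration.integral_norm_bound_integral)
    show "(\<lambda>y. ?h y - (if y \<in> ?J then ?h y else 0)) integrable_on {0<..}" using hd by blast
    show "(\<lambda>y. C * (exp (- y) - (if y \<in> ?J then exp (- y) else 0))) integrable_on {0<..}" using he by blast
    show "norm (?h y - (if y \<in> ?J then ?h y else 0)) \<le> C * (exp (- y) - (if y \<in> ?J then exp (- y) else 0))"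
      if "y \<in> {0<..}" for y using C[of y] that by auto
  qed
  then show ?thesis unfolding integral_unique[OF hd] integral_unique[OF he] .
qed

lemma trunc_holomorphic: "trunc n holomorphic_on UNIV"
proof -
  let ?N = "real (Suc n)"
  have pos: "y > 0" if "y \<in> cbox (1 / ?N) ?N" for y
  proof -
    have "0 < 1 / ?N" by simp
    also have "1 / ?N \<le> y" using that by simp
    finally show ?thesis .
  qed
  let ?f = "\<lambda>s y. \<phi> y * exp ((s - 1) * of_real (ln y))"
  let ?f' = "\<lambda>s y. \<phi> y * (of_real (ln y) * exp ((s - 1) * of_real (ln y)))"
  have contc: "continuous_on (cbox (1 / ?N) ?N) \<phi>" using pos by (intro continuous_on_subset[OF cont]) auto
  have "(\<lambda>s. integral (cbox (1 / ?N) ?N) (?f s)) holomorphic_on UNIV"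
  proof (rule leibniz_rule_holomorphic)
    show "((\<lambda>s. ?f s y) has_field_derivative ?f' s y) (at s within UNIV)" for s y
      by (auto intro!: derivative_eq_intros)
    show "?f s integrable_on cbox (1 / ?N) ?N" for s
    proof (rule integrable_continuous)
      show "continuous_on (cbox (1 / ?N) ?N) (?f s)"
        using pos by (intro continuous_intros contc) force
    qed
    have c2: "continuous_on (UNIV \<times> cbox (1 / ?N) ?N) (\<lambda>x. \<phi> (snd x))"
      by (rule continuous_on_compose2[OF contc]) (auto intro!: continuous_intros)
    have "continuous_on (UNIV \<times> cbox (1 / ?N) ?N) (\<lambda>x. ?f' (fst x) (snd x))"
      using pos by (intro continuous_intros c2) force+
    then show "continuous_on (UNIV \<times> cbox (1 / ?N) ?N) (\<lambda>(s, y). ?f' s y)"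
      by (simp add: case_prod_unfold)
  qed simp
  moreover have "integral (cbox (1 / ?N) ?N) (?f s) = trunc n s" for s
    unfolding trunc_def cbox_interval[symmetric]
    by (rule integral_cong) (use pos powr_complex_of_real in simp)
  ultimately show ?thesis by simp
qed

lemma truncation_error_tendsto:
  "(\<lambda>n. C * (1 - (exp (- (1 / real (Suc n))) - exp (- real (Suc n))))) \<longlonglongrightarrow> 0"
proof -
  have a: "(\<lambda>n. 1 / real (Suc n)) \<longlonglongrightarrow> 0" using LIMSEQ_inverse_real_of_nat by (simp add: inverse_eq_divide)
  have "filterlim (\<lambda>n. real (Suc n)) at_top sequentially"
    using filterlim_real_sequentially filterlim_sequentially_Suc by blast
  then have b: "(\<lambda>n. exp (- real (Suc n))) \<longlonglongrightarrow> 0"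
    by (intro filterlim_compose[OF exp_at_bot]) (simp add: filterlim_uminus_at_bot del: of_nat_Suc)
  have "(\<lambda>n. C * (1 - (exp (- (1 / real (Suc n))) - exp (- real (Suc n))))) \<longlonglongrightarrow> C * (1 - (exp (- 0) - 0))"
    by (intro tendsto_intros a b)
  then show ?thesis by simp
qed

lemma trunc_tendsto: "(\<lambda>n. trunc n s) \<longlonglongrightarrow> M s"
proof -
  obtain C where C: "\<And>y. y > 0 \<Longrightarrow> cmod (\<phi> y * of_real y powr (s - 1)) \<le> C * exp (- y)"
    using decay[of "\<bar>Re s\<bar>"] by auto
  have "(\<lambda>n. M s - trunc n s) \<longlonglongrightarrow> 0"
    by (rule Lim_null_comparison[OF always_eventually truncation_error_tendsto]) (use truncation_error[OF C] in blast)
  then have "(\<lambda>n. M s - (M s - trunc n s)) \<longlonglongrightarrow> M s - 0" by (intro tendsto_diff tendsto_const)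
  then show ?thesis by simp
qed

lemma M_holomorphic: "M holomorphic_on UNIV"
proof (rule holomorphic_uniform_sequence[OF open_UNIV trunc_holomorphic])
  fix s0 :: complex
  obtain C where C: "\<And>s y. \<bar>Re s\<bar> \<le> cmod s0 + 1 \<Longrightarrow> y > 0 \<Longrightarrow> cmod (\<phi> y * of_real y powr (s - 1)) \<le> C * exp (- y)"
    using decay[of "cmod s0 + 1"] by blast
  have "uniform_limit (cball s0 1) trunc M sequentially"
  proof (rule uniform_limitI)
    fix e :: real assume "e > 0"
    then have "eventually (\<lambda>n. C * (1 - (exp (- (1 / real (Suc n))) - exp (- real (Suc n)))) < e) sequentially"
      by (rule order_tendstoD[OF truncation_error_tendsto])
    then show "eventually (\<lambda>n. \<forall>s\<in>cball s0 1. dist (trunc n s) (M s) < e) sequentially"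
    proof eventually_elim
      case (elim n)
      show ?case
      proof
        fix s assume "s \<in> cball s0 1"
        then have "cmod (s - s0) \<le> 1" by (simp add: dist_norm norm_minus_commute)
        moreover have "cmod s \<le> cmod s0 + cmod (s - s0)" using norm_triangle_ineq[of s0 "s - s0"] by simp
        ultimately have "\<bar>Re s\<bar> \<le> cmod s0 + 1" using abs_Re_le_cmod[of s] by linarith
        then have "cmod (M s - trunc n s) \<le> C * (1 - (exp (- (1 / real (Suc n))) - exp (- real (Suc n))))"
          by (intro truncation_error C)
        then have "cmod (M s - trunc n s) < e" using elim by (rule le_less_trans)
        then show "dist (trunc n s) (M s) < e" by (simp add: dist_norm norm_minus_commute)
      qed
    qed
  qed
  then show "\<exists>d>0. cball s0 d \<subseteq> UNIV \<and> uniform_limit (cball s0 d) trunc M sequentially"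
    by (intro exI[of _ 1]) simp
qed

text \<open>Termwise integration of the exponential series. The coefficient \<open>c n\<close>
  belongs to the index \<open>Suc n\<close>. With the entire function \<open>rGamma\<close> in place
  of a quotient, the same formula defines the continuation for all \<open>s\<close>.\<close>

lemma dirichlet_series:
  assumes series: "\<And>y. y > 0 \<Longrightarrow> (\<lambda>n. c n * of_real (exp (- (2 * pi * real (Suc n) * y)))) sums \<phi> y"
    and abs: "\<And>y. y > 0 \<Longrightarrow> summable (\<lambda>n. cmod (c n) * exp (- (2 * pi * real (Suc n) * y)))"
    and summ: "summable (\<lambda>n. cmod (c n) * real (Suc n) powr (- Re s))" and s: "Re s > 0"
  shows "(\<lambda>n. c n * of_nat (Suc n) powr (- s)) sums ((of_real (2 * pi)) powr s * rGamma s * M s)"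
proof -
  define k where "k n = 2 * pi * real (Suc n)" for n
  have k: "k n > 0" for n unfolding k_def by (simp del: of_nat_Suc)
  define g where "g k y = complex_of_real y powr (s - 1) / of_real (exp (k * y))" for k y :: real
  define I where "I = integral {0<..} (\<lambda>y. norm (g 1 y))"
  have gint: "g (k n) absolutely_integrable_on {0<..}" for n
    unfolding g_def by (rule absolutely_integrable_Gamma_integral[OF s k])
  let ?M = "lebesgue_on {0<..} :: real measure"
  have int: "integrable ?M h" if "h absolutely_integrable_on {0<..}" for h :: "real \<Rightarrow> 'b::euclidean_space"
    using that by (simp add: integrable_restrict_space set_integrable_def)
  have eqI: "integral\<^sup>L ?M h = integral {0<..} h" if "h absolutely_integrable_on {0<..}" for h :: "real \<Rightarrow> 'b::euclidean_space"
    by (rule lebesgue_integral_eq_integral[OF int[OF that]]) simp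
  have cint: "(\<lambda>y. c n * g (k n) y) absolutely_integrable_on {0<..}" for n
    using gint[of n] by (rule set_integrable_mult_right)
  have pk: "k n powr (- Re s) = (2 * pi) powr (- Re s) * real (Suc n) powr (- Re s)" for n
    unfolding k_def by (rule powr_mult) 
  have cpk: "of_real (k n) powr (- s) = of_real (2 * pi) powr (- s) * of_nat (Suc n) powr (- s)" for n
    unfolding k_def of_real_mult[of "2 * pi"] by (subst powr_times_real) (auto simp del: of_nat_Suc)
  have "(\<lambda>n. integral\<^sup>L ?M (\<lambda>y. c n * g (k n) y)) sums (integral\<^sup>L ?M (\<lambda>y. \<Sum>n. c n * g (k n) y))"
  proof (rule sums_integral)
    show "integrable ?M (\<lambda>y. c n * g (k n) y)" for n by (rule int[OF cint])
    have "norm (c n * g (k n) y) = (cmod (c n) * exp (- (2 * pi * real (Suc n) * y))) * norm (complex_of_real y powr (s - 1))" for n y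
      by (simp add: g_def k_def norm_mult norm_divide norm_inverse exp_minus divide_inverse del: of_nat_Suc)
    then show "AE y in ?M. summable (\<lambda>n. norm (c n * g (k n) y))"
      using abs by (intro AE_I2) (auto intro!: summable_mult2)
    have "(\<integral>y. norm (c n * g (k n) y) \<partial>?M) = (2 * pi) powr (- Re s) * I * (cmod (c n) * real (Suc n) powr (- Re s))" for n
    proof -
      have "(\<integral>y. norm (c n * g (k n) y) \<partial>?M) = cmod (c n) * integral {0<..} (\<lambda>y. norm (g (k n) y))"
        using eqI[OF absolutely_integrable_norm[OF cint[of n]]] by (simp add: norm_mult o_def)
      also have "integral {0<..} (\<lambda>y. norm (g (k n) y)) = k n powr (- Re s) * I"
        unfolding I_def g_def by (rule Gamma_integral_scaled(2)[OF s k])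
      finally show ?thesis unfolding pk by (simp add: mult_ac)
    qed
    then show "summable (\<lambda>n. \<integral>y. norm (c n * g (k n) y) \<partial>?M)" using summ by (auto intro!: summable_mult)
  qed
  moreover have "integral\<^sup>L ?M (\<lambda>y. c n * g (k n) y) = Gamma s * of_real (2 * pi) powr (- s) * (c n * of_nat (Suc n) powr (- s))" for n
  proof -
    have "integral\<^sup>L ?M (\<lambda>y. c n * g (k n) y) = c n * integral {0<..} (g (k n))"
      unfolding eqI[OF cint] by simp
    also have "integral {0<..} (g (k n)) = Gamma s * of_real (k n) powr (- s)"
      unfolding g_def by (rule Gamma_integral_scaled(1)[OF s k])
    finally show ?thesis unfolding cpk by (simp add: mult_ac)
  qed
  moreover have "integral\<^sup>L ?M (\<lambda>y. \<Sum>n. c n * g (k n) y) = M s"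
  proof -
    have "integral\<^sup>L ?M (\<lambda>y. \<Sum>n. c n * g (k n) y) = integral\<^sup>L ?M (\<lambda>y. \<phi> y * of_real y powr (s - 1))"
    proof (rule Bochner_Integration.integral_cong[OF refl])
      fix y assume "y \<in> space ?M"
      then have y: "y > 0" by simp
      have "(\<lambda>n. c n * of_real (exp (- (2 * pi * real (Suc n) * y))) * of_real y powr (s - 1)) sums (\<phi> y * of_real y powr (s - 1))"
        by (intro sums_mult2 series y)
      moreover have "c n * of_real (exp (- (2 * pi * real (Suc n) * y))) * of_real y powr (s - 1) = c n * g (k n) y" for n
        by (simp add: g_def k_def exp_minus divide_inverse mult_ac)
      ultimately have "(\<lambda>n. c n * g (k n) y) sums (\<phi> y * of_real y powr (s - 1))" by (simp only:)
      then show "(\<Sum>n. c n * g (k n) y) = \<phi> y * of_real y powr (s - 1)" by (simp add: sums_iff)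
    qed
    also have "\<dots> = M s" unfolding M_def by (rule eqI[OF absolutely_integrable])
    finally show ?thesis .
  qed
  ultimately have "(\<lambda>n. Gamma s * of_real (2 * pi) powr (- s) * (c n * of_nat (Suc n) powr (- s))) sums M s"
    by (simp only:)
  then have "(\<lambda>n. of_real (2 * pi) powr s * rGamma s * (Gamma s * of_real (2 * pi) powr (- s) * (c n * of_nat (Suc n) powr (- s))))
      sums (of_real (2 * pi) powr s * rGamma s * M s)" by (rule sums_mult)
  moreover have "of_real (2 * pi) powr s * rGamma s * (Gamma s * of_real (2 * pi) powr (- s) * x) = x" for x
  proof -
    have "s \<notin> \<int>\<^sub>\<le>\<^sub>0" using s by (auto elim!: nonpos_Ints_cases)
    then have "rGamma s * Gamma s = 1" by (simp add: rGamma_inverse_Gamma Gamma_eq_zero_iff)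
    moreover have "complex_of_real (2 * pi) powr s * of_real (2 * pi) powr (- s) = 1"
      by (simp add: powr_add[symmetric])
    moreover have "of_real (2 * pi) powr s * rGamma s * (Gamma s * of_real (2 * pi) powr (- s) * x)
       = (rGamma s * Gamma s) * (of_real (2 * pi) powr s * of_real (2 * pi) powr (- s)) * x" by (simp only: mult_ac)
    ultimately show ?thesis by simp
  qed
  ultimately show ?thesis by (simp only:)
qed

end

section \<open>The twisted L-value as a boundary value\<close>

lemma power_le_fact_exp:
  fixes x :: real
  assumes "x \<ge> 0"
  shows "x ^ n \<le> fact n * exp x"
proof -
  have "(\<Sum>k\<in>{n}. x ^ k /\<^sub>R fact k) \<le> (\<Sum>k. x ^ k /\<^sub>R fact k)"
    by (rule sum_le_suminf[OF summable_exp_generic]) (use assms in auto)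
  then have "x ^ n / fact n \<le> exp x" unfolding exp_def by (simp add: divide_inverse mult.commute)
  then show ?thesis by (simp add: divide_le_eq mult.commute)
qed

lemma filterlim_affine_Im:
  assumes "det \<tau> = 1" "\<tau>$2$1 = 0"
  shows "filterlim (mobius \<tau>) (filtercomap Im at_top) (filtercomap Im at_top)"
proof -
  have d: "\<tau>$2$2 \<noteq> 0" using assms by (auto simp: det_2)
  have "LIM y at_top. (1 / (\<tau>$2$2)\<^sup>2) * y :> at_top"
    using d by (intro filterlim_tendsto_pos_mult_at_top[OF tendsto_const]) (auto intro: filterlim_ident)
  then have "LIM z filtercomap Im at_top. (1 / (\<tau>$2$2)\<^sup>2) * Im z :> at_top"
    by (rule filterlim_compose) (rule filterlim_filtercomap)
  moreover have "Im (mobius \<tau> z) = (1 / (\<tau>$2$2)\<^sup>2) * Im z" for z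
    using assms by (simp add: Im_mobius jfac_def)
  ultimately show ?thesis by (simp add: filterlim_filtercomap_iff o_def)
qed

locale weight_2_form = cusp_form +
  fixes \<eta> :: real
  assumes isolated: "isolated1 \<eta> \<Gamma>" and cofinite: "cofinite_subgroup \<Gamma>"
    and width: "cusp_at_infinity_of_width \<Gamma> 1"
begin

lemma None_cusp: "None \<in> cusps \<Gamma>"
  using width by (simp add: cusp_at_infinity_of_width_def)

text \<open>The width condition gives the translation by 1 up to sign only; in weight 2 the sign has
  no effect.\<close>

lemma period_1:
  assumes z: "Im z > 0"
  shows "f (z + 1) = f z"
proof -
  have T: "translation t = mat2 1 t 0 1" for t by (simp add: translation_def mat2_def)
  have "translation 1 \<in> {A. \<exists>n::int. A = translation (of_int n * 1) \<or> A = - translation (of_int n * 1)}"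
    by (auto intro!: exI[of _ 1])
  then have "translation 1 \<in> \<Gamma> \<or> - translation 1 \<in> \<Gamma>"
    using width unfolding cusp_at_infinity_of_width_def by blast
  then show ?thesis
  proof
    assume "translation 1 \<in> \<Gamma>"
    from slash_invariant[OF this z] show ?thesis by (simp add: T slash_def mobius_def jfac_def)
  next
    assume "- translation 1 \<in> \<Gamma>"
    from slash_invariant[OF this z] show ?thesis
      by (simp add: T slash_def mobius_def jfac_def power_int_minus algebra_simps minus_divide_left[symmetric])
  qed
qed

lemma expansion:
  obtains G where "G holomorphic_on ball 0 1" "\<And>z. Im z > 0 \<Longrightarrow> f z = qexp 1 z * G (qexp 1 z)"
proof -
  have "(f \<longlongrightarrow> 0) (filtercomap Im at_top)"
    using slash_tendsto[of "mat 1"] None_cusp by (simp add: mobius_P1.simps)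
  moreover have "f (z + of_real 1) = f z" if "Im z > 0" for z using period_1[OF that] by simp
  ultimately show ?thesis using periodic_expansion[OF holomorphic zero_less_one] that by blast
qed

text \<open>\<sigma> acts as z \<mapsto> r - 1/z and carries i / y to r + i y, so approaching the
  cusp vertically is going up in its coordinate; the automorphy factor accounts for (1 /
  y)^2.\<close>

lemma decay_at_cusp:
  assumes r: "Some r \<in> cusps \<Gamma>"
  obtains c C where "c > 0" "C \<ge> 0"
    "\<And>y. 0 < y \<Longrightarrow> y \<le> 1 \<Longrightarrow> cmod (f (of_real r + \<i> * of_real y)) \<le> C * (1 / y)\<^sup>2 * exp (- (c * (1 / y)))"
proof -
  define \<sigma> where "\<sigma> = mat2 r (-1) 1 0"
  have s: "det \<sigma> = 1" "mobius_P1 \<sigma> None \<in> cusps \<Gamma>"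
    using r by (simp_all add: \<sigma>_def det_2 mobius_P1.simps)
  obtain w C where wC: "w > 0" "C \<ge> 0"
    "\<And>z. Im z \<ge> 1 \<Longrightarrow> cmod (slash 2 f \<sigma> z) \<le> C * exp (- (2 * pi * Im z / w))"
    using slash_decay[OF s zero_less_one] by blast
  show ?thesis
  proof (rule that[of "2 * pi / w" C])
    fix y :: real assume y: "0 < y" "y \<le> 1"
    let ?z = "\<i> / of_real y :: complex"
    have Im: "Im ?z = 1 / y" by simp
    have "mobius \<sigma> ?z = of_real r + \<i> * of_real y"
      using y by (simp add: mobius_def \<sigma>_def field_simps)
    moreover have "cmod (jfac \<sigma> ?z powi (- 2)) = y\<^sup>2"
      using y by (simp add: jfac_def \<sigma>_def power_int_minus norm_inverse norm_power norm_divide power_divide)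
    ultimately have "y\<^sup>2 * cmod (f (of_real r + \<i> * of_real y)) = cmod (slash 2 f \<sigma> ?z)"
      by (simp add: slash_def norm_mult)
    also have "\<dots> \<le> C * exp (- (2 * pi * (1 / y) / w))"
      using wC(3)[of ?z] y unfolding Im by simp
    finally show "cmod (f (of_real r + \<i> * of_real y)) \<le> C * (1 / y)\<^sup>2 * exp (- (2 * pi / w * (1 / y)))"
      using y by (simp add: field_simps)
  qed (use wC in auto)
qed

lemma mellin_vertical:
  assumes r: "Some r \<in> cusps \<Gamma>"
  shows "mellin (\<lambda>y. f (of_real r + \<i> * of_real y))"
proof
  let ?\<phi> = "\<lambda>y. f (of_real r + \<i> * of_real y)"
  have "continuous_on {z. Im z > 0} f" by (rule holomorphic_on_imp_continuous_on[OF holomorphic])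
  then show "continuous_on {0<..} ?\<phi>"
    by (rule continuous_on_compose2) (auto intro!: continuous_intros)
  fix R :: real
  obtain G where G: "G holomorphic_on ball 0 1" "\<And>z. Im z > 0 \<Longrightarrow> f z = qexp 1 z * G (qexp 1 z)"
    using expansion by blast
  obtain C1 where C1: "C1 \<ge> 0" "\<And>z. Im z \<ge> 1 \<Longrightarrow> cmod (f z) \<le> C1 * exp (- (2 * pi * Im z / 1))"
    using periodic_decay[OF G zero_less_one zero_less_one] by blast
  obtain c C2 where C2: "c > 0" "C2 \<ge> 0"
    "\<And>y. 0 < y \<Longrightarrow> y \<le> 1 \<Longrightarrow> cmod (?\<phi> y) \<le> C2 * (1 / y)\<^sup>2 * exp (- (c * (1 / y)))"
    using decay_at_cusp[OF r] by blast
  \<comment> \<open>An integer exponent that dominates |Re s - 1| on the strip.\<close>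
  define m where "m = nat \<lceil>\<bar>R\<bar> + 1\<rceil>"
  have m: "\<bar>R\<bar> + 1 \<le> real m" unfolding m_def by linarith
  \<comment> \<open>With t = 1 / y, t^(m + 2) exp (- c t) is at most (m + 2)! / c^(m + 2). The two
    extra powers come from the automorphy factor, and \<open>exp 1\<close> turns the bound into a
    multiple of exp (-y) for y < 1.\<close>
  define D where "D = C2 * (fact (m + 2) / c ^ (m + 2)) * exp 1"
  have D0: "D \<ge> 0" using C2 by (simp add: D_def)
  have E0: "C1 * fact m \<ge> 0" using C1 by simp
  show "\<exists>C. \<forall>s y. \<bar>Re s\<bar> \<le> R \<longrightarrow> y > 0 \<longrightarrow> cmod (?\<phi> y * of_real y powr (s - 1)) \<le> C * exp (- y)"
  proof (intro exI[of _ "C1 * fact m + D"] allI impI)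
    fix s :: complex and y :: real assume s: "\<bar>Re s\<bar> \<le> R" and y: "y > 0"
    have n: "cmod (of_real y powr (s - 1)) = y powr (Re s - 1)" using y by (simp add: norm_powr_real_powr)
    have ex: "- real m \<le> Re s - 1" "Re s - 1 \<le> real m" using s m by linarith+
    show "cmod (?\<phi> y * of_real y powr (s - 1)) \<le> (C1 * fact m + D) * exp (- y)"
    proof (cases "y \<ge> 1")
      case True
      have f1: "cmod (?\<phi> y) \<le> C1 * exp (- (2 * pi * y))" using C1(2)[of "of_real r + \<i> * of_real y"] True by simp
      have "y powr (Re s - 1) \<le> y powr real m" using ex True by (intro powr_mono) auto
      also have "\<dots> = y ^ m" using y by (simp add: powr_realpow)
      also have "\<dots> \<le> fact m * exp y" by (rule power_le_fact_exp) (use y in simp)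
      finally have "cmod (?\<phi> y) * y powr (Re s - 1) \<le> (C1 * exp (- (2 * pi * y))) * (fact m * exp y)"
        using f1 C1 by (intro mult_mono) auto
      also have "\<dots> = (C1 * fact m) * exp (y - 2 * pi * y)" by (simp add: exp_diff exp_minus field_simps)
      also have "\<dots> \<le> (C1 * fact m) * exp (- y)"
      proof (rule mult_left_mono[OF _ E0])
        have "1 * y \<le> pi * y" using y pi_gt3 by (intro mult_right_mono) auto
        then show "exp (y - 2 * pi * y) \<le> exp (- y)" by simp
      qed
      also have "\<dots> \<le> (C1 * fact m + D) * exp (- y)" using D0 by (intro mult_right_mono) auto
      finally show ?thesis by (simp add: norm_mult n)
    next
      case False
      define t where "t = 1 / y"
      have t: "t > 0" using y by (simp add: t_def)
      have "y powr (Re s - 1) \<le> y powr (- real m)" using ex y False by (intro powr_mono') auto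
      also have "\<dots> = t ^ m" using y by (simp add: t_def powr_minus powr_realpow power_divide divide_inverse power_inverse)
      finally have p: "y powr (Re s - 1) \<le> t ^ m" .
      have "cmod (?\<phi> y) \<le> C2 * t\<^sup>2 * exp (- (c * t))" using C2(3)[of y] y False by (simp add: t_def)
      then have "cmod (?\<phi> y) * y powr (Re s - 1) \<le> (C2 * t\<^sup>2 * exp (- (c * t))) * t ^ m"
        using p C2 by (intro mult_mono) auto
      also have "\<dots> = C2 * (t ^ (m + 2) * exp (- (c * t)))" by (simp add: power_add power2_eq_square mult_ac)
      also have "\<dots> \<le> C2 * (fact (m + 2) / c ^ (m + 2))"
      proof (intro mult_left_mono C2)
        have "(c * t) ^ (m + 2) \<le> fact (m + 2) * exp (c * t)"
          by (rule power_le_fact_exp) (use C2 t in simp)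
        then have "c ^ (m + 2) * t ^ (m + 2) \<le> fact (m + 2) * exp (c * t)" by (simp only: power_mult_distrib)
        then show "t ^ (m + 2) * exp (- (c * t)) \<le> fact (m + 2) / c ^ (m + 2)"
          using C2(1) by (simp add: exp_minus field_simps del: fact_Suc power_Suc)
      qed
      also have "\<dots> = D * exp (- 1)" by (simp add: D_def exp_minus)
      also have "\<dots> \<le> D * exp (- y)" using False D0 by (intro mult_left_mono) auto
      also have "\<dots> \<le> (C1 * fact m + D) * exp (- y)" using E0 by (intro mult_right_mono) auto
      finally show ?thesis by (simp add: norm_mult n)
    qed
  qed
qed

text \<open>The Mellin transform with its Gamma factor is an entire function continuing the series,
  and the identity theorem makes it the only one; at s = 1 the factor (2 pi)^s / Gamma(s) is 2
  pi.\<close>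

lemma twisted_L_eq:
  assumes r: "Some r \<in> cusps \<Gamma>"
  shows "twisted_L f r 1 = 2 * of_real pi * mellin.M (\<lambda>y. f (of_real r + \<i> * of_real y)) 1"
proof -
  let ?\<phi> = "\<lambda>y. f (of_real r + \<i> * of_real y)"
  interpret mellin ?\<phi> by (rule mellin_vertical[OF r])
  let ?a = "fourier_coeff f"
  obtain G where G: "G holomorphic_on ball 0 1" "\<And>z. Im z > 0 \<Longrightarrow> f z = qexp 1 z * G (qexp 1 z)"
    using expansion by blast
  obtain C where C: "C > 0" "\<And>z. Im z > 0 \<Longrightarrow> Im z * cmod (f z) \<le> C"
    using height_bounded[OF isolated cofinite] by blast
  define c where "c n = ?a (Suc n) * fourier_e (of_nat (Suc n) * of_real r)" for n
  have nc: "cmod (c n) = cmod (?a (Suc n))" for n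
    using norm_qexp[of 1 "of_nat (Suc n) * of_real r"] by (simp add: c_def norm_mult qexp_1 del: of_nat_Suc)
  have ex: "exp (- (2 * pi * real (Suc n) * y)) = exp (- (2 * pi * y)) ^ Suc n" for n y
    by (simp add: exp_of_nat_mult[symmetric] mult_ac del: of_nat_Suc power_Suc)
  have series: "(\<lambda>n. c n * of_real (exp (- (2 * pi * real (Suc n) * y)))) sums ?\<phi> y" if y: "y > 0" for y
  proof -
    let ?z = "of_real r + \<i> * of_real y :: complex"
    have "(\<lambda>n. ?a (Suc n) * fourier_e ?z ^ Suc n) sums f ?z"
      using fourier_coeff_sums(1)[OF G] fourier_coeff_sums(2)[OF G, of ?z] y by (subst sums_Suc_iff) simp
    moreover have "fourier_e ?z ^ Suc n = fourier_e (of_nat (Suc n) * of_real r) * of_real (exp (- (2 * pi * real (Suc n) * y)))" for n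
    proof -
      have "fourier_e ?z ^ Suc n = fourier_e (of_nat (Suc n) * ?z)" by (rule fourier_e_mult[symmetric])
      also have "2 * of_real pi * \<i> * (of_nat (Suc n) * ?z) = 2 * of_real pi * \<i> * (of_nat (Suc n) * of_real r)
          + of_real (- (2 * pi * real (Suc n) * y))" by (simp add: algebra_simps del: of_nat_Suc)
      then have "fourier_e (of_nat (Suc n) * ?z) = fourier_e (of_nat (Suc n) * of_real r) * of_real (exp (- (2 * pi * real (Suc n) * y)))"
        unfolding fourier_e_def exp_of_real[symmetric] by (simp only: exp_add)
      finally show ?thesis .
    qed
    ultimately show ?thesis by (simp only: c_def mult.assoc)
  qed
  have abs: "summable (\<lambda>n. cmod (c n) * exp (- (2 * pi * real (Suc n) * y)))" if y: "y > 0" for y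
    unfolding nc ex using fourier_coeff_summable[OF G y]
    by (subst summable_Suc_iff[of "\<lambda>n. cmod (?a n) * exp (- (2 * pi * y)) ^ n"])
  have summ: "summable (\<lambda>n. cmod (c n) * real (Suc n) powr (- Re s))" if s: "Re s > 3/2" for s
  proof -
    have "summable (\<lambda>n. cmod (?a n) * real n powr (- Re s))"
      by (rule dirichlet_summable[where \<alpha> = "3/2" and K = "C * exp (2 * pi)"])
         (use fourier_coeff_sum_bound[OF G C] s in auto)
    then show ?thesis unfolding nc by (subst summable_Suc_iff[of "\<lambda>n. cmod (?a n) * real n powr (- Re s)"])
  qed
  define L where "L s = of_real (2 * pi) powr s * rGamma s * M s" for s
  have Lhol: "L holomorphic_on UNIV" unfolding L_def by (intro holomorphic_intros M_holomorphic)
  have Lsums: "(\<lambda>n. ?a (Suc n) * fourier_e (of_nat (Suc n) * of_real r) * of_nat (Suc n) powr (- s)) sums L s"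
    if s: "Re s > 3/2" for s
    unfolding L_def c_def[symmetric] by (rule dirichlet_series[OF series abs summ[OF s]]) (use s in auto)
  have "twisted_L f r = L"
    unfolding twisted_L_def
  proof (rule the_equality)
    show "L holomorphic_on UNIV \<and> (\<forall>s. Re s > 3/2 \<longrightarrow>
        (\<lambda>n. ?a (Suc n) * fourier_e (of_nat (Suc n) * of_real r) * of_nat (Suc n) powr (- s)) sums L s)"
      using Lhol Lsums by blast
    fix L' assume L': "L' holomorphic_on UNIV \<and> (\<forall>s. Re s > 3/2 \<longrightarrow>
        (\<lambda>n. ?a (Suc n) * fourier_e (of_nat (Suc n) * of_real r) * of_nat (Suc n) powr (- s)) sums L' s)"
    show "L' = L"
    proof
      fix s
      show "L' s = L s"
      proof (rule analytic_continuation_open[of "{s. Re s > 3/2}" UNIV L' L s])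
        have "(2::complex) \<in> {s. Re s > 3/2}" by simp
        then show "{s. Re s > 3/2} \<noteq> ({} :: complex set)" by blast
        show "L' z = L z" if "z \<in> {s. Re s > 3/2}" for z
          using L' Lsums[of z] that sums_unique2 by blast
        show "open {s. Re s > 3/2}" by (rule open_halfspace_Re_gt)
      qed (use L' Lhol in auto)
    qed
  qed
  then show ?thesis by (simp add: L_def)
qed

section \<open>Boundary values of the primitive and their differences\<close>

definition twisted_value :: "P1R \<Rightarrow> complex" where
  "twisted_value r = (case r of None \<Rightarrow> 0 | Some x \<Rightarrow> twisted_L f x 1)"

context
  fixes P :: "complex \<Rightarrow> complex"
  assumes P: "\<And>z. Im z > 0 \<Longrightarrow> (P has_field_derivative f z) (at z)"
    and P_infinity: "(P \<longlongrightarrow> 0) (filtercomap Im at_top)"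
begin

text \<open>The two matrices differ by one that fixes infinity and multiplies heights by a positive
  constant, so the limit belongs to the cusp alone.\<close>

lemma cusp_limit_unique:
  assumes s: "det \<sigma> = 1" "det \<sigma>' = 1" "mobius_P1 \<sigma> None = mobius_P1 \<sigma>' None"
    and V: "((\<lambda>z. P (mobius \<sigma> z)) \<longlongrightarrow> V) (filtercomap Im at_top)"
  shows "((\<lambda>z. P (mobius \<sigma>' z)) \<longlongrightarrow> V) (filtercomap Im at_top)"
proof -
  define \<tau> where "\<tau> = adj2 \<sigma> ** \<sigma>'"
  have t: "det \<tau> = 1" using s by (simp add: \<tau>_def det_mul)
  have "mobius_P1 \<tau> None = mobius_P1 (adj2 \<sigma> ** \<sigma>) None"
    unfolding \<tau>_def using s by (simp add: mobius_P1_mult_None)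
  then have "\<tau>$2$1 = 0" using s(1) by (auto simp: adj2_inverse mobius_P1.simps split: if_splits)
  have st: "\<sigma> ** \<tau> = \<sigma>'" by (simp add: \<tau>_def matrix_mul_assoc adj2_inverse[OF s(1)])
  have "((\<lambda>z. P (mobius \<sigma> (mobius \<tau> z))) \<longlongrightarrow> V) (filtercomap Im at_top)"
    by (rule filterlim_compose[OF V filterlim_affine_Im[OF t \<open>\<tau>$2$1 = 0\<close>]])
  moreover have "eventually (\<lambda>z. P (mobius \<sigma> (mobius \<tau> z)) = P (mobius \<sigma>' z)) (filtercomap Im at_top)"
    using eventually_Im_pos by eventually_elim (use mobius_mult_jfac(2)[OF t] st in metis)
  ultimately show ?thesis by (rule Lim_transform_eventually)
qed

lemma filtercomap_Im_nontrivial: "filtercomap Im at_top \<noteq> bot"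
  by (rule filtercomap_neq_bot_surj) (auto intro!: surjI[of Im "\<lambda>y. Complex 0 y"])

text \<open>At a finite cusp the Mellin integral at s = 1 is the path integral of f dz divided by i:
  the upper end contributes 0, the lower end \<open>V\<close>. At infinity \<open>V\<close> is 0, in
  agreement with the value assigned there.\<close>

lemma twisted_value_eq:
  assumes s: "det \<sigma> = 1" "mobius_P1 \<sigma> None \<in> cusps \<Gamma>"
    and V: "((\<lambda>z. P (mobius \<sigma> z)) \<longlongrightarrow> V) (filtercomap Im at_top)"
  shows "twisted_value (mobius_P1 \<sigma> None) = 2 * of_real pi * \<i> * V"
proof (cases "mobius_P1 \<sigma> None")
  case None
  have "mobius_P1 (mat 1) None = None" by (simp add: mobius_P1.simps)
  then have "((\<lambda>z. P (mobius (mat 1) z)) \<longlongrightarrow> V) (filtercomap Im at_top)"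
    by (intro cusp_limit_unique[OF s(1) _ _ V]) (simp_all add: None)
  then have "V = 0" using P_infinity filtercomap_Im_nontrivial by (simp add: tendsto_unique)
  then show ?thesis by (simp add: None twisted_value_def)
next
  case (Some r)
  define \<sigma>' where "\<sigma>' = mat2 r (-1) 1 0"
  have s': "det \<sigma>' = 1" "mobius_P1 \<sigma>' None = Some r" by (simp_all add: \<sigma>'_def det_2 mobius_P1.simps)
  have V': "((\<lambda>z. P (mobius \<sigma>' z)) \<longlongrightarrow> V) (filtercomap Im at_top)"
    by (rule cusp_limit_unique[OF s(1) s'(1) _ V]) (simp add: Some s')
  have rc: "Some r \<in> cusps \<Gamma>" using s Some by simp
  let ?\<phi> = "\<lambda>y. f (of_real r + \<i> * of_real y)"
  interpret mellin ?\<phi> by (rule mellin_vertical[OF rc])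
  have N: "filterlim (\<lambda>n. real (Suc n)) at_top sequentially"
    using filterlim_real_sequentially filterlim_sequentially_Suc by blast
  have top: "filterlim (\<lambda>n. x + \<i> * of_real (real (Suc n))) (filtercomap Im at_top) sequentially" if "Im x = 0" for x
    using N that by (simp add: filterlim_filtercomap_iff o_def del: of_nat_Suc)
  have up: "(\<lambda>n. P (of_real r + \<i> * of_real (real (Suc n)))) \<longlonglongrightarrow> 0"
    by (rule filterlim_compose[OF P_infinity top]) simp
  \<comment> \<open>The lower end r + i / (n + 1) is the image of i (n + 1) under \<sigma>'.\<close>
  have "(\<lambda>n. P (mobius \<sigma>' (0 + \<i> * of_real (real (Suc n))))) \<longlonglongrightarrow> V"
    by (rule filterlim_compose[OF V' top]) simp
  moreover have "mobius \<sigma>' (0 + \<i> * of_real (real (Suc n))) = of_real r + \<i> * of_real (1 / real (Suc n))" for n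
  proof -
    have "mobius \<sigma>' (\<i> * of_real x) = of_real r + \<i> * of_real (1 / x)" if "x > 0" for x :: real
      using that by (simp add: mobius_def \<sigma>'_def field_simps)
    from this[of "real (Suc n)"] show ?thesis by (simp del: of_nat_Suc)
  qed
  ultimately have down: "(\<lambda>n. P (of_real r + \<i> * of_real (1 / real (Suc n)))) \<longlonglongrightarrow> V" by (simp only:)
  have tr: "trunc n 1 = - \<i> * (P (of_real r + \<i> * of_real (real (Suc n))) - P (of_real r + \<i> * of_real (1 / real (Suc n))))" for n
  proof -
    let ?N = "real (Suc n)"
    have N: "1 / ?N > 0" "1 / ?N \<le> ?N" by (simp_all add: divide_le_eq algebra_simps)
    have "((\<lambda>y. \<i> * ?\<phi> y) has_integral (P (of_real r + \<i> * of_real ?N) - P (of_real r + \<i> * of_real (1 / ?N)))) {1 / ?N..?N}"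
    proof (rule fundamental_theorem_of_calculus[OF N(2)])
      fix y assume "y \<in> {1 / ?N..?N}"
      then have y: "y > 0" using less_le_trans[OF N(1)] by (simp only: atLeastAtMost_iff)
      have "((\<lambda>w. P (of_real r + \<i> * w)) has_field_derivative f (of_real r + \<i> * of_real y) * \<i>) (at (of_real y))"
      proof (rule DERIV_chain2[of P])
        show "(P has_field_derivative f (of_real r + \<i> * of_real y)) (at (of_real r + \<i> * of_real y))"
          by (rule P) (use y in simp)
        show "((\<lambda>w. of_real r + \<i> * w) has_field_derivative \<i>) (at (of_real y))"
          by (auto intro!: derivative_eq_intros)
      qed
      then have "((\<lambda>y. P (of_real r + \<i> * of_real y)) has_vector_derivative f (of_real r + \<i> * of_real y) * \<i>) (at y)"
        by (rule has_vector_derivative_real_field)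
      then show "((\<lambda>y. P (of_real r + \<i> * of_real y)) has_vector_derivative \<i> * ?\<phi> y) (at y within {1 / ?N..?N})"
        by (simp add: mult.commute has_vector_derivative_at_within)
    qed
    then have "((\<lambda>y. - \<i> * (\<i> * ?\<phi> y)) has_integral - \<i> * (P (of_real r + \<i> * of_real ?N) - P (of_real r + \<i> * of_real (1 / ?N)))) {1 / ?N..?N}"
      by (rule has_integral_mult_right)
    then have "integral {1 / ?N..?N} ?\<phi> = - \<i> * (P (of_real r + \<i> * of_real ?N) - P (of_real r + \<i> * of_real (1 / ?N)))"
      by (intro integral_unique) (simp add: mult.assoc[symmetric])
    moreover have "trunc n 1 = integral {1 / ?N..?N} ?\<phi>"
      unfolding trunc_def
    proof (rule integral_cong)
      fix y assume "y \<in> {1 / ?N..?N}"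
      then have "y > 0" using less_le_trans[OF N(1)] by (simp only: atLeastAtMost_iff)
      then show "?\<phi> y * of_real y powr (1 - 1) = ?\<phi> y" by simp
    qed
    ultimately show ?thesis by simp
  qed
  have "(\<lambda>n. trunc n 1) \<longlonglongrightarrow> - \<i> * (0 - V)"
    unfolding tr by (intro tendsto_intros up down)
  then have "M 1 = - \<i> * (0 - V)" using trunc_tendsto LIMSEQ_unique by blast
  then show ?thesis using twisted_L_eq[OF rc] by (simp add: Some twisted_value_def)
qed

text \<open>Infinity and the cusp sent to infinity need no separate cases:
  \<open>twisted_value_eq\<close> holds at every cusp, for any matrix that carries infinity
  there.\<close>

lemma twisted_value_mobius_diff:
  assumes A: "A \<in> \<Gamma>"
  obtains c where "\<And>r. r \<in> cusps \<Gamma> \<Longrightarrow> twisted_value (mobius_P1 A r) - twisted_value r = c"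
proof -
  have dA: "det A = 1" by (rule det_eq_1[OF A])
  let ?H = "{z. Im z > 0}"
  have "((\<lambda>z. P (mobius A z) - P z) has_field_derivative 0) (at z within ?H)" if "z \<in> ?H" for z
  proof -
    have z: "Im z > 0" using that by simp
    have "((\<lambda>z. P (mobius A z) - P z) has_field_derivative slash 2 f A z - f z) (at z)"
      by (intro DERIV_diff P[OF z] primitive_slash[OF P] dA z)
    then show ?thesis by (simp add: has_field_derivative_at_within slash_invariant[OF A z])
  qed
  then obtain k where k: "\<And>z. z \<in> ?H \<Longrightarrow> P (mobius A z) - P z = k"
    using has_field_derivative_zero_constant[OF convex_halfspace_Im_gt, of 0 "\<lambda>z. P (mobius A z) - P z"] by blast
  show ?thesis
  proof (rule that[of "2 * of_real pi * \<i> * k"])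
    fix r assume r: "r \<in> cusps \<Gamma>"
    obtain \<sigma> where s: "det \<sigma> = 1" "mobius_P1 \<sigma> None = r" by (rule mobius_P1_transitive)
    have sc: "mobius_P1 \<sigma> None \<in> cusps \<Gamma>" using r s by simp
    obtain V where V: "((\<lambda>z. P (mobius \<sigma> z)) \<longlongrightarrow> V) (filtercomap Im at_top)"
      using cusp_limit[OF P s(1) sc] by blast
    \<comment> \<open>A \<sigma> carries infinity to the cusp A r, and along it \<open>P\<close>
      tends to V + k.\<close>
    have As: "det (A ** \<sigma>) = 1" "mobius_P1 (A ** \<sigma>) None = mobius_P1 A r"
      using s dA by (simp_all add: det_mul mobius_P1_mult_None)
    have "((\<lambda>z. P (mobius \<sigma> z) + k) \<longlongrightarrow> V + k) (filtercomap Im at_top)" by (intro tendsto_intros V)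
    moreover have "eventually (\<lambda>z. P (mobius \<sigma> z) + k = P (mobius (A ** \<sigma>) z)) (filtercomap Im at_top)"
      using eventually_Im_pos
    proof eventually_elim
      case (elim z)
      then show ?case using k[of "mobius \<sigma> z"] mobius_upper[OF s(1) elim]
        by (simp add: mobius_mult_jfac(2)[OF s(1)] algebra_simps)
    qed
    ultimately have "((\<lambda>z. P (mobius (A ** \<sigma>) z)) \<longlongrightarrow> V + k) (filtercomap Im at_top)"
      by (rule Lim_transform_eventually)
    then have "twisted_value (mobius_P1 A r) = 2 * of_real pi * \<i> * (V + k)"
      using twisted_value_eq[OF As(1)] cusps_mobius[OF group A r] As(2) by simp
    moreover have "twisted_value r = 2 * of_real pi * \<i> * V" using twisted_value_eq[OF s(1) sc V] s(2) by simp
    ultimately show "twisted_value (mobius_P1 A r) - twisted_value r = 2 * of_real pi * \<i> * k" by (simp add: algebra_simps)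
  qed
qed

end

lemma quantum_modular: "quantum_modular_form 0 \<Gamma> {} twisted_value"
  unfolding quantum_modular_form_def
proof (intro conjI ballI)
  fix A assume A: "A \<in> \<Gamma>"
  obtain G where G: "G holomorphic_on ball 0 1" "\<And>z. Im z > 0 \<Longrightarrow> f z = qexp 1 z * G (qexp 1 z)"
    using expansion by blast
  obtain P where "\<And>z. Im z > 0 \<Longrightarrow> (P has_field_derivative f z) (at z)" "(P \<longlongrightarrow> 0) (filtercomap Im at_top)"
    using periodic_primitive[OF G zero_less_one] by blast
  then obtain c where "\<And>r. r \<in> cusps \<Gamma> \<Longrightarrow> twisted_value (mobius_P1 A r) - twisted_value r = c"
    using twisted_value_mobius_diff A by blast
  then show "\<exists>G. continuous_map (subtopology P1R_topology (UNIV - ({} \<union> mobius_P1 A -` {}))) euclidean G \<and>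
      (\<forall>r\<in>cusps \<Gamma> - ({} \<union> mobius_P1 A -` {}). G r = twisted_value (mobius_P1 A r) - jfac_P1 A r powi 0 * twisted_value r)"
    \<comment> \<open>In weight 0 the factor \<open>jfac_P1 A r powi 0\<close> is 1 even where
      \<open>jfac_P1\<close> vanishes, so the same constant serves at every cusp.\<close>
    by (intro exI[of _ "\<lambda>_. c"]) simp
qed simp

end

theorem theorem4p8:
  fixes \<Gamma> :: "(real^2^2) set" and f :: "complex \<Rightarrow> complex"
  assumes "discrete_subgroup \<Gamma>"
    and "cofinite_subgroup \<Gamma>"
    and "cusp_at_infinity_of_width \<Gamma> 1"
    and "f \<in> cusp_forms 2 \<Gamma>"
  shows "quantum_modular_form 0 \<Gamma> {}
           (\<lambda>r. case r of None \<Rightarrow> 0 | Some x \<Rightarrow> twisted_L f x 1)"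
proof -
  obtain \<eta> where eta: "isolated1 \<eta> \<Gamma>" using discrete_subgroup_matgroup(2)[OF assms(1)] by blast
  interpret weight_2_form \<Gamma> f \<eta>
    using discrete_subgroup_matgroup(1)[OF assms(1)] eta assms(2-4) by unfold_locales
  show ?thesis using quantum_modular unfolding twisted_value_def[abs_def] .
qed

end
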